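(* Let $V^*$ be a Lefschetz module over $E$ with center $(n+1)/2$ with a three step filtration by objects of ${\mathbb M}$: $$0\hookrightarrow F^2V^*\hookrightarrow F^1 V^*\hookrightarrow F^0V^*=V^*$$ such that their graded quotients $G^iV:=F^iV/F^{i+1}V$ are Lefschetz modules of center $(n+i)/2$. Then there is a unique splitting of filtered $E$-modules $$\alpha: G^0V^*\oplus G^1V^*\oplus G^2V^*\xrightarrow{\ \sim\ } V^*$$ such that the following hold for the restrictions $\alpha^i=\alpha |_{G^iV^*}: G^iV^*\to F^iV^*$: \begin{enumerate} \item $\alpha^1: G^1V^*\to V^*$ is $\mathsf{L}$-linear; \item $\alpha^0: G^0V^*\to V^*$ is $\mathsf{L}$-linear when taken modulo $\mathrm{Im}\, \alpha ^2$ and $\mathsf{\Lambda}$-linear when taken modulo $\mathrm{Im}\,\alpha ^1$. \end{enumerate} Moreover there is an isomorphism $\beta: G^0V^*\to G^2V^{*+1}$ of $\mathsf{L}$-modules such that $\alpha$ translates the $E[\mathsf{L}, \mathsf{\Lambda}]$-module structure on $V^*$ into the following $E[\mathsf{L}, \mathsf{\Lambda}]$-module structure on $\bigoplus_i G^iV^*$: for $x^i\in G^iV^*$, $$\mathsf{L}(x^0, x^1, x^2)=(\mathsf{L}x^0,\ \mathsf{L}x^1,\ \beta x^0+\mathsf{L}x^2),\qquad \mathsf{\Lambda}(x^0, x^1, x^2)=(\mathsf{\Lambda}x^0+\beta^{-1}x^2,\ \mathsf{\Lambda}x^1,\ \mathsf{\Lambda}x^2),$$ i.e. in matrix form (acting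 on the column vector $(x^0,x^1,x^2)^T$) $\mathsf{L}$ is given by the matrix with rows $(\mathsf{L},0,0)$, $(0,\mathsf{L},0)$, $(\beta,0,\mathsf{L})$ and $\mathsf{\Lambda}$ by the matrix with rows $(\mathsf{\Lambda},0,\beta^{-1})$, $(0,\mathsf{\Lambda},0)$, $(0,0,\mathsf{\Lambda})$.
   Context: $E$ is a field of characteristic $0$. ${\mathbb M}$ denotes the abelian category of graded $E$-vector spaces $V^*=\bigoplus_{i\in{\mathbb Z}}V^i$ with $V^i=0$ for $|i|\gg 0$, equipped with a linear operator $\mathsf{L}$ of degree $1$, $\mathsf{L}: V^*\to V^{*+1}$. A Lefschetz module with center $n/2$ is an object $V^*$ of ${\mathbb M}$ such that $\mathsf{L}^{n-2i}: V^i\to V^{n-i}$ is an isomorphism for all $i$ (with $i\le n/2$). On any Lefschetz module with center $n/2$ there is a unique operator $\mathsf{\Lambda}$ of degree $-1$ such that $[\mathsf{\Lambda},\mathsf{L}]|_{V^i}=n-2i$; this is the $\mathsf{\Lambda}$ used on $V^*$ (center $(n+1)/2$) and on each $G^iV^*$ (center $(n+i)/2$). *)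

theory Defs
  imports "HOL-Algebra.Module" "HOL-Algebra.AbelCoset"
begin

section \<open>Linear maps, quotients and direct sums of modules\<close>

definition linear_maps ::
  "('e, 'r) ring_scheme \<Rightarrow> ('e, 'a, 'm) module_scheme \<Rightarrow> ('e, 'b, 'n) module_scheme \<Rightarrow> ('a \<Rightarrow> 'b) set"
  where "linear_maps R M N = {f \<in> carrier M \<rightarrow> carrier N.
    (\<forall>x \<in> carrier M. \<forall>y \<in> carrier M. f (x \<oplus>\<^bsub>M\<^esub> y) = f x \<oplus>\<^bsub>N\<^esub> f y) \<and>
    (\<forall>a \<in> carrier R. \<forall>x \<in> carrier M. f (a \<odot>\<^bsub>M\<^esub> x) = a \<odot>\<^bsub>N\<^esub> f x)}"

definition linear_isos ::
  "('e, 'r) ring_scheme \<Rightarrow> ('e, 'a, 'm) module_scheme \<Rightarrow> ('e, 'b, 'n) module_scheme \<Rightarrow> ('a \<Rightarrow> 'b) set"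
  where "linear_isos R M N = {f \<in> linear_maps R M N. bij_betw f (carrier M) (carrier N)}"

text \<open>
  The record type of modules extends that of rings; a module makes no use of the fields
  \<open>mult\<close> and \<open>one\<close>, which are therefore left undefined below. In the quotient, the scalar
  multiple of a coset is the coset \<open>N + a X\<close>; adding \<open>N\<close> only matters when \<open>a X\<close>
  is not already a full coset, e.g. for \<open>a = 0\<close>.
\<close>

definition quot_module ::
  "('e, 'a, 'm) module_scheme \<Rightarrow> 'a set \<Rightarrow> ('e, 'a set) module"
  where "quot_module M N =
    \<lparr>carrier = a_rcosets\<^bsub>M\<^esub> N, mult = undefined, one = undefined,
     zero = N, add = (\<lambda>X Y. X <+>\<^bsub>M\<^esub> Y),
     smult = (\<lambda>a X. N <+>\<^bsub>M\<^esub> ((\<lambda>x. a \<odot>\<^bsub>M\<^esub> x) ` X))\<rparr>"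

definition direct_sum3 ::
  "('e, 'a) module \<Rightarrow> ('e, 'b) module \<Rightarrow> ('e, 'c) module \<Rightarrow> ('e, 'a \<times> 'b \<times> 'c) module"
  where "direct_sum3 A B C =
    \<lparr>carrier = carrier A \<times> carrier B \<times> carrier C, mult = undefined, one = undefined,
     zero = (\<zero>\<^bsub>A\<^esub>, \<zero>\<^bsub>B\<^esub>, \<zero>\<^bsub>C\<^esub>),
     add = (\<lambda>(x0, x1, x2) (y0, y1, y2). (x0 \<oplus>\<^bsub>A\<^esub> y0, x1 \<oplus>\<^bsub>B\<^esub> y1, x2 \<oplus>\<^bsub>C\<^esub> y2)),
     smult = (\<lambda>a (x0, x1, x2). (a \<odot>\<^bsub>A\<^esub> x0, a \<odot>\<^bsub>B\<^esub> x1, a \<odot>\<^bsub>C\<^esub> x2))\<rparr>"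


section \<open>Lefschetz modules\<close>

text \<open>
  A graded space is the family \<open>V\<close> of its homogeneous components, and an operator of degree
  \<open>d\<close> is a family of maps, the \<open>j\<close>-th one going from \<open>V j\<close> to \<open>V (j + d)\<close>.
\<close>

definition graded_L_space ::
  "('e, 'r) ring_scheme \<Rightarrow> (int \<Rightarrow> ('e, 'v) module) \<Rightarrow> (int \<Rightarrow> 'v \<Rightarrow> 'v) \<Rightarrow> bool"
  where "graded_L_space E V L \<longleftrightarrow>
    (\<forall>j. module E (V j)) \<and>
    (\<exists>N. \<forall>j. \<bar>j\<bar> > N \<longrightarrow> carrier (V j) = {\<zero>\<^bsub>V j\<^esub>}) \<and>
    (\<forall>j. L j \<in> linear_maps E (V j) (V (j + 1)))"

text \<open>\<open>L_power L k j\<close> is the restriction of the \<open>k\<close>-th power of \<open>L\<close> to degree \<open>j\<close>.\<close>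

fun L_power :: "(int \<Rightarrow> 'v \<Rightarrow> 'v) \<Rightarrow> nat \<Rightarrow> int \<Rightarrow> 'v \<Rightarrow> 'v"
  where
    "L_power L 0 j x = x"
  | "L_power L (Suc k) j x = L (j + int k) (L_power L k j x)"

text \<open>
  \<open>lefschetz_module E V L n\<close> says that \<open>(V, L)\<close> is a Lefschetz module with center \<open>n / 2\<close>:
  the integer parameter is twice the center. The same convention applies to \<open>Lambda_op\<close>.
\<close>

definition lefschetz_module ::
  "('e, 'r) ring_scheme \<Rightarrow> (int \<Rightarrow> ('e, 'v) module) \<Rightarrow> (int \<Rightarrow> 'v \<Rightarrow> 'v) \<Rightarrow> int \<Rightarrow> bool"
  where "lefschetz_module E V L n \<longleftrightarrow>
    graded_L_space E V L \<and>
    (\<forall>i. 2 * i \<le> n \<longrightarrow>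
      L_power L (nat (n - 2 * i)) i \<in> linear_isos E (V i) (V (n - i)))"

text \<open>
  The operator of degree \<open>-1\<close> whose commutator with \<open>L\<close> is \<open>n - 2 j\<close> in degree \<open>j\<close>.
  It is unique as an operator on the components, hence as a family of functions once their
  values outside the carriers are normalised by \<^const>\<open>extensional\<close>.
\<close>

definition is_Lambda ::
  "('e, 'r) ring_scheme \<Rightarrow> (int \<Rightarrow> ('e, 'v) module) \<Rightarrow> (int \<Rightarrow> 'v \<Rightarrow> 'v) \<Rightarrow> int \<Rightarrow>
    (int \<Rightarrow> 'v \<Rightarrow> 'v) \<Rightarrow> bool"
  where "is_Lambda E V L n D \<longleftrightarrow>
    (\<forall>j. D j \<in> linear_maps E (V j) (V (j - 1)) \<inter> extensional (carrier (V j))) \<and>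
    (\<forall>j. \<forall>x \<in> carrier (V j).
      D (j + 1) (L j x) \<ominus>\<^bsub>V j\<^esub> L (j - 1) (D j x) = add_pow (V j) (n - 2 * j) x)"

definition Lambda_op ::
  "('e, 'r) ring_scheme \<Rightarrow> (int \<Rightarrow> ('e, 'v) module) \<Rightarrow> (int \<Rightarrow> 'v \<Rightarrow> 'v) \<Rightarrow> int \<Rightarrow>
    (int \<Rightarrow> 'v \<Rightarrow> 'v)"
  where "Lambda_op E V L n = (THE D. is_Lambda E V L n D)"


section \<open>Three step filtrations, graded quotients and splittings\<close>

definition three_step_filtration ::
  "('e, 'r) ring_scheme \<Rightarrow> (int \<Rightarrow> ('e, 'v) module) \<Rightarrow> (int \<Rightarrow> 'v \<Rightarrow> 'v) \<Rightarrow>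
    (nat \<Rightarrow> int \<Rightarrow> 'v set) \<Rightarrow> bool"
  where "three_step_filtration E V L F \<longleftrightarrow>
    (\<forall>i j. submodule (F i j) E (V j)) \<and>
    (\<forall>i j. L j ` F i j \<subseteq> F i (j + 1)) \<and>
    (\<forall>i j. F (i + 1) j \<subseteq> F i j) \<and>
    (\<forall>j. F 0 j = carrier (V j)) \<and>
    (\<forall>i j. i \<ge> 3 \<longrightarrow> F i j = {\<zero>\<^bsub>V j\<^esub>})"

definition Gr ::
  "(int \<Rightarrow> ('e, 'v) module) \<Rightarrow> (nat \<Rightarrow> int \<Rightarrow> 'v set) \<Rightarrow> nat \<Rightarrow> int \<Rightarrow> ('e, 'v set) module"
  where "Gr V F i j = quot_module ((V j)\<lparr>carrier := F i j\<rparr>) (F (i + 1) j)"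

text \<open>The operator induced on the quotient: the coset of \<open>x\<close> goes to the coset of \<open>L j x\<close>.\<close>

definition Gr_L ::
  "(int \<Rightarrow> ('e, 'v) module) \<Rightarrow> (int \<Rightarrow> 'v \<Rightarrow> 'v) \<Rightarrow> (nat \<Rightarrow> int \<Rightarrow> 'v set) \<Rightarrow>
    nat \<Rightarrow> int \<Rightarrow> 'v set \<Rightarrow> 'v set"
  where "Gr_L V L F i j X = F (i + 1) (j + 1) <+>\<^bsub>V (j + 1)\<^esub> (L j ` X)"

definition Gr_Lambda ::
  "('e, 'r) ring_scheme \<Rightarrow> (int \<Rightarrow> ('e, 'v) module) \<Rightarrow> (int \<Rightarrow> 'v \<Rightarrow> 'v) \<Rightarrow>
    (nat \<Rightarrow> int \<Rightarrow> 'v set) \<Rightarrow> int \<Rightarrow> nat \<Rightarrow> int \<Rightarrow> 'v set \<Rightarrow> 'v set"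
  where "Gr_Lambda E V L F n i = Lambda_op E (Gr V F i) (Gr_L V L F i) (n + int i)"

definition Gr_sum ::
  "(int \<Rightarrow> ('e, 'v) module) \<Rightarrow> (nat \<Rightarrow> int \<Rightarrow> 'v set) \<Rightarrow>
    int \<Rightarrow> ('e, 'v set \<times> 'v set \<times> 'v set) module"
  where "Gr_sum V F j = direct_sum3 (Gr V F 0 j) (Gr V F 1 j) (Gr V F 2 j)"

definition Gr_sum_filtration ::
  "(int \<Rightarrow> ('e, 'v) module) \<Rightarrow> (nat \<Rightarrow> int \<Rightarrow> 'v set) \<Rightarrow>
    nat \<Rightarrow> int \<Rightarrow> ('v set \<times> 'v set \<times> 'v set) set"
  where "Gr_sum_filtration V F k j = {(x0, x1, x2) \<in> carrier (Gr_sum V F j).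
    (0 < k \<longrightarrow> x0 = \<zero>\<^bsub>Gr V F 0 j\<^esub>) \<and>
    (1 < k \<longrightarrow> x1 = \<zero>\<^bsub>Gr V F 1 j\<^esub>) \<and>
    (2 < k \<longrightarrow> x2 = \<zero>\<^bsub>Gr V F 2 j\<^esub>)}"

definition Gr_incl ::
  "(int \<Rightarrow> ('e, 'v) module) \<Rightarrow> (nat \<Rightarrow> int \<Rightarrow> 'v set) \<Rightarrow>
    nat \<Rightarrow> int \<Rightarrow> 'v set \<Rightarrow> 'v set \<times> 'v set \<times> 'v set"
  where "Gr_incl V F i j x =
    (if i = 0 then x else \<zero>\<^bsub>Gr V F 0 j\<^esub>,
     if i = 1 then x else \<zero>\<^bsub>Gr V F 1 j\<^esub>,
     if i = 2 then x else \<zero>\<^bsub>Gr V F 2 j\<^esub>)"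

definition restr_Gr ::
  "(int \<Rightarrow> ('e, 'v) module) \<Rightarrow> (nat \<Rightarrow> int \<Rightarrow> 'v set) \<Rightarrow>
    (int \<Rightarrow> 'v set \<times> 'v set \<times> 'v set \<Rightarrow> 'v) \<Rightarrow> nat \<Rightarrow> int \<Rightarrow> 'v set \<Rightarrow> 'v"
  where "restr_Gr V F \<alpha> i j x = \<alpha> j (Gr_incl V F i j x)"

text \<open>
  A splitting is a degree-preserving isomorphism of filtered modules that induces the identity
  on each graded quotient: the class of \<open>\<alpha>\<^sup>i x\<close> in \<open>F i j / F (i + 1) j\<close> is \<open>x\<close> itself.
\<close>

definition filtered_splitting ::
  "('e, 'r) ring_scheme \<Rightarrow> (int \<Rightarrow> ('e, 'v) module) \<Rightarrow> (nat \<Rightarrow> int \<Rightarrow> 'v set) \<Rightarrow>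
    (int \<Rightarrow> 'v set \<times> 'v set \<times> 'v set \<Rightarrow> 'v) \<Rightarrow> bool"
  where "filtered_splitting E V F \<alpha> \<longleftrightarrow>
    (\<forall>j. \<alpha> j \<in> linear_isos E (Gr_sum V F j) (V j) \<inter> extensional (carrier (Gr_sum V F j))) \<and>
    (\<forall>k j. \<alpha> j ` Gr_sum_filtration V F k j = F k j) \<and>
    (\<forall>i\<le>2. \<forall>j. \<forall>x \<in> carrier (Gr V F i j). F (i + 1) j +>\<^bsub>V j\<^esub> restr_Gr V F \<alpha> i j x = x)"

text \<open>
  Linearity modulo a subspace: the defect of commutation lies in that subspace. Here \<open>n + 1\<close>
  is twice the center of \<open>V\<close>, and \<open>n + i\<close> is twice the center of the \<open>i\<close>-th graded quotient.
\<close>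

definition adapted_splitting ::
  "('e, 'r) ring_scheme \<Rightarrow> (int \<Rightarrow> ('e, 'v) module) \<Rightarrow> (int \<Rightarrow> 'v \<Rightarrow> 'v) \<Rightarrow>
    (nat \<Rightarrow> int \<Rightarrow> 'v set) \<Rightarrow> int \<Rightarrow> (int \<Rightarrow> 'v set \<times> 'v set \<times> 'v set \<Rightarrow> 'v) \<Rightarrow> bool"
  where "adapted_splitting E V L F n \<alpha> \<longleftrightarrow>
    filtered_splitting E V F \<alpha> \<and>
    (\<forall>j. \<forall>x \<in> carrier (Gr V F 1 j).
      restr_Gr V F \<alpha> 1 (j + 1) (Gr_L V L F 1 j x) = L j (restr_Gr V F \<alpha> 1 j x)) \<and>
    (\<forall>j. \<forall>x \<in> carrier (Gr V F 0 j).
      restr_Gr V F \<alpha> 0 (j + 1) (Gr_L V L F 0 j x) \<ominus>\<^bsub>V (j + 1)\<^esub> L j (restr_Gr V F \<alpha> 0 j x)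
        \<in> restr_Gr V F \<alpha> 2 (j + 1) ` carrier (Gr V F 2 (j + 1))) \<and>
    (\<forall>j. \<forall>x \<in> carrier (Gr V F 0 j).
      restr_Gr V F \<alpha> 0 (j - 1) (Gr_Lambda E V L F n 0 j x)
          \<ominus>\<^bsub>V (j - 1)\<^esub> Lambda_op E V L (n + 1) j (restr_Gr V F \<alpha> 0 j x)
        \<in> restr_Gr V F \<alpha> 1 (j - 1) ` carrier (Gr V F 1 (j - 1)))"

end

theory Submission
  imports Defs
begin

text \<open>
  Everything rests on one vanishing principle: a map of degree \<open>0\<close> commuting with \<open>L\<close> from a
  Lefschetz module with center \<open>a / 2\<close> to one with center \<open>b / 2\<close> is zero if \<open>a < b\<close>, because a Lefschetz
  module is generated under \<open>L\<close> by primitive elements. Shifting degrees turns statements about maps of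
  degree \<open>- 1\<close> into this form; uniqueness of \<open>\<Lambda>\<close> is an instance.

  Write \<open>b : F1 \<rightarrow> G0\<close> for the map of degree \<open>- 1\<close> induced by the operator \<open>\<Lambda>\<close> of \<open>V\<close>. It commutes with
  \<open>L\<close>, and its restriction to \<open>F2 = G2\<close> is an isomorphism: both sides have the same center after the
  shift, and on primitive elements this follows from the commutator of \<open>\<Lambda>\<close> and \<open>L\<^sup>k\<close>. Let \<open>\<beta>\<close> be its inverse.
  Then \<open>F1\<close> is the direct sum of \<open>F2\<close> and the kernel of \<open>b\<close>, which gives \<open>\<alpha>1\<close>, and
  \<open>\<alpha>0 = \<Lambda> \<beta> - \<Lambda>2 \<beta>\<close>, where \<open>\<Lambda>2\<close> belongs to \<open>G2\<close>, satisfies \<open>L \<alpha>0 = \<alpha>0 L + \<beta>\<close>. The remaining relations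
  and the uniqueness of the splitting are again instances of the vanishing principle.
\<close>


section \<open>Linear maps\<close>

text \<open>The bookkeeping is in doubled centers: G0, G1, G2 have n, n + 1, n + 2, and V has n + 1.
  A map of degree -1 is read as one of degree 0 into a shifted space, whose doubled center is larger
  by 2. For b : G2 -> G0 both sides then have n + 2, so the vanishing principle is silent, and that
  V itself is a Lefschetz module has to be used. On the primitive vectors concerned, the commutator
  of \<Lambda> with L^(w+1) has coefficient w + 1 up to sign, because the doubled center of V
  differs by one from those of G0 and G2. This integer is invertible in characteristic 0. The same
  difference by one produces the entry \<beta> in the matrix of L. Two candidates for \<alpha>0 that
  satisfy the condition on L still may differ by a map with values in G2, since that condition is
  taken modulo G2. The condition on \<Lambda> removes this freedom: p0 \<Lambda> applied to the
  difference gives b of its G2-value, and b is injective there.\<close>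

lemma linear_mapsI:
  assumes "\<And>x. x \<in> carrier M \<Longrightarrow> f x \<in> carrier N"
    and "\<And>x y. x \<in> carrier M \<Longrightarrow> y \<in> carrier M \<Longrightarrow> f (x \<oplus>\<^bsub>M\<^esub> y) = f x \<oplus>\<^bsub>N\<^esub> f y"
    and "\<And>a x. a \<in> carrier R \<Longrightarrow> x \<in> carrier M \<Longrightarrow> f (a \<odot>\<^bsub>M\<^esub> x) = a \<odot>\<^bsub>N\<^esub> f x"
  shows "f \<in> linear_maps R M N"
  using assms by (auto simp: linear_maps_def)

lemma linear_maps_closed: "f \<in> linear_maps R M N \<Longrightarrow> x \<in> carrier M \<Longrightarrow> f x \<in> carrier N"
  and linear_maps_add: "f \<in> linear_maps R M N \<Longrightarrow> x \<in> carrier M \<Longrightarrow> y \<in> carrier M \<Longrightarrow>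
    f (x \<oplus>\<^bsub>M\<^esub> y) = f x \<oplus>\<^bsub>N\<^esub> f y"
  and linear_maps_smult: "f \<in> linear_maps R M N \<Longrightarrow> a \<in> carrier R \<Longrightarrow> x \<in> carrier M \<Longrightarrow>
    f (a \<odot>\<^bsub>M\<^esub> x) = a \<odot>\<^bsub>N\<^esub> f x"
  by (auto simp: linear_maps_def)

lemma linear_maps_cong:
  assumes "\<And>x. x \<in> carrier M \<Longrightarrow> f x = g x" "f \<in> linear_maps R M N" "module R M"
  shows "g \<in> linear_maps R M N"
proof -
  interpret module R M by fact
  show ?thesis using assms(1,2) by (auto simp: linear_maps_def simp flip: assms(1))
qed

lemma linear_maps_comp:
  "f \<in> linear_maps R M N \<Longrightarrow> g \<in> linear_maps R N P \<Longrightarrow> (\<lambda>x. g (f x)) \<in> linear_maps R M P"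
  by (rule linear_mapsI) (simp_all add: linear_maps_closed linear_maps_add linear_maps_smult)

lemma linear_maps_hom:
  assumes "module R M" "module R N" "f \<in> linear_maps R M N"
  shows "abelian_group_hom M N f"
proof -
  interpret M: module R M by fact
  interpret N: module R N by fact
  show ?thesis
    by unfold_locales (use assms(3) in \<open>auto simp: hom_def linear_maps_def\<close>)
qed

lemma linear_maps_zero:
  assumes "module R M" "module R N" "f \<in> linear_maps R M N"
  shows "f \<zero>\<^bsub>M\<^esub> = \<zero>\<^bsub>N\<^esub>"
  using abelian_group_hom.hom_zero[OF linear_maps_hom[OF assms]] .

lemma linear_maps_a_inv:
  assumes "module R M" "module R N" "f \<in> linear_maps R M N" "x \<in> carrier M"
  shows "f (\<ominus>\<^bsub>M\<^esub> x) = \<ominus>\<^bsub>N\<^esub> f x"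
  using abelian_group_hom.hom_a_inv[OF linear_maps_hom[OF assms(1-3)] assms(4)] .

lemma linear_maps_minus:
  assumes "module R M" "module R N" "f \<in> linear_maps R M N" "x \<in> carrier M" "y \<in> carrier M"
  shows "f (x \<ominus>\<^bsub>M\<^esub> y) = f x \<ominus>\<^bsub>N\<^esub> f y"
proof -
  interpret M: module R M by fact
  show ?thesis using assms
    by (simp add: a_minus_def linear_maps_add linear_maps_a_inv)
qed

lemma linear_maps_add_pow:
  fixes k :: int
  assumes "module R M" "module R N" "f \<in> linear_maps R M N" "x \<in> carrier M"
  shows "f (add_pow M k x) = add_pow N k (f x)"
proof -
  interpret f: abelian_group_hom M N f by (rule linear_maps_hom[OF assms(1-3)])
  interpret group_hom "add_monoid M" "add_monoid N" f
    using f.a_group_hom by simp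
  show ?thesis using assms(4) hom_int_pow[of x k] by (simp add: add_pow_def)
qed

lemma (in module) add_pow_smult:
  fixes k :: int
  assumes "a \<in> carrier R" "x \<in> carrier M"
  shows "add_pow M k (a \<odot>\<^bsub>M\<^esub> x) = a \<odot>\<^bsub>M\<^esub> add_pow M k x"
  by (rule linear_maps_add_pow[OF module_axioms module_axioms, of "\<lambda>x. a \<odot>\<^bsub>M\<^esub> x", symmetric])
    (use assms in \<open>auto simp: smult_r_distr m_comm simp flip: smult_assoc1 intro!: linear_mapsI\<close>)

text \<open>Commutators produce integer multiples, whereas division takes place in the field. For
  fixed x, scaling x is a homomorphism of additive groups from R to M, and this translates one into
  the other.\<close>

lemma (in module) add_pow_eq_smult:
  fixes k :: int
  assumes "x \<in> carrier M"
  shows "add_pow M k x = add_pow R k \<one> \<odot>\<^bsub>M\<^esub> x"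
proof -
  interpret group_hom "add_monoid R" "add_monoid M" "\<lambda>a. a \<odot>\<^bsub>M\<^esub> x"
    by (intro group_hom.intro R.a_group M.a_group group_hom_axioms.intro)
      (use assms in \<open>auto simp: hom_def smult_l_distr\<close>)
  show ?thesis using hom_int_pow[of \<one> k] assms by (simp add: add_pow_def)
qed

lemma linear_maps_plus:
  assumes "module R N" "f \<in> linear_maps R M N" "g \<in> linear_maps R M N" "module R M"
  shows "(\<lambda>x. f x \<oplus>\<^bsub>N\<^esub> g x) \<in> linear_maps R M N"
proof -
  interpret N: module R N by fact
  show ?thesis
    by (rule linear_mapsI) (use assms in \<open>auto simp: linear_maps_closed linear_maps_add
      linear_maps_smult N.smult_r_distr N.a_ac\<close>)
qed

lemma linear_maps_diff:
  assumes "module R N" "f \<in> linear_maps R M N" "g \<in> linear_maps R M N" "module R M"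
  shows "(\<lambda>x. f x \<ominus>\<^bsub>N\<^esub> g x) \<in> linear_maps R M N"
proof -
  interpret N: module R N by fact
  show ?thesis
    by (rule linear_mapsI) (use assms in \<open>auto simp: a_minus_def linear_maps_closed linear_maps_add
      linear_maps_smult N.smult_r_distr N.a_ac N.minus_add N.smult_r_minus\<close>)
qed

lemma linear_maps_add_pow_map:
  fixes k :: int
  assumes "module R N" "f \<in> linear_maps R M N" "module R M"
  shows "(\<lambda>x. add_pow N k (f x)) \<in> linear_maps R M N"
proof -
  interpret N: module R N by fact
  show ?thesis
    by (rule linear_mapsI) (use assms in \<open>auto simp: linear_maps_closed linear_maps_add
      linear_maps_smult N.add_pow_smult N.add.int_pow_distrib\<close>)
qed

lemma linear_maps_zero_map:
  assumes "module R N"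
  shows "(\<lambda>x. \<zero>\<^bsub>N\<^esub>) \<in> linear_maps R M N"
proof -
  interpret N: module R N by fact
  show ?thesis by (rule linear_mapsI) auto
qed

lemma linear_isosD:
  assumes "f \<in> linear_isos R M N"
  shows "f \<in> linear_maps R M N" "bij_betw f (carrier M) (carrier N)"
  using assms by (auto simp: linear_isos_def)

lemma linear_isos_inv:
  assumes "f \<in> linear_isos R M N" "module R M"
  shows "inv_into (carrier M) f \<in> linear_isos R N M"
proof -
  interpret module R M by fact
  note f = linear_isosD[OF assms(1)]
  let ?g = "inv_into (carrier M) f"
  have g: "bij_betw ?g (carrier N) (carrier M)" using f(2) by (rule bij_betw_inv_into)
  have gc: "?g y \<in> carrier M" if "y \<in> carrier N" for y using g that by (rule bij_betw_apply)
  have fg: "f (?g y) = y" if "y \<in> carrier N" for y using f(2) that by (rule bij_betw_inv_into_right)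
  have gf: "?g (f x) = x" if "x \<in> carrier M" for x using f(2) that by (rule bij_betw_inv_into_left)
  have "?g \<in> linear_maps R N M"
  proof (rule linear_mapsI)
    fix x y assume xy: "x \<in> carrier N" "y \<in> carrier N"
    have "?g (f (?g x \<oplus>\<^bsub>M\<^esub> ?g y)) = ?g x \<oplus>\<^bsub>M\<^esub> ?g y" using xy by (simp add: gf gc)
    then show "?g (x \<oplus>\<^bsub>N\<^esub> y) = ?g x \<oplus>\<^bsub>M\<^esub> ?g y"
      using xy by (simp add: linear_maps_add[OF f(1)] fg gc)
  next
    fix a x assume ax: "a \<in> carrier R" "x \<in> carrier N"
    have "?g (f (a \<odot>\<^bsub>M\<^esub> ?g x)) = a \<odot>\<^bsub>M\<^esub> ?g x" using ax by (simp add: gf gc)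
    then show "?g (a \<odot>\<^bsub>N\<^esub> x) = a \<odot>\<^bsub>M\<^esub> ?g x"
      using ax by (simp add: linear_maps_smult[OF f(1)] fg gc)
  qed (use gc in auto)
  with g show ?thesis by (simp add: linear_isos_def)
qed


section \<open>Subtraction in abelian groups\<close>

lemma (in abelian_group) minus_eq_0_iff:
  assumes "x \<in> carrier G" "y \<in> carrier G"
  shows "x \<ominus> y = \<zero> \<longleftrightarrow> x = y"
  using assms by (metis a_minus_def add.inv_closed add.inv_equality add.inv_inv r_neg)

text \<open>That f - g commutes with L is proved below in the form f L + L g = L f + g L, which
  contains no subtraction and suits \<open>a_ac\<close>. This lemma converts it back.\<close>

lemma (in abelian_group) add_eq_add_imp_minus_eq_minus:
  assumes "a \<in> carrier G" "b \<in> carrier G" "c \<in> carrier G" "d \<in> carrier G" "a \<oplus> b = c \<oplus> d"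
  shows "a \<ominus> d = c \<ominus> b"
proof -
  have "a \<ominus> d = (a \<oplus> b) \<oplus> (\<ominus> b \<oplus> \<ominus> d)"
    using assms(1-4) by (simp add: a_minus_def a_assoc) (metis a_assoc add.inv_closed l_zero r_neg)
  also have "\<dots> = (c \<oplus> d) \<oplus> (\<ominus> d \<oplus> \<ominus> b)"
    using assms by (simp add: a_comm)
  also have "\<dots> = c \<ominus> b"
    using assms(1-4) by (simp add: a_minus_def a_assoc) (metis a_assoc add.inv_closed l_zero r_neg)
  finally show ?thesis .
qed


section \<open>Graded spaces with an operator of degree one\<close>

locale graded_L =
  fixes E :: "('e, 'r) ring_scheme" and V :: "int \<Rightarrow> ('e, 'v) module" and L :: "int \<Rightarrow> 'v \<Rightarrow> 'v"
  assumes graded: "graded_L_space E V L"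
begin

lemma module_component: "module E (V j)"
  using graded by (simp add: graded_L_space_def)

sublocale deg: module E "V j" for j
  by (rule module_component)

lemma L_linear: "L j \<in> linear_maps E (V j) (V (j + 1))"
  using graded by (simp add: graded_L_space_def)

lemma L_closed: "x \<in> carrier (V j) \<Longrightarrow> i = j + 1 \<Longrightarrow> L j x \<in> carrier (V i)"
  using linear_maps_closed[OF L_linear] by simp

text \<open>Inductions on the degree start from such an N, where every vector is zero.\<close>

lemma bounded_below: "\<exists>N. \<forall>j \<le> N. carrier (V j) = {\<zero>\<^bsub>V j\<^esub>}"
proof -
  obtain N where N: "\<forall>j. \<bar>j\<bar> > N \<longrightarrow> carrier (V j) = {\<zero>\<^bsub>V j\<^esub>}"
    using graded by (auto simp: graded_L_space_def)
  show ?thesis by (rule exI[of _ "- \<bar>N\<bar> - 1"]) (use N in auto)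
qed

text \<open>The target degree is a variable tied by an equation, so that one fact serves all
  expressions for the same degree, such as \<open>i + int w\<close> and
  \<open>i - 1 + int (Suc w)\<close>.\<close>

lemma L_power_linear: "i = j + int k \<Longrightarrow> L_power L k j \<in> linear_maps E (V j) (V i)"
proof (induction k arbitrary: i)
  case 0
  then show ?case by (auto simp: linear_maps_def)
next
  case (Suc k)
  have "(\<lambda>x. L (j + int k) (L_power L k j x)) \<in> linear_maps E (V j) (V (j + int k + 1))"
    using Suc.IH L_linear by (rule linear_maps_comp) simp
  then show ?case using Suc.prems by (simp add: algebra_simps linear_maps_def)
qed

lemma L_power_closed: "x \<in> carrier (V j) \<Longrightarrow> i = j + int k \<Longrightarrow> L_power L k j x \<in> carrier (V i)"
  using L_power_linear linear_maps_closed by metis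

text \<open>The recursion of \<open>L_power\<close> adds the new factor last. Here it is added
  first, as needed when a vector of the form L u is inserted.\<close>

lemma L_power_Suc_right: "L_power L k (j + 1) (L j x) = L_power L (Suc k) j x"
  by (induction k) (simp_all add: algebra_simps)

lemma L_power_add: "L_power L k (j + int l) (L_power L l j x) = L_power L (k + l) j x"
  by (induction k) (simp_all add: algebra_simps)

lemmas L_add = linear_maps_add[OF L_linear]
  and L_zero = linear_maps_zero[OF module_component module_component L_linear]
  and L_minus = linear_maps_minus[OF module_component module_component L_linear]
  and L_add_pow = linear_maps_add_pow[OF module_component module_component L_linear]
  and L_power_plus = linear_maps_add[OF L_power_linear[OF refl]]
  and L_power_zero = linear_maps_zero[OF module_component module_component L_power_linear[OF refl]]
  and L_power_minus = linear_maps_minus[OF module_component module_component L_power_linear[OF refl]]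
  and L_power_add_pow =
    linear_maps_add_pow[OF module_component module_component L_power_linear[OF refl]]

end

section \<open>Shifts of degree and maps intertwining the operators\<close>

lemma L_power_shift: "L_power (\<lambda>j. L (j + d)) k j = L_power L k (j + d)"
proof
  show "L_power (\<lambda>j. L (j + d)) k j x = L_power L k (j + d) x" for x
    by (induction k) (simp_all add: algebra_simps)
qed

lemma L_power_commute:
  assumes "graded_L E A LA"
    and comm: "\<And>j x. x \<in> carrier (A j) \<Longrightarrow> f (j + 1) (LA j x) = LB j (f j x)"
    and x: "x \<in> carrier (A j)" and i: "i = j + int k"
  shows "f i (L_power LA k j x) = L_power LB k j (f j x)"
proof -
  interpret A: graded_L E A LA by fact
  show ?thesis unfolding i
  proof (induction k)
    case (Suc k)
    have "f (j + int k + 1) (LA (j + int k) (L_power LA k j x)) =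
        LB (j + int k) (f (j + int k) (L_power LA k j x))"
      by (rule comm, rule A.L_power_closed[OF x refl])
    then show ?case using Suc.IH by (simp add: algebra_simps)
  qed simp
qed

text \<open>The component of degree i is now \<open>V (i + d)\<close>, so the center moves by
  \<open>- d\<close>; the parameter is twice the center and moves by \<open>- 2 * d\<close>.\<close>

lemma lefschetz_shift:
  assumes "lefschetz_module E V L n"
  shows "lefschetz_module E (\<lambda>j. V (j + d)) (\<lambda>j. L (j + d)) (n - 2 * d)"
proof -
  have g: "graded_L_space E V L" using assms by (simp add: lefschetz_module_def)
  then obtain N where N: "\<forall>j. \<bar>j\<bar> > N \<longrightarrow> carrier (V j) = {\<zero>\<^bsub>V j\<^esub>}"
    by (auto simp: graded_L_space_def)
  have "\<exists>N. \<forall>j. \<bar>j\<bar> > N \<longrightarrow> carrier (V (j + d)) = {\<zero>\<^bsub>V (j + d)\<^esub>}"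
    by (rule exI[of _ "\<bar>N\<bar> + \<bar>d\<bar>"]) (use N in auto)
  moreover have "L (j + d) \<in> linear_maps E (V (j + d)) (V (j + 1 + d))" for j
  proof -
    have "L (j + d) \<in> linear_maps E (V (j + d)) (V (j + d + 1))"
      using g by (simp add: graded_L_space_def)
    then show ?thesis by (simp add: algebra_simps)
  qed
  ultimately have 1: "graded_L_space E (\<lambda>j. V (j + d)) (\<lambda>j. L (j + d))"
    using g by (simp add: graded_L_space_def)
  have "L_power L (nat (n - 2 * d - 2 * i)) (i + d) \<in> linear_isos E (V (i + d)) (V (n - 2 * d - i + d))"
    if "2 * i \<le> n - 2 * d" for i
  proof -
    have "L_power L (nat (n - 2 * (i + d))) (i + d) \<in> linear_isos E (V (i + d)) (V (n - (i + d)))"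
      using conjunct2[OF assms[unfolded lefschetz_module_def], rule_format, of "i + d"] that by simp
    moreover have "n - 2 * (i + d) = n - 2 * d - 2 * i" "n - (i + d) = n - 2 * d - i + d" by auto
    ultimately show ?thesis by (simp only:)
  qed
  with 1 show ?thesis by (simp add: lefschetz_module_def L_power_shift)
qed

text \<open>A map of degree -1 into V is a map of degree 0 into this space. The gain of 2 in the
  parameter is what makes the vanishing principle applicable.\<close>

lemma lefschetz_shift_down:
  "lefschetz_module E V L n \<Longrightarrow> lefschetz_module E (\<lambda>j. V (j - 1)) (\<lambda>j. L (j - 1)) (n + 2)"
  using lefschetz_shift[of E V L n "-1"] by simp


section \<open>Lefschetz modules\<close>

locale lefschetz =
  fixes E :: "('e, 'r) ring_scheme" and V :: "int \<Rightarrow> ('e, 'v) module" and L :: "int \<Rightarrow> 'v \<Rightarrow> 'v"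
    and n :: int
  assumes lefschetz: "lefschetz_module E V L n"

sublocale lefschetz \<subseteq> graded_L E V L
  using lefschetz by unfold_locales (simp add: lefschetz_module_def)

context lefschetz
begin

text \<open>Trades \<open>nat (n - 2 * i)\<close> for a free exponent with an additive constraint.
  All later exponents are controlled by equations of this shape.\<close>

lemma L_power_iso:
  assumes "n = 2 * i + int k" "j = i + int k"
  shows "L_power L k i \<in> linear_isos E (V i) (V j)"
proof -
  have "L_power L (nat (n - 2 * i)) i \<in> linear_isos E (V i) (V (n - i))"
    using conjunct2[OF lefschetz[unfolded lefschetz_module_def], rule_format, of i] assms(1) by simp
  moreover have "nat (n - 2 * i) = k" "n - i = j" using assms by auto
  ultimately show ?thesis by simp
qed

lemma L_power_surj:
  assumes "n = 2 * i + int k" "j = i + int k" "y \<in> carrier (V j)"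
  obtains x where "x \<in> carrier (V i)" "L_power L k i x = y"
proof -
  have "y \<in> L_power L k i ` carrier (V i)"
    using linear_isosD(2)[OF L_power_iso[OF assms(1,2)]] assms(3) by (simp add: bij_betw_def)
  then show ?thesis using that by blast
qed

lemma L_power_inj:
  assumes "n = 2 * i + int k" "x \<in> carrier (V i)" "y \<in> carrier (V i)"
    and "L_power L k i x = L_power L k i y"
  shows "x = y"
  using linear_isosD(2)[OF L_power_iso[OF assms(1) refl]] assms(2-4)
  by (auto simp: bij_betw_def inj_on_def)

text \<open>A power of L that does not exceed the Lefschetz exponent can be completed to it by a
  further \<open>L^l\<close>, and the composite is injective.\<close>

lemma L_power_eq_0:
  assumes "2 * i + int k \<le> n" "x \<in> carrier (V i)" "L_power L k i x = \<zero>\<^bsub>V (i + int k)\<^esub>"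
  shows "x = \<zero>\<^bsub>V i\<^esub>"
proof -
  define l where "l = nat (n - 2 * i - int k)"
  have n: "n = 2 * i + int (l + k)" using assms by (simp add: l_def)
  have "L_power L (l + k) i x = L_power L l (i + int k) (L_power L k i x)"
    by (simp add: L_power_add)
  also have "\<dots> = \<zero>\<^bsub>V (i + int (l + k))\<^esub>"
    using assms(3) by (simp add: L_power_zero algebra_simps)
  also have "\<dots> = L_power L (l + k) i \<zero>\<^bsub>V i\<^esub>" by (simp add: L_power_zero)
  finally show ?thesis using L_power_inj[OF n assms(2)] by simp
qed

text \<open>Degree \<open>j - 1\<close> has Lefschetz exponent w + 2, so L^(w+2) u = L^(w+1) x can
  be solved for u. Then x - L u is killed by L^(w+1), which means that it is primitive.\<close>

lemma primitive_decomposition: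
  assumes n: "n = 2 * j + int w" and x: "x \<in> carrier (V j)"
  obtains u p where "u \<in> carrier (V (j - 1))" "p \<in> carrier (V j)"
    "L_power L (Suc w) j p = \<zero>\<^bsub>V (j + int (Suc w))\<^esub>" "x = p \<oplus>\<^bsub>V j\<^esub> L (j - 1) u"
proof -
  have "n = 2 * (j - 1) + int (Suc (Suc w))" using n by simp
  then obtain u where u: "u \<in> carrier (V (j - 1))"
    "L_power L (Suc (Suc w)) (j - 1) u = L_power L (Suc w) j x"
    by (rule L_power_surj[of _ _ "j + int (Suc w)" "L_power L (Suc w) j x"])
      (use L_power_closed[OF x, of _ "Suc w"] in auto)
  have Lu: "L (j - 1) u \<in> carrier (V j)" using L_closed[OF u(1)] by simp
  have "L_power L (Suc w) j (L (j - 1) u) = L_power L (Suc w) j x"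
    using u(2) L_power_Suc_right[of "Suc w" "j - 1" u] by simp
  then have "L_power L (Suc w) j (x \<ominus>\<^bsub>V j\<^esub> L (j - 1) u) = \<zero>\<^bsub>V (j + int (Suc w))\<^esub>"
    using x Lu L_power_closed[OF x refl, of "Suc w"]
    by (simp only: L_power_minus deg.M.minus_eq_0_iff)
  moreover have "x = (x \<ominus>\<^bsub>V j\<^esub> L (j - 1) u) \<oplus>\<^bsub>V j\<^esub> L (j - 1) u"
    using x Lu by (simp add: a_minus_def deg.M.a_assoc deg.M.l_neg)
  ultimately show ?thesis using that u(1) x Lu by (meson deg.M.minus_closed)
qed

text \<open>Up to the center, a vector is a primitive one plus L u with u one degree lower. Above
  the center it is L^m v with v in the mirrored degree \<open>n - j\<close>, which is lower as well.
  The degree descends until all components vanish.\<close>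

lemma lefschetz_induct [consumes 1, case_names add L primitive]:
  assumes x: "x \<in> carrier (V j)"
    and add: "\<And>i x y. x \<in> carrier (V i) \<Longrightarrow> y \<in> carrier (V i) \<Longrightarrow> P i x \<Longrightarrow> P i y \<Longrightarrow>
      P i (x \<oplus>\<^bsub>V i\<^esub> y)"
    and L: "\<And>i x. x \<in> carrier (V i) \<Longrightarrow> P i x \<Longrightarrow> P (i + 1) (L i x)"
    and primitive: "\<And>i w x. n = 2 * i + int w \<Longrightarrow> x \<in> carrier (V i) \<Longrightarrow>
      L_power L (Suc w) i x = \<zero>\<^bsub>V (i + int (Suc w))\<^esub> \<Longrightarrow> P i x"
  shows "P j x"
proof -
  obtain N where N: "\<forall>j \<le> N. carrier (V j) = {\<zero>\<^bsub>V j\<^esub>}" using bounded_below by blast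
  have power: "P (i + int k) (L_power L k i x)" if "x \<in> carrier (V i)" "P i x" for i k x
  proof (induction k)
    case (Suc k)
    have "P (i + int k + 1) (L (i + int k) (L_power L k i x))"
      using L_power_closed[OF that(1) refl] Suc.IH by (rule L)
    then show ?case by (simp add: algebra_simps)
  qed (use that in simp)
  show ?thesis using x
  proof (induction "nat (j - N)" arbitrary: j x rule: less_induct)
    case less
    show ?case
    proof (cases "2 * j \<le> n")
      case True
      then have n: "n = 2 * j + int (nat (n - 2 * j))" by simp
      show ?thesis
      proof (cases "j \<le> N")
        case True
        \<comment> \<open>The zero vector is primitive, so the bottom of the descent falls under the
          third hypothesis.\<close>
        then have "x = \<zero>\<^bsub>V j\<^esub>" using N less.prems by auto
        then show ?thesis using primitive[OF n] less.prems L_power_zero by metis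
      next
        case False
        obtain u p where up: "u \<in> carrier (V (j - 1))" "p \<in> carrier (V j)"
          "L_power L (Suc (nat (n - 2 * j))) j p = \<zero>\<^bsub>V (j + int (Suc (nat (n - 2 * j))))\<^esub>"
          "x = p \<oplus>\<^bsub>V j\<^esub> L (j - 1) u"
          using primitive_decomposition[OF n less.prems] by blast
        have "P (j - 1) u" using False up(1) by (intro less.hyps) auto
        then have "P j (L (j - 1) u)" using L[OF up(1)] by simp
        moreover have "L (j - 1) u \<in> carrier (V j)" using L_closed[OF up(1)] by simp
        moreover have "P j p" using primitive[OF n up(2,3)] .
        ultimately show ?thesis using add up(2,4) by simp
      qed
    next
      case False
      define m where "m = nat (2 * j - n)"
      have m: "n = 2 * (n - j) + int m" "j = n - j + int m" "m > 0" using False by (auto simp: m_def)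
      obtain v where v: "v \<in> carrier (V (n - j))" "L_power L m (n - j) v = x"
        using L_power_surj[OF m(1,2) less.prems] by blast
      have "P (n - j) v"
      proof (cases "n - j \<le> N")
        case True
        then have "v = \<zero>\<^bsub>V (n - j)\<^esub>" using N v(1) by auto
        then show ?thesis using primitive[OF m(1)] v(1) L_power_zero by metis
      next
        case False
        then show ?thesis using m v(1) by (intro less.hyps) auto
      qed
      then show ?thesis using power[OF v(1), of m] v(2) m(2) by simp
    qed
  qed
qed

end


section \<open>Maps commuting with L\<close>

text \<open>If x is primitive of degree i with a = 2 i + w, then f x is killed by L^(w+1). Since 2 i
  + w + 1 = a + 1 \<le> b, this power is injective on degree i of B, so f x is zero. Sums and
  L-images of such x inherit this.\<close>

lemma L_linear_eq_0:
  assumes A: "lefschetz_module E A LA a" and B: "lefschetz_module E B LB b" and ab: "a < b"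
    and f: "\<And>j. f j \<in> linear_maps E (A j) (B j)"
    and comm: "\<And>j x. x \<in> carrier (A j) \<Longrightarrow> f (j + 1) (LA j x) = LB j (f j x)"
    and x: "x \<in> carrier (A j)"
  shows "f j x = \<zero>\<^bsub>B j\<^esub>"
proof -
  interpret A: lefschetz E A LA a by unfold_locales fact
  interpret B: lefschetz E B LB b by unfold_locales fact
  show ?thesis using x
  proof (induction rule: A.lefschetz_induct)
    case (add i x y)
    then show ?case by (simp add: linear_maps_add[OF f])
  next
    case (L i x)
    then show ?case by (simp add: comm B.L_zero)
  next
    case (primitive i w x)
    have "L_power LB (Suc w) i (f i x) = f (i + int (Suc w)) (L_power LA (Suc w) i x)"
      by (rule L_power_commute[of E A LA f LB, symmetric, OF A.graded_L_axioms comm primitive(2) refl])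
    also have "\<dots> = \<zero>\<^bsub>B (i + int (Suc w))\<^esub>"
      unfolding primitive(3) by (rule linear_maps_zero[OF A.module_component B.module_component f])
    finally show ?case
      using B.L_power_eq_0[of i "Suc w"] primitive(1) ab linear_maps_closed[OF f primitive(2)] by simp
  qed
qed

text \<open>
  The hypothesis on \<open>f\<close> and \<open>g\<close> says that \<open>f - g\<close> commutes with the operators, although
  neither \<open>f\<close> nor \<open>g\<close> need do so.
\<close>

lemma L_linear_eq:
  assumes A: "lefschetz_module E A LA a" and B: "lefschetz_module E B LB b" and ab: "a < b"
    and f: "\<And>j. f j \<in> linear_maps E (A j) (B j)"
    and g: "\<And>j. g j \<in> linear_maps E (A j) (B j)"
    and comm: "\<And>j x. x \<in> carrier (A j) \<Longrightarrow>
      f (j + 1) (LA j x) \<oplus>\<^bsub>B (j + 1)\<^esub> LB j (g j x) = LB j (f j x) \<oplus>\<^bsub>B (j + 1)\<^esub> g (j + 1) (LA j x)"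
    and x: "x \<in> carrier (A j)"
  shows "f j x = g j x"
proof -
  interpret A: lefschetz E A LA a by unfold_locales fact
  interpret B: lefschetz E B LB b by unfold_locales fact
  note fc = linear_maps_closed[OF f] and gc = linear_maps_closed[OF g]
  have "f j x \<ominus>\<^bsub>B j\<^esub> g j x = \<zero>\<^bsub>B j\<^esub>"
  proof (rule L_linear_eq_0[OF A B ab _ _ x, of "\<lambda>j x. f j x \<ominus>\<^bsub>B j\<^esub> g j x"])
    show "(\<lambda>x. f j x \<ominus>\<^bsub>B j\<^esub> g j x) \<in> linear_maps E (A j) (B j)" for j
      by (rule linear_maps_diff[OF B.module_component f g A.module_component])
    fix j x assume x: "x \<in> carrier (A j)"
    have "f (j + 1) (LA j x) \<ominus>\<^bsub>B (j + 1)\<^esub> g (j + 1) (LA j x) = LB j (f j x) \<ominus>\<^bsub>B (j + 1)\<^esub> LB j (g j x)"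
      by (rule B.deg.add_eq_add_imp_minus_eq_minus[OF _ _ _ _ comm[OF x]])
        (auto intro!: fc gc B.L_closed A.L_closed x)
    also have "\<dots> = LB j (f j x \<ominus>\<^bsub>B j\<^esub> g j x)"
      by (rule B.L_minus[symmetric]) (auto intro: fc gc x)
    finally show "f (j + 1) (LA j x) \<ominus>\<^bsub>B (j + 1)\<^esub> g (j + 1) (LA j x) = LB j (f j x \<ominus>\<^bsub>B j\<^esub> g j x)" .
  qed
  then show ?thesis by (simp add: B.deg.minus_eq_0_iff fc gc x)
qed

text \<open>With equal centers the image of a primitive vector is primitive and need not vanish, but
  bijectivity can be tested on primitive vectors. The image of f is closed under sums and L, which
  propagates surjectivity; the kernel is treated by descent on the degree.\<close>

lemma L_linear_iso:
  assumes A: "lefschetz_module E A LA a" and B: "lefschetz_module E B LB a"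
    and f: "\<And>j. f j \<in> linear_maps E (A j) (B j)"
    and comm: "\<And>j x. x \<in> carrier (A j) \<Longrightarrow> f (j + 1) (LA j x) = LB j (f j x)"
    and inj: "\<And>i w x. a = 2 * i + int w \<Longrightarrow> x \<in> carrier (A i) \<Longrightarrow>
      L_power LA (Suc w) i x = \<zero>\<^bsub>A (i + int (Suc w))\<^esub> \<Longrightarrow> f i x = \<zero>\<^bsub>B i\<^esub> \<Longrightarrow> x = \<zero>\<^bsub>A i\<^esub>"
    and surj: "\<And>i w y. a = 2 * i + int w \<Longrightarrow> y \<in> carrier (B i) \<Longrightarrow>
      L_power LB (Suc w) i y = \<zero>\<^bsub>B (i + int (Suc w))\<^esub> \<Longrightarrow> y \<in> f i ` carrier (A i)"
  shows "f j \<in> linear_isos E (A j) (B j)"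
proof -
  interpret A: lefschetz E A LA a by unfold_locales fact
  interpret B: lefschetz E B LB a by unfold_locales fact
  note fc = linear_maps_closed[OF f]
  have f_power: "f i (L_power LA k j x) = L_power LB k j (f j x)"
    if "x \<in> carrier (A j)" "i = j + int k" for i j k x
    using L_power_commute[of E A LA f LB, OF A.graded_L_axioms comm that] .
  obtain N where N: "\<forall>j \<le> N. carrier (A j) = {\<zero>\<^bsub>A j\<^esub>}" using A.bounded_below by blast
  have ker: "x = \<zero>\<^bsub>A j\<^esub>" if "x \<in> carrier (A j)" "f j x = \<zero>\<^bsub>B j\<^esub>" for x j
    using that
  proof (induction "nat (j - N)" arbitrary: j x rule: less_induct)
    case less
    show ?case
    proof (cases "j \<le> N")
      case True
      then show ?thesis using N less.prems by auto
    next
      case jN: False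
      show ?thesis
      proof (cases "2 * j \<le> a")
        case True
        define w where "w = nat (a - 2 * j)"
        have w: "a = 2 * j + int w" using True by (simp add: w_def)
        obtain u p where up: "u \<in> carrier (A (j - 1))" "p \<in> carrier (A j)"
          "L_power LA (Suc w) j p = \<zero>\<^bsub>A (j + int (Suc w))\<^esub>" "x = p \<oplus>\<^bsub>A j\<^esub> LA (j - 1) u"
          using A.primitive_decomposition[OF w less.prems(1)] by blast
        have Lu: "LA (j - 1) u \<in> carrier (A j)" using A.L_closed[OF up(1)] by simp
        \<comment> \<open>L^(w+1) kills the primitive part p and leaves L^(w+2) u. As f x is zero,
          L^(w+2) annihilates f u, and w + 2 is the Lefschetz exponent of degree
          \<open>j - 1\<close>.\<close>
        have "L_power LA (Suc w) j x = L_power LA (Suc w) (j - 1 + 1) (LA (j - 1) u)"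
          using up Lu A.L_power_closed[OF Lu, of _ "Suc w"]
          by (simp only: A.L_power_plus A.deg.M.l_zero diff_add_cancel)
        also have "\<dots> = L_power LA (Suc (Suc w)) (j - 1) u" by (rule A.L_power_Suc_right)
        finally have "f (j + int (Suc w)) (L_power LA (Suc w) j x) =
            L_power LB (Suc (Suc w)) (j - 1) (f (j - 1) u)"
          using f_power[OF up(1), of "j + int (Suc w)" "Suc (Suc w)"] by simp
        moreover have "f (j + int (Suc w)) (L_power LA (Suc w) j x) = \<zero>\<^bsub>B (j + int (Suc w))\<^esub>"
          using f_power[OF less.prems(1), of _ "Suc w"] less.prems(2) B.L_power_zero[of "Suc w" j] by simp
        ultimately have "f (j - 1) u = \<zero>\<^bsub>B (j - 1)\<^esub>"
          using fc[OF up(1)] w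
          by (intro B.L_power_eq_0[of "j - 1" "Suc (Suc w)"])
            (simp_all add: algebra_simps del: L_power.simps)
        then have "u = \<zero>\<^bsub>A (j - 1)\<^esub>" using jN up(1) by (intro less.hyps) auto
        then have "x = p" using up(2,4) A.L_zero[of "j - 1"] by simp
        then show ?thesis using inj[OF w up(2,3)] less.prems(2) by simp
      next
        case False
        define m where "m = nat (2 * j - a)"
        have m: "a = 2 * (a - j) + int m" "j = a - j + int m" "m > 0" using False by (auto simp: m_def)
        obtain v where v: "v \<in> carrier (A (a - j))" "L_power LA m (a - j) v = x"
          using A.L_power_surj[OF m(1,2) less.prems(1)] by blast
        \<comment> \<open>Above the center f x = L^m (f v), and m is the Lefschetz exponent of
          degree \<open>a - j\<close> in B.\<close>
        have "L_power LB m (a - j) (f (a - j) v) = \<zero>\<^bsub>B (a - j + int m)\<^esub>"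
          using f_power[OF v(1) m(2)] v(2) less.prems(2) by (simp only: m(2)[symmetric])
        then have "f (a - j) v = \<zero>\<^bsub>B (a - j)\<^esub>"
          using B.L_power_eq_0[of "a - j" m "f (a - j) v"] fc[OF v(1)] m(1) by simp
        then have "v = \<zero>\<^bsub>A (a - j)\<^esub>" using jN m v(1) by (intro less.hyps) auto
        then show ?thesis using v(2) A.L_power_zero[of m "a - j"] m(2) by simp
      qed
    qed
  qed
  have "inj_on (f j) (carrier (A j))"
  proof (rule inj_onI)
    fix x y assume xy: "x \<in> carrier (A j)" "y \<in> carrier (A j)" "f j x = f j y"
    then have "f j (x \<ominus>\<^bsub>A j\<^esub> y) = \<zero>\<^bsub>B j\<^esub>"
      by (simp add: linear_maps_minus[OF A.module_component B.module_component f]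
        B.deg.minus_eq_0_iff fc)
    with ker[of "x \<ominus>\<^bsub>A j\<^esub> y" j] xy show "x = y" by (simp add: A.deg.minus_eq_0_iff)
  qed
  moreover have "y \<in> f j ` carrier (A j)" if "y \<in> carrier (B j)" for y
    using that
  proof (induction rule: B.lefschetz_induct)
    case (add i x y)
    then obtain u v where uv: "u \<in> carrier (A i)" "v \<in> carrier (A i)" "x = f i u" "y = f i v" by blast
    then show ?case
      by (intro rev_image_eqI[of "u \<oplus>\<^bsub>A i\<^esub> v"]) (auto simp: linear_maps_add[OF f])
  next
    case (L i x)
    then obtain u where u: "u \<in> carrier (A i)" "x = f i u" by blast
    then show ?case
      by (intro rev_image_eqI[of "LA i u"]) (auto simp: comm A.L_closed)
  qed (use surj in blast)
  ultimately have "bij_betw (f j) (carrier (A j)) (carrier (B j))"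
    unfolding bij_betw_def using fc by blast
  then show ?thesis using f by (simp add: linear_isos_def)
qed


section \<open>The lowering operator\<close>

context lefschetz
begin

text \<open>Both commutators with L are the same integer, so D - D' commutes with L; read as a map
  into the shifted space it goes from parameter n to n + 2. Outside the carriers both operators are
  \<open>undefined\<close> by extensionality.\<close>

lemma Lambda_unique:
  assumes D: "is_Lambda E V L n D" and D': "is_Lambda E V L n D'"
  shows "D = D'"
proof (rule ext)+
  fix j x
  have lin: "G j \<in> linear_maps E (V j) (V (j - 1))" if "is_Lambda E V L n G" for G j
    using that by (simp add: is_Lambda_def)
  have rel: "G (j + 1) (L j x) = add_pow (V j) (n - 2 * j) x \<oplus>\<^bsub>V j\<^esub> L (j - 1) (G j x)"
    if G: "is_Lambda E V L n G" and x: "x \<in> carrier (V j)" for G j x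
  proof -
    have c: "G (j + 1) (L j x) \<in> carrier (V j)" "L (j - 1) (G j x) \<in> carrier (V j)"
      using linear_maps_closed[OF lin[OF G, of "j + 1"] L_closed[OF x refl]]
        L_closed[OF linear_maps_closed[OF lin[OF G] x]] by simp_all
    have "G (j + 1) (L j x) \<ominus>\<^bsub>V j\<^esub> L (j - 1) (G j x) = add_pow (V j) (n - 2 * j) x"
      using G x by (simp add: is_Lambda_def)
    then show ?thesis using c by (metis a_minus_def deg.M.a_assoc deg.M.add.inv_closed deg.M.l_neg deg.M.r_zero)
  qed
  show "D j x = D' j x"
  proof (cases "x \<in> carrier (V j)")
    case True
    show ?thesis
    proof (rule L_linear_eq[OF lefschetz lefschetz_shift_down[OF lefschetz] _ _ _ _ True, of D D'])
      fix j x assume x: "x \<in> carrier (V j)"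
      have "L (j - 1) (G j x) \<in> carrier (V j)" if "is_Lambda E V L n G" for G
        using L_closed[OF linear_maps_closed[OF lin[OF that] x]] by simp
      then show "D (j + 1) (L j x) \<oplus>\<^bsub>V (j + 1 - 1)\<^esub> L (j - 1) (D' j x) =
          L (j - 1) (D j x) \<oplus>\<^bsub>V (j + 1 - 1)\<^esub> D' (j + 1) (L j x)"
        using D D' x by (simp add: rel deg.M.a_ac)
    qed (use lin[OF D] lin[OF D'] in auto)
  next
    case False
    have "D j x = undefined" "D' j x = undefined"
      using D D' False by (auto simp: is_Lambda_def extensional_def)
    then show ?thesis by simp
  qed
qed

text \<open>Write x = p + L u with p primitive. A lowering operator must kill p, so its value on x
  is \<Lambda> L u = L \<Lambda> u + (n - 2 (j - 1)) u, and n - 2 (j - 1) = w + 2. The vector u is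
  characterised by L^(w+2) u = L^(w+1) x. This is a recursion on the degree, valid up to n /
  2.\<close>

lemma Lambda_lower_half:
  "\<exists>D. \<forall>j w. n = 2 * j + int w \<longrightarrow> D j \<in> linear_maps E (V j) (V (j - 1)) \<and>
    (\<forall>x \<in> carrier (V j). \<forall>u \<in> carrier (V (j - 1)).
      L_power L (Suc w) j x = L_power L (Suc (Suc w)) (j - 1) u \<longrightarrow>
      D j x = L (j - 2) (D (j - 1) u) \<oplus>\<^bsub>V (j - 1)\<^esub> add_pow (V (j - 1)) (int w + 2) u)"
  (is "\<exists>D. \<forall>j w. ?P D j w")
proof -
  obtain N where N: "\<forall>j \<le> N. carrier (V j) = {\<zero>\<^bsub>V j\<^esub>}" using bounded_below by blast
  have "\<exists>D. \<forall>j \<le> J. \<forall>w. ?P D j w" if "N \<le> J" for J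
    using that
  proof (induction J rule: int_ge_induct)
    case base
    have "?P (\<lambda>j x. \<zero>\<^bsub>V (j - 1)\<^esub>) j w" if "j \<le> N" for j w
      using that N L_zero[of "j - 2"] by (auto intro: linear_maps_zero_map module_component)
    then show ?case by (intro exI[of _ "\<lambda>j x. \<zero>\<^bsub>V (j - 1)\<^esub>"]) blast
  next
    case (step J)
    then obtain D where D: "\<forall>j \<le> J. \<forall>w. ?P D j w" by blast
    show ?case
    proof (cases "2 * (J + 1) \<le> n")
      case False
      then have "\<forall>j \<le> J + 1. \<forall>w. ?P D j w" using D by (auto simp: le_less)
      then show ?thesis by blast
    next
      case True
      define w where "w = nat (n - 2 * (J + 1))"
      have w: "n = 2 * J + int (Suc (Suc w))" using True by (simp add: w_def)
      \<comment> \<open>\<open>T x\<close> is the vector u that belongs to x; as a power of L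
        followed by the inverse of a Lefschetz isomorphism it is linear in x.\<close>
      define T where "T x = inv_into (carrier (V J)) (L_power L (Suc (Suc w)) J)
        (L_power L (Suc w) (J + 1) x)" for x
      have iso: "L_power L (Suc (Suc w)) J \<in> linear_isos E (V J) (V (J + 1 + int (Suc w)))"
        by (rule L_power_iso[OF w]) simp
      have T: "T \<in> linear_maps E (V (J + 1)) (V J)"
        unfolding T_def
        by (rule linear_maps_comp[OF L_power_linear[OF refl]
              linear_isosD(1)[OF linear_isos_inv[OF iso module_component]]])
      have T_eq: "T x = u" if "u \<in> carrier (V J)"
        "L_power L (Suc w) (J + 1) x = L_power L (Suc (Suc w)) J u" for x u
        unfolding T_def that(2) by (rule bij_betw_inv_into_left[OF linear_isosD(2)[OF iso] that(1)])
      define G where "G x = L (J - 1) (D J (T x)) \<oplus>\<^bsub>V J\<^esub> add_pow (V J) (int w + 2) (T x)" for x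
      have DJ: "D J \<in> linear_maps E (V J) (V (J - 1))" using D w by blast
      have LJ: "L (J - 1) \<in> linear_maps E (V (J - 1)) (V J)" using L_linear[of "J - 1"] by simp
      have G: "G \<in> linear_maps E (V (J + 1)) (V J)"
        unfolding G_def
        by (intro linear_maps_plus linear_maps_add_pow_map module_component T
            linear_maps_comp[OF T] linear_maps_comp[OF DJ LJ])
      have "?P (D(J + 1 := G)) j w'" if "j \<le> J + 1" for j w'
      proof (cases "j \<le> J")
        case True
        then show ?thesis using D by simp
      next
        case False
        then have j: "j = J + 1" using that by simp
        show ?thesis
        proof (intro impI)
          assume "n = 2 * j + int w'"
          then have "w' = w" using w j by simp
          then show "(D(J + 1 := G)) j \<in> linear_maps E (V j) (V (j - 1)) \<and>
            (\<forall>x \<in> carrier (V j). \<forall>u \<in> carrier (V (j - 1)).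
              L_power L (Suc w') j x = L_power L (Suc (Suc w')) (j - 1) u \<longrightarrow>
              (D(J + 1 := G)) j x = L (j - 2) ((D(J + 1 := G)) (j - 1) u)
                \<oplus>\<^bsub>V (j - 1)\<^esub> add_pow (V (j - 1)) (int w' + 2) u)"
            using G T_eq by (simp add: j G_def del: L_power.simps)
        qed
      qed
      then show ?thesis by blast
    qed
  qed
  \<comment> \<open>The condition concerns only degrees up to n / 2, all of which lie below this
    bound.\<close>
  from this[of "max N \<bar>n\<bar>"] obtain D where D: "\<forall>j \<le> max N \<bar>n\<bar>. \<forall>w. ?P D j w" by auto
  have "?P D j w" for j w
  proof (cases "j \<le> max N \<bar>n\<bar>")
    case False
    then have "n \<noteq> 2 * j + int w" by auto
    then show ?thesis by blast
  qed (use D in blast)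
  then show ?thesis by blast
qed

text \<open>Above the center the operator is forced by its values below: a vector there is L^m v
  with v of degree i and n = 2 i + m. Moving the operator past L^m costs m (n - 2 i - (m - 1)) = m
  times L^(m-1) v, which is the formula \<open>up\<close>.\<close>

lemma Lambda_exists: "\<exists>D. is_Lambda E V L n D"
proof -
  obtain D where D: "\<And>j w. n = 2 * j + int w \<Longrightarrow> D j \<in> linear_maps E (V j) (V (j - 1))"
    and D_eq: "\<And>j w x u. n = 2 * j + int w \<Longrightarrow> x \<in> carrier (V j) \<Longrightarrow> u \<in> carrier (V (j - 1)) \<Longrightarrow>
      L_power L (Suc w) j x = L_power L (Suc (Suc w)) (j - 1) u \<Longrightarrow>
      D j x = L (j - 2) (D (j - 1) u) \<oplus>\<^bsub>V (j - 1)\<^esub> add_pow (V (j - 1)) (int w + 2) u"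
    using Lambda_lower_half by blast
  define up where "up m i v = L_power L m (i - 1) (D i v)
    \<oplus>\<^bsub>V (i + int m - 1)\<^esub> add_pow (V (i + int m - 1)) (int m) (L_power L (m - 1) i v)" for m i v
  \<comment> \<open>The middle degree belongs to the lower half, and \<open>restrict\<close>
    supplies extensionality.\<close>
  define D' where "D' j = (if 2 * j \<le> n then restrict (D j) (carrier (V j))
    else restrict (\<lambda>x. up (nat (2 * j - n)) (n - j)
      (inv_into (carrier (V (n - j))) (L_power L (nat (2 * j - n)) (n - j)) x)) (carrier (V j)))" for j
  have up_lin: "up m i \<in> linear_maps E (V i) (V (i + int m - 1))"
    if n: "n = 2 * i + int m" and m: "m > 0" for m i
    unfolding up_def using m
    by (intro linear_maps_plus linear_maps_add_pow_map module_component
        linear_maps_comp[OF D[OF n] L_power_linear] L_power_linear) auto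
  have D'_lin: "D' j \<in> linear_maps E (V j) (V (j - 1))" for j
  proof (cases "2 * j \<le> n")
    case True
    then have "n = 2 * j + int (nat (n - 2 * j))" by simp
    from D[OF this] show ?thesis
      by (rule linear_maps_cong[rotated]) (simp_all add: D'_def True module_component)
  next
    case False
    define m where "m = nat (2 * j - n)"
    have m: "n = 2 * (n - j) + int m" "j = n - j + int m" "m > 0" using False by (auto simp: m_def)
    have "(\<lambda>x. up m (n - j) (inv_into (carrier (V (n - j))) (L_power L m (n - j)) x))
        \<in> linear_maps E (V j) (V (n - j + int m - 1))"
      by (rule linear_maps_comp[OF linear_isosD(1)[OF linear_isos_inv[OF L_power_iso[OF m(1,2)]
            module_component]] up_lin[OF m(1,3)]])
    then have "(\<lambda>x. up m (n - j) (inv_into (carrier (V (n - j))) (L_power L m (n - j)) x))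
        \<in> linear_maps E (V j) (V (j - 1))" using m(2) by simp
    then show ?thesis
      by (rule linear_maps_cong[rotated]) (simp_all add: D'_def False module_component m_def)
  qed
  have D'_up: "D' (i + int m) (L_power L m i v) = L_power L m (i - 1) (D' i v)
      \<oplus>\<^bsub>V (i + int m - 1)\<^esub> add_pow (V (i + int m - 1)) (int m) (L_power L (m - 1) i v)"
    if n: "n = 2 * i + int m" and m: "m > 0" and v: "v \<in> carrier (V i)" for i m v
  proof -
    have "inv_into (carrier (V i)) (L_power L m i) (L_power L m i v) = v"
      by (rule bij_betw_inv_into_left[OF linear_isosD(2)[OF L_power_iso[OF n refl]] v])
    moreover have "nat (2 * (i + int m) - n) = m" "n - (i + int m) = i" "\<not> 2 * (i + int m) \<le> n" "2 * i \<le> n"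
      using n m by auto
    ultimately have "D' (i + int m) (L_power L m i v) = up m i v"
      using L_power_closed[OF v refl, of m] by (simp only: D'_def restrict_apply if_True if_False)
    then show ?thesis using \<open>2 * i \<le> n\<close> v by (simp add: up_def D'_def)
  qed
  have D'_low: "D' j x = L (j - 2) (D' (j - 1) u) \<oplus>\<^bsub>V (j - 1)\<^esub> add_pow (V (j - 1)) (int w + 2) u"
    if "n = 2 * j + int w" "x \<in> carrier (V j)" "u \<in> carrier (V (j - 1))"
      "L_power L (Suc w) j x = L_power L (Suc (Suc w)) (j - 1) u" for j w x u
    using D_eq[OF that] that(1-3) by (simp add: D'_def)
  have D'_closed: "D' j x \<in> carrier (V (j - 1))" if "x \<in> carrier (V j)" for j x
    by (rule linear_maps_closed[OF D'_lin that])
  have LD'_closed: "L (j - 1) (D' j x) \<in> carrier (V j)" if "x \<in> carrier (V j)" for j x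
    using L_closed[OF D'_closed[OF that]] by simp
  have "D' (j + 1) (L j x) = add_pow (V j) (n - 2 * j) x \<oplus>\<^bsub>V j\<^esub> L (j - 1) (D' j x)"
    if x: "x \<in> carrier (V j)" for j x
  proof -
    \<comment> \<open>In the order of the cases: L x is still in the lower half; x lies just below a
      half-integral center; x lies in the middle degree; x lies above the center.\<close>
    consider (ge2) w where "n = 2 * j + int (Suc (Suc w))" | (one) "n = 2 * j + 1" | (zero) "n = 2 * j"
      | (neg) m where "m > 0" "n = 2 * j - int m"
    proof -
      have "n = 2 * j + int (Suc (Suc (nat (n - 2 * j - 2)))) \<or> n = 2 * j + 1 \<or> n = 2 * j \<or>
          (nat (2 * j - n) > 0 \<and> n = 2 * j - int (nat (2 * j - n)))" by auto
      then show ?thesis using that by metis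
    qed
    then show ?thesis
    proof cases
      case ge2
      \<comment> \<open>Here x itself is the vector attached to L x in the recursion, because
        L^(w+1) (L x) = L^(w+2) x.\<close>
      have "D' (j + 1) (L j x) = L (j + 1 - 2) (D' (j + 1 - 1) x) \<oplus>\<^bsub>V (j + 1 - 1)\<^esub>
          add_pow (V (j + 1 - 1)) (int w + 2) x"
        by (rule D'_low) (use ge2 x L_closed L_power_Suc_right[of "Suc w" j x] in auto)
      then show ?thesis using ge2 x LD'_closed[OF x] by (simp add: deg.M.a_comm algebra_simps)
    next
      case one
      have "D' (j + int 1) (L_power L 1 j x) = L_power L 1 (j - 1) (D' j x)
          \<oplus>\<^bsub>V (j + int 1 - 1)\<^esub> add_pow (V (j + int 1 - 1)) (int 1) (L_power L (1 - 1) j x)"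
        by (rule D'_up) (use one x in auto)
      then show ?thesis using one x LD'_closed[OF x] by (simp add: deg.M.a_comm)
    next
      case zero
      have n2: "n = 2 * (j - 1) + int 2" using zero by simp
      \<comment> \<open>The same v presents L x as L^2 v from below and is the vector attached to x
        in the recursion. Both D' (L x) and L (D' x) therefore become L (L (D' v) + 2 v).\<close>
      obtain v where v: "v \<in> carrier (V (j - 1))" "L_power L 2 (j - 1) v = L j x"
        using L_power_surj[OF n2, of "j + 1" "L j x"] L_closed[OF x] by auto
      have LDv: "L (j - 2) (D' (j - 1) v) \<in> carrier (V (j - 1))"
        using LD'_closed[OF v(1)] by simp
      have "D' (j + 1) (L j x) = D' (j - 1 + int 2) (L_power L 2 (j - 1) v)"
        using v(2) by (simp add: add.commute)
      also have "\<dots> = L_power L 2 (j - 1 - 1) (D' (j - 1) v)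
          \<oplus>\<^bsub>V (j - 1 + int 2 - 1)\<^esub> add_pow (V (j - 1 + int 2 - 1)) (int 2) (L_power L (2 - 1) (j - 1) v)"
        by (rule D'_up[OF n2 _ v(1)]) simp
      also have "\<dots> = L (j - 1) (L (j - 2) (D' (j - 1) v)) \<oplus>\<^bsub>V j\<^esub> add_pow (V j) (2::int) (L (j - 1) v)"
        by (simp add: numeral_2_eq_2)
      also have "\<dots> = L (j - 1) (L (j - 2) (D' (j - 1) v) \<oplus>\<^bsub>V (j - 1)\<^esub> add_pow (V (j - 1)) (2::int) v)"
        using L_add[OF LDv, of "add_pow (V (j - 1)) (2::int) v"] L_add_pow[OF v(1), of 2] v(1) by simp
      also have "L (j - 2) (D' (j - 1) v) \<oplus>\<^bsub>V (j - 1)\<^esub> add_pow (V (j - 1)) (2::int) v = D' j x"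
        using D'_low[of j 0 x v] zero x v by (simp add: numeral_2_eq_2)
      finally show ?thesis using zero x LD'_closed[OF x] by (simp add: add_pow_def)
    next
      case neg
      define i where "i = j - int m"
      have j: "j = i + int m" by (simp add: i_def)
      have n0: "n = 2 * i + int m" and n2: "n = 2 * (i - 1) + int (Suc (Suc m))" using neg(2) j by auto
      obtain v where v: "v \<in> carrier (V i)" "L_power L m i v = x"
        using L_power_surj[OF n0 j x] by blast
      \<comment> \<open>Since L x = L^(m+2) u, the formula for the upper half and the recursion at v
        give D' (L x) = L^(m+1) (D' v). Applying L to D' x = L^m (D' v) + m L^(m-1) v gives the same
        plus m x, and n - 2 j = - m.\<close>
      obtain u where u: "u \<in> carrier (V (i - 1))"
        "L_power L (Suc (Suc m)) (i - 1) u = L_power L (Suc m) i v"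
        using L_power_surj[OF n2, of "i + int (Suc m)" "L_power L (Suc m) i v"]
          L_power_closed[OF v(1), of _ "Suc m"] by auto
      obtain k where k: "m = Suc k" using neg(1) by (cases m) auto
      have Dv: "D' i v = L (i - 2) (D' (i - 1) u) \<oplus>\<^bsub>V (i - 1)\<^esub> add_pow (V (i - 1)) (int m + 2) u"
        by (rule D'_low[OF n0 v(1) u(1) u(2)[symmetric]])
      have Du: "D' (i - 1) u \<in> carrier (V (i - 2))" using D'_closed[OF u(1)] by simp
      have LDu: "L (i - 2) (D' (i - 1) u) \<in> carrier (V (i - 1))" using L_closed[OF Du] by simp
      have "D' (j + 1) (L j x) = D' (i - 1 + int (Suc (Suc m))) (L_power L (Suc (Suc m)) (i - 1) u)"
        using u(2) v(2) j by (simp add: algebra_simps)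
      also have "\<dots> = L_power L (Suc (Suc m)) (i - 1 - 1) (D' (i - 1) u) \<oplus>\<^bsub>V (i - 1 + int (Suc (Suc m)) - 1)\<^esub>
          add_pow (V (i - 1 + int (Suc (Suc m)) - 1)) (int (Suc (Suc m))) (L_power L (Suc (Suc m) - 1) (i - 1) u)"
        by (rule D'_up[OF n2 _ u(1)]) simp
      also have "\<dots> = L_power L (Suc (Suc m)) (i - 2) (D' (i - 1) u) \<oplus>\<^bsub>V j\<^esub>
          add_pow (V j) (int m + 2) (L_power L (Suc m) (i - 1) u)"
        by (simp add: j algebra_simps del: L_power.simps)
      also have "L_power L (Suc (Suc m)) (i - 2) (D' (i - 1) u) =
          L_power L (Suc m) (i - 1) (L (i - 2) (D' (i - 1) u))"
        using L_power_Suc_right[of "Suc m" "i - 2" "D' (i - 1) u"] by simp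
      also have "L_power L (Suc m) (i - 1) (L (i - 2) (D' (i - 1) u)) \<oplus>\<^bsub>V j\<^esub>
          add_pow (V j) (int m + 2) (L_power L (Suc m) (i - 1) u) = L_power L (Suc m) (i - 1) (D' i v)"
        unfolding Dv
        using L_power_plus[OF LDu deg.M.add.int_pow_closed[OF u(1)], of "Suc m" "int m + 2"]
          L_power_add_pow[OF u(1), of "Suc m" "int m + 2"] by (simp add: j algebra_simps del: L_power.simps)
      finally have 1: "D' (j + 1) (L j x) = L_power L (Suc m) (i - 1) (D' i v)" .
      let ?y = "L_power L m (i - 1) (D' i v)"
      have y: "?y \<in> carrier (V (j - 1))" by (rule L_power_closed[OF D'_closed[OF v(1)]]) (simp add: j)
      have z: "L_power L k i v \<in> carrier (V (j - 1))" using L_power_closed[OF v(1), of _ k] j k by simp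
      have "D' j x = ?y \<oplus>\<^bsub>V (j - 1)\<^esub> add_pow (V (j - 1)) (int m) (L_power L k i v)"
        using D'_up[OF n0 neg(1) v(1)] v(2) j k by simp
      then have "L (j - 1) (D' j x) = L (j - 1) ?y \<oplus>\<^bsub>V j\<^esub> add_pow (V j) (int m) (L (j - 1) (L_power L k i v))"
        using L_add[OF y deg.M.add.int_pow_closed[OF z], of "int m"] L_add_pow[OF z, of "int m"] by simp
      also have "L (j - 1) (L_power L k i v) = x" using v(2) j k by simp
      also have "L (j - 1) ?y = D' (j + 1) (L j x)" unfolding 1 by (simp add: j algebra_simps)
      finally have "L (j - 1) (D' j x) = D' (j + 1) (L j x) \<oplus>\<^bsub>V j\<^esub> add_pow (V j) (int m) x" .
      moreover have "D' (j + 1) (L j x) \<in> carrier (V j)"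
        using D'_closed[OF L_closed[OF x refl]] by simp
      moreover have "add_pow (V j) (n - 2 * j) x = \<ominus>\<^bsub>V j\<^esub> add_pow (V j) (int m) x"
        using deg.M.add.int_pow_neg[OF x, of "int m"] neg(2) by simp
      ultimately show ?thesis
        using x deg.M.a_comm[of "D' (j + 1) (L j x)" j "add_pow (V j) (int m) x"]
        by (simp add: deg.M.r_neg1)
    qed
  qed
  then have "D' (j + 1) (L j x) \<ominus>\<^bsub>V j\<^esub> L (j - 1) (D' j x) = add_pow (V j) (n - 2 * j) x"
    if "x \<in> carrier (V j)" for j x
    using that LD'_closed[OF that] by (simp add: a_minus_def deg.M.a_assoc deg.M.r_neg)
  moreover have "D' j \<in> extensional (carrier (V j))" for j by (auto simp: D'_def)
  ultimately show ?thesis using D'_lin by (auto simp: is_Lambda_def intro!: exI[of _ D'])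
qed

abbreviation \<Lambda> where "\<Lambda> \<equiv> Lambda_op E V L n"

lemma is_Lambda_Lambda_op: "is_Lambda E V L n \<Lambda>"
  unfolding Lambda_op_def using Lambda_exists Lambda_unique by (metis theI)

lemma Lambda_linear: "\<Lambda> j \<in> linear_maps E (V j) (V (j - 1))"
  using is_Lambda_Lambda_op by (simp add: is_Lambda_def)

lemma Lambda_closed: "x \<in> carrier (V j) \<Longrightarrow> i = j - 1 \<Longrightarrow> \<Lambda> j x \<in> carrier (V i)"
  using linear_maps_closed[OF Lambda_linear] by simp

lemma L_Lambda_closed: "x \<in> carrier (V j) \<Longrightarrow> L (j - 1) (\<Lambda> j x) \<in> carrier (V j)"
  using L_closed[OF Lambda_closed[OF _ refl], of x j j] by simp

lemma Lambda_L:
  assumes x: "x \<in> carrier (V j)"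
  shows "\<Lambda> (j + 1) (L j x) = L (j - 1) (\<Lambda> j x) \<oplus>\<^bsub>V j\<^esub> add_pow (V j) (n - 2 * j) x"
proof -
  have c: "\<Lambda> (j + 1) (L j x) \<in> carrier (V j)"
    using Lambda_closed[OF L_closed[OF x refl]] by simp
  have "\<Lambda> (j + 1) (L j x) \<ominus>\<^bsub>V j\<^esub> L (j - 1) (\<Lambda> j x) = add_pow (V j) (n - 2 * j) x"
    using is_Lambda_Lambda_op x by (simp add: is_Lambda_def)
  then show ?thesis using c L_Lambda_closed[OF x]
    by (metis a_minus_def deg.M.a_assoc deg.M.a_comm deg.M.add.inv_closed deg.M.l_neg deg.M.r_zero)
qed

text \<open>The commutator formula of sl2. The coefficient is the sum of n - 2 (j + t) over t = 0,
  ..., k, one summand for each factor L that is passed.\<close>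

lemma Lambda_L_power:
  assumes x: "x \<in> carrier (V j)"
  shows "\<Lambda> (j + int (Suc k)) (L_power L (Suc k) j x) = L_power L (Suc k) (j - 1) (\<Lambda> j x)
    \<oplus>\<^bsub>V (j + int k)\<^esub> add_pow (V (j + int k)) (int (Suc k) * (n - 2 * j - int k)) (L_power L k j x)"
proof (induction k)
  case 0
  then show ?case using Lambda_L[OF x] by simp
next
  case (Suc k)
  let ?j = "j + int (Suc k)" and ?y = "L_power L (Suc k) j x"
  let ?c = "int (Suc k) * (n - 2 * j - int k)"
  have y: "?y \<in> carrier (V ?j)" by (rule L_power_closed[OF x refl])
  have z: "L_power L k j x \<in> carrier (V (j + int k))" by (rule L_power_closed[OF x refl])
  have t: "L_power L (Suc k) (j - 1) (\<Lambda> j x) \<in> carrier (V (j + int k))"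
    by (rule L_power_closed[OF Lambda_closed[OF x refl]]) simp
  have Lt: "L_power L (Suc (Suc k)) (j - 1) (\<Lambda> j x) \<in> carrier (V ?j)"
    by (rule L_power_closed[OF Lambda_closed[OF x refl]]) simp
  have "\<Lambda> (?j + 1) (L ?j ?y) = L (?j - 1) (\<Lambda> ?j ?y) \<oplus>\<^bsub>V ?j\<^esub> add_pow (V ?j) (n - 2 * ?j) ?y"
    by (rule Lambda_L[OF y])
  also have "L (?j - 1) (\<Lambda> ?j ?y) = L (j + int k) (\<Lambda> ?j ?y)" by simp
  also have "\<dots> = L_power L (Suc (Suc k)) (j - 1) (\<Lambda> j x) \<oplus>\<^bsub>V ?j\<^esub> add_pow (V ?j) ?c ?y"
    unfolding Suc.IH
    using L_add[OF t deg.M.add.int_pow_closed[OF z], of ?c] L_add_pow[OF z, of ?c]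
    by (simp add: algebra_simps)
  also have "\<dots> \<oplus>\<^bsub>V ?j\<^esub> add_pow (V ?j) (n - 2 * ?j) ?y =
      L_power L (Suc (Suc k)) (j - 1) (\<Lambda> j x) \<oplus>\<^bsub>V ?j\<^esub> add_pow (V ?j) (?c + (n - 2 * ?j)) ?y"
    using Lt y by (simp add: deg.M.a_assoc deg.M.add.int_pow_mult del: L_power.simps)
  also have "?c + (n - 2 * ?j) = int (Suc (Suc k)) * (n - 2 * j - int (Suc k))"
    by (simp add: algebra_simps)
  finally show ?case by (simp add: algebra_simps)
qed

end


lemma linear_maps_codomain:
  assumes "f \<in> linear_maps R M N" "\<And>x. x \<in> carrier M \<Longrightarrow> f x \<in> H"
  shows "f \<in> linear_maps R M (N\<lparr>carrier := H\<rparr>)"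
  using assms by (auto simp: linear_maps_def)


section \<open>Extensions of Lefschetz modules\<close>

text \<open>
  The filtration \<open>V \<supseteq> F1 \<supseteq> F2\<close> is given by the projections \<open>p0\<close> and \<open>p1\<close> onto the first two
  graded quotients and by the inclusion \<open>\<iota>\<close> of the third one.
\<close>

locale lefschetz_extension =
  V: lefschetz E V L "n + 1" + Q0: lefschetz E Q0 L0 n +
  Q1: lefschetz E Q1 L1 "n + 1" + Q2: lefschetz E Q2 L2 "n + 2"
  for E :: "('e, 'r) ring_scheme" and V :: "int \<Rightarrow> ('e, 'v) module" and L and n
    and Q0 Q1 Q2 :: "int \<Rightarrow> ('e, 'q) module" and L0 L1 L2 +
  fixes F1 F2 :: "int \<Rightarrow> 'v set" and p0 p1 :: "int \<Rightarrow> 'v \<Rightarrow> 'q" and \<iota> :: "int \<Rightarrow> 'q \<Rightarrow> 'v"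
  assumes field: "field E"
    and char_0: "\<And>k::nat. add_pow E k \<one>\<^bsub>E\<^esub> = \<zero>\<^bsub>E\<^esub> \<Longrightarrow> k = 0"
    and F1: "submodule (F1 j) E (V j)"
    and F1_L: "x \<in> F1 j \<Longrightarrow> L j x \<in> F1 (j + 1)"
    and F2_F1: "F2 j \<subseteq> F1 j"
    and p0: "p0 j \<in> linear_maps E (V j) (Q0 j)"
    and p0_surj: "p0 j ` carrier (V j) = carrier (Q0 j)"
    and p0_ker: "x \<in> carrier (V j) \<Longrightarrow> p0 j x = \<zero>\<^bsub>Q0 j\<^esub> \<longleftrightarrow> x \<in> F1 j"
    and p0_L: "x \<in> carrier (V j) \<Longrightarrow> p0 (j + 1) (L j x) = L0 j (p0 j x)"
    and p1: "p1 j \<in> linear_maps E ((V j)\<lparr>carrier := F1 j\<rparr>) (Q1 j)"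
    and p1_surj: "p1 j ` F1 j = carrier (Q1 j)"
    and p1_ker: "x \<in> F1 j \<Longrightarrow> p1 j x = \<zero>\<^bsub>Q1 j\<^esub> \<longleftrightarrow> x \<in> F2 j"
    and p1_L: "x \<in> F1 j \<Longrightarrow> p1 (j + 1) (L j x) = L1 j (p1 j x)"
    and \<iota>: "\<iota> j \<in> linear_maps E (Q2 j) (V j)"
    and \<iota>_inj: "inj_on (\<iota> j) (carrier (Q2 j))"
    and \<iota>_image: "\<iota> j ` carrier (Q2 j) = F2 j"
    and \<iota>_L: "z \<in> carrier (Q2 j) \<Longrightarrow> \<iota> (j + 1) (L2 j z) = L j (\<iota> j z)"
begin

section \<open>Rules for the filtration, its projections and the inclusion\<close>

lemma F1_carrier: "x \<in> F1 j \<Longrightarrow> x \<in> carrier (V j)"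
  using V.deg.submoduleE(1)[OF F1] by auto

lemma F1_add: "x \<in> F1 j \<Longrightarrow> y \<in> F1 j \<Longrightarrow> x \<oplus>\<^bsub>V j\<^esub> y \<in> F1 j"
  by (rule V.deg.submoduleE(5)[OF F1])

lemma F1_smult: "a \<in> carrier E \<Longrightarrow> x \<in> F1 j \<Longrightarrow> a \<odot>\<^bsub>V j\<^esub> x \<in> F1 j"
  by (rule V.deg.submoduleE(4)[OF F1])

lemma F1_minus: "x \<in> F1 j \<Longrightarrow> y \<in> F1 j \<Longrightarrow> x \<ominus>\<^bsub>V j\<^esub> y \<in> F1 j"
  unfolding a_minus_def by (intro F1_add V.deg.submoduleE(3)[OF F1])

lemmas p0_closed = linear_maps_closed[OF p0]
  and p0_add = linear_maps_add[OF p0]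
  and p0_minus = linear_maps_minus[OF V.module_component Q0.module_component p0]
  and p0_add_pow = linear_maps_add_pow[OF V.module_component Q0.module_component p0]
  and \<iota>_add = linear_maps_add[OF \<iota>]
  and \<iota>_zero = linear_maps_zero[OF Q2.module_component V.module_component \<iota>]
  and \<iota>_minus = linear_maps_minus[OF Q2.module_component V.module_component \<iota>]
  and \<iota>_add_pow = linear_maps_add_pow[OF Q2.module_component V.module_component \<iota>]

lemma \<iota>_closed: "x \<in> carrier (Q2 j) \<Longrightarrow> i = j \<Longrightarrow> \<iota> j x \<in> carrier (V i)"
  using linear_maps_closed[OF \<iota>] by simp

lemma \<iota>_F2: "x \<in> carrier (Q2 j) \<Longrightarrow> \<iota> j x \<in> F2 j"
  using \<iota>_image by blast

lemma \<iota>_F1: "x \<in> carrier (Q2 j) \<Longrightarrow> \<iota> j x \<in> F1 j"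
  using \<iota>_F2 F2_F1 by blast

lemma p0_\<iota>: "x \<in> carrier (Q2 j) \<Longrightarrow> p0 j (\<iota> j x) = \<zero>\<^bsub>Q0 j\<^esub>"
  using p0_ker[OF \<iota>_closed] \<iota>_F1 by blast

lemma \<iota>_eq_0: "x \<in> carrier (Q2 j) \<Longrightarrow> \<iota> j x = \<zero>\<^bsub>V j\<^esub> \<Longrightarrow> x = \<zero>\<^bsub>Q2 j\<^esub>"
  using \<iota>_inj[of j] \<iota>_zero[of j] by (metis Q2.deg.M.zero_closed inj_onD)

lemma p1_closed: "x \<in> F1 j \<Longrightarrow> p1 j x \<in> carrier (Q1 j)"
  using p1_surj by blast

lemma p0_lift:
  assumes "y \<in> carrier (Q0 j)"
  obtains x where "x \<in> carrier (V j)" "p0 j x = y"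
  using assms unfolding p0_surj[symmetric] by blast

lemma p1_lift:
  assumes "y \<in> carrier (Q1 j)"
  obtains x where "x \<in> F1 j" "p1 j x = y"
  using assms unfolding p1_surj[symmetric] by blast

lemma F2_lift:
  assumes "y \<in> F2 j"
  obtains x where "x \<in> carrier (Q2 j)" "\<iota> j x = y"
  using assms unfolding \<iota>_image[symmetric] by blast

lemma p1_add: "x \<in> F1 j \<Longrightarrow> y \<in> F1 j \<Longrightarrow> p1 j (x \<oplus>\<^bsub>V j\<^esub> y) = p1 j x \<oplus>\<^bsub>Q1 j\<^esub> p1 j y"
  using linear_maps_add[OF p1] by simp

lemma p1_smult: "a \<in> carrier E \<Longrightarrow> x \<in> F1 j \<Longrightarrow> p1 j (a \<odot>\<^bsub>V j\<^esub> x) = a \<odot>\<^bsub>Q1 j\<^esub> p1 j x"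
  using linear_maps_smult[OF p1] by simp

lemma p1_\<iota>: "x \<in> carrier (Q2 j) \<Longrightarrow> p1 j (\<iota> j x) = \<zero>\<^bsub>Q1 j\<^esub>"
  using p1_ker[OF \<iota>_F1] \<iota>_F2 by blast

lemma p1_minus: "x \<in> F1 j \<Longrightarrow> y \<in> F1 j \<Longrightarrow> p1 j (x \<ominus>\<^bsub>V j\<^esub> y) = p1 j x \<ominus>\<^bsub>Q1 j\<^esub> p1 j y"
proof -
  assume xy: "x \<in> F1 j" "y \<in> F1 j"
  have "p1 j ((x \<ominus>\<^bsub>V j\<^esub> y) \<oplus>\<^bsub>V j\<^esub> y) = p1 j (x \<ominus>\<^bsub>V j\<^esub> y) \<oplus>\<^bsub>Q1 j\<^esub> p1 j y"
    using xy by (intro p1_add F1_minus)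
  moreover have "(x \<ominus>\<^bsub>V j\<^esub> y) \<oplus>\<^bsub>V j\<^esub> y = x"
    using xy F1_carrier by (simp add: a_minus_def V.deg.M.a_assoc V.deg.M.l_neg)
  ultimately show ?thesis
    using p1_closed[OF xy(1)] p1_closed[OF xy(2)] p1_closed[OF F1_minus[OF xy]]
    by (simp add: a_minus_def Q1.deg.M.a_assoc Q1.deg.M.r_neg)
qed

lemma F1_L_power: "x \<in> F1 j \<Longrightarrow> L_power L k j x \<in> F1 (j + int k)"
proof (induction k)
  case (Suc k)
  then show ?case using F1_L[of "L_power L k j x" "j + int k"] by (simp add: algebra_simps)
qed simp

lemma p1_L_power: "x \<in> F1 j \<Longrightarrow> p1 (j + int k) (L_power L k j x) = L_power L1 k j (p1 j x)"
proof (induction k)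
  case (Suc k)
  then show ?case using p1_L[OF F1_L_power[of x j k]] by (simp add: algebra_simps)
qed simp

lemma p0_L_power:
  "x \<in> carrier (V j) \<Longrightarrow> i = j + int k \<Longrightarrow> p0 i (L_power L k j x) = L_power L0 k j (p0 j x)"
  by (rule L_power_commute[of E V L p0 L0, OF V.graded_L_axioms p0_L])

lemma \<iota>_L_power:
  "x \<in> carrier (Q2 j) \<Longrightarrow> i = j + int k \<Longrightarrow> \<iota> i (L_power L2 k j x) = L_power L k j (\<iota> j x)"
  by (rule L_power_commute[of E Q2 L2 \<iota> L, OF Q2.graded_L_axioms \<iota>_L])

text \<open>In characteristic 0 the integer k + 1 is a nonzero, hence invertible, element of the
  field. One scalar serves all modules, since in each of them the multiple is taken by this same
  element.\<close>

lemma scalar_inverse: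
  obtains a where "a \<in> carrier E"
    "\<And>(M :: ('e, 'q) module) x. module E M \<Longrightarrow> x \<in> carrier M \<Longrightarrow> a \<odot>\<^bsub>M\<^esub> add_pow M (int (Suc k)) x = x"
proof -
  interpret E: field E by (rule field)
  define e where "e = add_pow E (int (Suc k)) \<one>\<^bsub>E\<^esub>"
  have "e = add_pow E (Suc k) \<one>\<^bsub>E\<^esub>"
    unfolding e_def add_pow_def by (rule int_pow_int)
  then have "e \<noteq> \<zero>\<^bsub>E\<^esub>" using char_0[of "Suc k"] by auto
  moreover have "e \<in> carrier E" by (simp add: e_def)
  ultimately have e: "e \<in> Units E" "e \<in> carrier E" by (auto simp: E.field_Units)
  show thesis
  proof (rule that[of "inv\<^bsub>E\<^esub> e"])
    show "inv\<^bsub>E\<^esub> e \<in> carrier E" using e by simp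
    fix M :: "('e, 'q) module" and x
    assume M: "module E M" and x: "x \<in> carrier M"
    interpret M: module E M by fact
    show "inv\<^bsub>E\<^esub> e \<odot>\<^bsub>M\<^esub> add_pow M (int (Suc k)) x = x"
      using M.add_pow_eq_smult[OF x, of "int (Suc k)"] e x
      unfolding e_def[symmetric] by (simp add: M.smult_assoc1[symmetric] del: of_nat_Suc)
  qed
qed

lemma add_pow_eq_0:
  fixes M :: "('e, 'q) module"
  assumes "module E M" "x \<in> carrier M" "add_pow M (int (Suc k)) x = \<zero>\<^bsub>M\<^esub>"
  shows "x = \<zero>\<^bsub>M\<^esub>"
proof -
  interpret M: module E M by fact
  obtain a where "a \<in> carrier E" "a \<odot>\<^bsub>M\<^esub> add_pow M (int (Suc k)) x = x"
    using scalar_inverse assms(1,2) by metis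
  then show ?thesis using assms(3) by simp
qed

section \<open>The map induced by \<Lambda> and its restriction to G2\<close>

definition b where "b j x = p0 (j - 1) (V.\<Lambda> j x)"

lemma b_linear: "b j \<in> linear_maps E (V j) (Q0 (j - 1))"
  unfolding b_def by (rule linear_maps_comp[OF V.Lambda_linear p0])

lemmas b_closed = linear_maps_closed[OF b_linear]
  and b_minus = linear_maps_minus[OF V.module_component Q0.module_component b_linear]

text \<open>The commutator of \<Lambda> and L contributes an integer multiple of x, and
  \<open>p0\<close> kills it because x lies in F1.\<close>

lemma b_L:
  assumes x: "x \<in> F1 j"
  shows "b (j + 1) (L j x) = L0 (j - 1) (b j x)"
proof -
  note xV = F1_carrier[OF x]
  have "b (j + 1) (L j x) = p0 j (L (j - 1) (V.\<Lambda> j x) \<oplus>\<^bsub>V j\<^esub> add_pow (V j) (n + 1 - 2 * j) x)"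
    by (simp add: b_def V.Lambda_L[OF xV])
  also have "\<dots> = p0 j (L (j - 1) (V.\<Lambda> j x)) \<oplus>\<^bsub>Q0 j\<^esub> add_pow (Q0 j) (n + 1 - 2 * j) (p0 j x)"
    using xV V.L_Lambda_closed[OF xV] by (simp add: p0_add p0_add_pow)
  also have "p0 j x = \<zero>\<^bsub>Q0 j\<^esub>" using p0_ker[OF xV] x by simp
  also have "p0 j (L (j - 1) (V.\<Lambda> j x)) = L0 (j - 1) (b j x)"
    using p0_L[OF V.Lambda_closed[OF xV refl]] by (simp add: b_def)
  finally show ?thesis
    using Q0.L_closed[OF b_closed[OF xV], of j] by simp
qed

definition c where "c j x = b j (\<iota> j x)"

lemma c_linear: "c j \<in> linear_maps E (Q2 j) (Q0 (j - 1))"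
  unfolding c_def by (rule linear_maps_comp[OF \<iota> b_linear])

lemmas c_zero = linear_maps_zero[OF Q2.module_component Q0.module_component c_linear]
  and c_closed = linear_maps_closed[OF c_linear]

lemma c_L: "x \<in> carrier (Q2 j) \<Longrightarrow> c (j + 1) (L2 j x) = L0 (j - 1) (c j x)"
  by (simp add: c_def \<iota>_L b_L \<iota>_F1)

lemma c_L_power:
  assumes "x \<in> carrier (Q2 j)" "i = j + int k"
  shows "c i (L_power L2 k j x) = L_power L0 k (j - 1) (c j x)"
proof -
  have "c i (L_power L2 k j x) = L_power (\<lambda>j. L0 (j - 1)) k j (c j x)"
    by (rule L_power_commute[of E Q2 L2 c "\<lambda>j. L0 (j - 1)", OF Q2.graded_L_axioms c_L assms])
  then show ?thesis using L_power_shift[of L0 "-1" k j] by simp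
qed

text \<open>Put y = \<Lambda> (\<iota> k), which lies in F1 because c k = 0. Applying \<Lambda> to
  L^(w+1) (\<iota> k) = 0 gives L^(w+1) y = (w + 1) L^w (\<iota> k). The right side lies in F2, so y
  has class zero in G1 and comes from some z in G2. One more L turns the right side into zero, so z
  = 0. Then (w + 1) L^w k = 0, and k = 0 in characteristic 0.\<close>

lemma c_injective_on_primitives:
  assumes w: "n + 2 = 2 * i + int w" and k: "k \<in> carrier (Q2 i)"
    and prim: "L_power L2 (Suc w) i k = \<zero>\<^bsub>Q2 (i + int (Suc w))\<^esub>" and ck: "c i k = \<zero>\<^bsub>Q0 (i - 1)\<^esub>"
  shows "k = \<zero>\<^bsub>Q2 i\<^esub>"
proof -
  define y where "y = V.\<Lambda> i (\<iota> i k)"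
  define m where "m = add_pow (Q2 (i + int w)) (int (Suc w)) (L_power L2 w i k)"
  have \<iota>k: "\<iota> i k \<in> carrier (V i)" by (rule \<iota>_closed[OF k refl])
  have y: "y \<in> carrier (V (i - 1))" unfolding y_def by (rule V.Lambda_closed[OF \<iota>k refl])
  have yF1: "y \<in> F1 (i - 1)" using p0_ker[OF y] ck by (simp add: c_def b_def y_def)
  have Lk: "L_power L2 w i k \<in> carrier (Q2 (i + int w))" by (rule Q2.L_power_closed[OF k refl])
  have m: "m \<in> carrier (Q2 (i + int w))" unfolding m_def using Lk by simp
  have Ly: "L_power L (Suc w) (i - 1) y \<in> carrier (V (i + int w))"
    by (rule V.L_power_closed[OF y]) simp
  have "L_power L (Suc w) i (\<iota> i k) = \<zero>\<^bsub>V (i + int (Suc w))\<^esub>"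
    using \<iota>_L_power[OF k refl, of "Suc w"] prim \<iota>_zero by simp
  then have "V.\<Lambda> (i + int (Suc w)) \<zero>\<^bsub>V (i + int (Suc w))\<^esub> = L_power L (Suc w) (i - 1) y
    \<oplus>\<^bsub>V (i + int w)\<^esub> add_pow (V (i + int w)) (int (Suc w) * (n + 1 - 2 * i - int w)) (L_power L w i (\<iota> i k))"
    using V.Lambda_L_power[OF \<iota>k, of w] by (simp only: y_def)
  \<comment> \<open>V has doubled center n + 1, one less than n + 2 = 2 i + w; hence the factor
    -1.\<close>
  also have "int (Suc w) * (n + 1 - 2 * i - int w) = - int (Suc w)"
  proof -
    have "n + 1 - 2 * i - int w = -1" using w by simp
    then show ?thesis by (simp only: mult_minus1_right)
  qed
  also have "add_pow (V (i + int w)) (- int (Suc w)) (L_power L w i (\<iota> i k)) = \<ominus>\<^bsub>V (i + int w)\<^esub> \<iota> (i + int w) m"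
    unfolding m_def \<iota>_add_pow[OF Lk] \<iota>_L_power[OF k refl]
    by (rule V.deg.M.add.int_pow_neg[OF V.L_power_closed[OF \<iota>k refl]])
  also have "V.\<Lambda> (i + int (Suc w)) \<zero>\<^bsub>V (i + int (Suc w))\<^esub> = \<zero>\<^bsub>V (i + int w)\<^esub>"
    using linear_maps_zero[OF V.module_component V.module_component V.Lambda_linear, of "i + int (Suc w)"]
    by (simp add: algebra_simps)
  finally have Ly_eq: "L_power L (Suc w) (i - 1) y = \<iota> (i + int w) m"
    using Ly \<iota>_closed[OF m refl] V.deg.minus_eq_0_iff[OF Ly \<iota>_closed[OF m refl]]
    by (simp add: a_minus_def)
  \<comment> \<open>For G1 in degree \<open>i - 1\<close> the exponent w + 1 is exactly the
    Lefschetz exponent, because 2 (i - 1) + w + 1 = n + 1.\<close>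
  have "L_power L1 (Suc w) (i - 1) (p1 (i - 1) y) = p1 (i + int w) (\<iota> (i + int w) m)"
    using p1_L_power[OF yF1, of "Suc w"] Ly_eq by simp
  then have "p1 (i - 1) y = \<zero>\<^bsub>Q1 (i - 1)\<^esub>"
    using w p1_\<iota>[OF m] by (intro Q1.L_power_eq_0[of "i - 1" "Suc w", OF _ p1_closed[OF yF1]]) simp_all
  then have "y \<in> F2 (i - 1)" using p1_ker[OF yF1] by simp
  then obtain z where z: "z \<in> carrier (Q2 (i - 1))" "y = \<iota> (i - 1) z" using F2_lift by metis
  have Lz: "L_power L2 (Suc w) (i - 1) z \<in> carrier (Q2 (i + int w))"
    by (rule Q2.L_power_closed[OF z(1)]) simp
  have "\<iota> (i + int w) (L_power L2 (Suc w) (i - 1) z) = \<iota> (i + int w) m"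
    using \<iota>_L_power[OF z(1), of "i + int w" "Suc w"] Ly_eq z(2) by simp
  then have Lzm: "L_power L2 (Suc w) (i - 1) z = m" using \<iota>_inj Lz m by (auto dest: inj_onD)
  have "L_power L2 (Suc (Suc w)) (i - 1) z = L2 (i + int w) m" using Lzm by simp
  also have "\<dots> = add_pow (Q2 (i + int w + 1)) (int (Suc w)) (L2 (i + int w) (L_power L2 w i k))"
    unfolding m_def by (rule Q2.L_add_pow[OF Lk])
  also have "L2 (i + int w) (L_power L2 w i k) = \<zero>\<^bsub>Q2 (i + int w + 1)\<^esub>"
    using prim by (simp add: algebra_simps)
  finally have "L_power L2 (Suc (Suc w)) (i - 1) z = \<zero>\<^bsub>Q2 (i - 1 + int (Suc (Suc w)))\<^esub>"
    by (simp add: algebra_simps del: L_power.simps)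
  then have "z = \<zero>\<^bsub>Q2 (i - 1)\<^esub>"
    using w by (intro Q2.L_power_eq_0[of "i - 1" "Suc (Suc w)", OF _ z(1)]) simp_all
  then have "m = \<zero>\<^bsub>Q2 (i + int w)\<^esub>"
    using Lzm Q2.L_power_zero[of "Suc w" "i - 1"] by simp
  then have "L_power L2 w i k = \<zero>\<^bsub>Q2 (i + int w)\<^esub>"
    using add_pow_eq_0[OF Q2.module_component Lk] by (simp add: m_def)
  then show ?thesis using w k by (intro Q2.L_power_eq_0[of i w k]) simp_all
qed

text \<open>A suitable lift x'' of y satisfies L^(w+1) x'' = \<iota> k' with L k' = 0. Applying p0
  \<Lambda> to this equation gives c k' = L^(w+1) z + (w + 1) L^w y, and L k' = 0 forces z = 0. With
  k' = L^w k it follows that c k = (w + 1) y, and w + 1 is invertible.\<close>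

lemma c_onto_primitives:
  assumes w: "n + 2 = 2 * i + int w" and y: "y \<in> carrier (Q0 (i - 1))"
    and prim: "L_power L0 (Suc w) (i - 1) y = \<zero>\<^bsub>Q0 (i + int w)\<^esub>"
  shows "y \<in> c i ` carrier (Q2 i)"
proof -
  obtain x where x: "x \<in> carrier (V (i - 1))" "p0 (i - 1) x = y" using p0_lift[OF y] .
  let ?d = "i + int w"
  have d: "?d = i - 1 + int (Suc w)" by simp
  have w0: "n = 2 * (i - 1) + int w" "n = 2 * (i - 2) + int (Suc (Suc w))"
    and w1: "n + 1 = 2 * (i - 1) + int (Suc w)"
    and w2: "n + 2 = 2 * (i - 1) + int (Suc (Suc w))" using w by simp_all
  text \<open>Correct the lift \<open>x\<close> of \<open>y\<close> by \<open>F1\<close> and then by \<open>F2\<close>.\<close>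
  have Lx: "L_power L (Suc w) (i - 1) x \<in> carrier (V ?d)" by (rule V.L_power_closed[OF x(1) d])
  have LxF1: "L_power L (Suc w) (i - 1) x \<in> F1 ?d"
    using p0_ker[OF Lx] p0_L_power[OF x(1) d] x(2) prim by metis
  \<comment> \<open>L^(w+1) maps degree \<open>i - 1\<close> of G1 isomorphically onto degree i + w,
    so the class of L^(w+1) x in G1 can be removed.\<close>
  obtain q where q: "q \<in> carrier (Q1 (i - 1))"
    "L_power L1 (Suc w) (i - 1) q = p1 ?d (L_power L (Suc w) (i - 1) x)"
    using Q1.L_power_surj[OF w1 d p1_closed[OF LxF1]] by blast
  obtain f where f: "f \<in> F1 (i - 1)" "p1 (i - 1) f = q" using p1_lift[OF q(1)] .
  have LfF1: "L_power L (Suc w) (i - 1) f \<in> F1 ?d" using F1_L_power[OF f(1), of "Suc w"] by simp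
  define x' where "x' = x \<ominus>\<^bsub>V (i - 1)\<^esub> f"
  have x': "x' \<in> carrier (V (i - 1))" using x(1) F1_carrier[OF f(1)] by (simp add: x'_def)
  have p0x': "p0 (i - 1) x' = y"
    using p0_minus[OF x(1) F1_carrier[OF f(1)]] p0_ker[OF F1_carrier[OF f(1)]] f(1) x(2) y
    by (simp add: x'_def a_minus_def)
  have Lx': "L_power L (Suc w) (i - 1) x' = L_power L (Suc w) (i - 1) x \<ominus>\<^bsub>V ?d\<^esub> L_power L (Suc w) (i - 1) f"
    unfolding x'_def using V.L_power_minus[OF x(1) F1_carrier[OF f(1)], of "Suc w"] by simp
  have Lx'F1: "L_power L (Suc w) (i - 1) x' \<in> F1 ?d"
    unfolding Lx' by (rule F1_minus[OF LxF1 LfF1])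
  have "p1 ?d (L_power L (Suc w) (i - 1) x') = \<zero>\<^bsub>Q1 ?d\<^esub>"
    unfolding Lx' p1_minus[OF LxF1 LfF1] using q p1_L_power[OF f(1), of "Suc w"] f(2) p1_closed[OF LxF1]
    by (simp add: a_minus_def Q1.deg.M.r_neg del: L_power.simps)
  then have "L_power L (Suc w) (i - 1) x' \<in> F2 ?d" using p1_ker[OF Lx'F1] by simp
  then obtain g where g: "g \<in> carrier (Q2 ?d)" "L_power L (Suc w) (i - 1) x' = \<iota> ?d g"
    using F2_lift by metis
  \<comment> \<open>In G2 the Lefschetz exponent of degree \<open>i - 1\<close> is w + 2, so L^(w+1)
    need not reach g. What can be matched is L g, which leaves a remainder k' killed by L.\<close>
  obtain h where h: "h \<in> carrier (Q2 (i - 1))" "L_power L2 (Suc (Suc w)) (i - 1) h = L2 ?d g"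
    using Q2.L_power_surj[OF w2, of "?d + 1" "L2 ?d g"] Q2.L_closed[OF g(1) refl] by auto
  have Lh: "L_power L2 (Suc w) (i - 1) h \<in> carrier (Q2 ?d)" by (rule Q2.L_power_closed[OF h(1) d])
  define x'' where "x'' = x' \<ominus>\<^bsub>V (i - 1)\<^esub> \<iota> (i - 1) h"
  define k' where "k' = g \<ominus>\<^bsub>Q2 ?d\<^esub> L_power L2 (Suc w) (i - 1) h"
  have \<iota>h: "\<iota> (i - 1) h \<in> carrier (V (i - 1))" by (rule \<iota>_closed[OF h(1) refl])
  have x'': "x'' \<in> carrier (V (i - 1))" using x' \<iota>h by (simp add: x''_def)
  have k': "k' \<in> carrier (Q2 ?d)" using g(1) Lh by (simp add: k'_def del: L_power.simps)
  have p0x'': "p0 (i - 1) x'' = y"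
    using p0_minus[OF x' \<iota>h] p0_\<iota>[OF h(1)] p0x' y by (simp add: x''_def a_minus_def)
  have Lx'': "L_power L (Suc w) (i - 1) x'' = \<iota> ?d k'"
    unfolding x''_def k'_def \<iota>_minus[OF g(1) Lh] \<iota>_L_power[OF h(1) d] g(2)[symmetric]
    using V.L_power_minus[OF x' \<iota>h, of "Suc w"] by simp
  have Lk': "L2 ?d k' = \<zero>\<^bsub>Q2 (?d + 1)\<^esub>"
    unfolding k'_def Q2.L_minus[OF g(1) Lh] h(2)[symmetric]
    using Q2.L_closed[OF g(1) refl] h(2) by (simp add: a_minus_def Q2.deg.M.r_neg)
  define z where "z = p0 (i - 2) (V.\<Lambda> (i - 1) x'')"
  have \<Lambda>x: "V.\<Lambda> (i - 1) x'' \<in> carrier (V (i - 2))" by (rule V.Lambda_closed[OF x'']) simp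
  have z: "z \<in> carrier (Q0 (i - 2))" unfolding z_def by (rule p0_closed[OF \<Lambda>x])
  have Lz: "L_power L0 (Suc w) (i - 2) z \<in> carrier (Q0 (?d - 1))"
    by (rule Q0.L_power_closed[OF z]) simp
  have Lwy: "L_power L0 w (i - 1) y \<in> carrier (Q0 (?d - 1))"
    by (rule Q0.L_power_closed[OF y]) simp
  have ck': "c ?d k' = L_power L0 (Suc w) (i - 2) z \<oplus>\<^bsub>Q0 (?d - 1)\<^esub>
      add_pow (Q0 (?d - 1)) (int (Suc w)) (L_power L0 w (i - 1) y)"
  proof -
    have "c ?d k' = p0 (?d - 1) (V.\<Lambda> (i - 1 + int (Suc w)) (L_power L (Suc w) (i - 1) x''))"
      by (simp add: c_def b_def Lx'' del: L_power.simps)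
    also have "\<dots> = p0 (?d - 1) (L_power L (Suc w) (i - 2) (V.\<Lambda> (i - 1) x'') \<oplus>\<^bsub>V (?d - 1)\<^esub>
      add_pow (V (?d - 1)) (int (Suc w) * (n + 1 - 2 * (i - 1) - int w)) (L_power L w (i - 1) x''))"
      unfolding V.Lambda_L_power[OF x''] by (simp add: algebra_simps del: L_power.simps)
    \<comment> \<open>Now 2 (i - 1) + w = n, one less than the doubled center of V; hence the factor
      1.\<close>
    also have "n + 1 - 2 * (i - 1) - int w = 1" using w by simp
    also have "p0 (?d - 1) (L_power L (Suc w) (i - 2) (V.\<Lambda> (i - 1) x'') \<oplus>\<^bsub>V (?d - 1)\<^esub>
      add_pow (V (?d - 1)) (int (Suc w) * 1) (L_power L w (i - 1) x'')) =
      p0 (?d - 1) (L_power L (Suc w) (i - 2) (V.\<Lambda> (i - 1) x'')) \<oplus>\<^bsub>Q0 (?d - 1)\<^esub>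
      add_pow (Q0 (?d - 1)) (int (Suc w) * 1) (p0 (?d - 1) (L_power L w (i - 1) x''))"
    proof -
      have c1: "L_power L (Suc w) (i - 2) (V.\<Lambda> (i - 1) x'') \<in> carrier (V (?d - 1))"
        by (rule V.L_power_closed[OF \<Lambda>x]) simp
      have c2: "L_power L w (i - 1) x'' \<in> carrier (V (?d - 1))" by (rule V.L_power_closed[OF x'']) simp
      show ?thesis
        by (simp only: p0_add[OF c1 V.deg.M.add.int_pow_closed[OF c2]] p0_add_pow[OF c2])
    qed
    also have "p0 (?d - 1) (L_power L (Suc w) (i - 2) (V.\<Lambda> (i - 1) x'')) = L_power L0 (Suc w) (i - 2) z"
      unfolding z_def by (rule p0_L_power[OF \<Lambda>x]) simp
    also have "p0 (?d - 1) (L_power L w (i - 1) x'') = L_power L0 w (i - 1) y"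
      using p0_L_power[OF x'', of "?d - 1" w] p0x'' by simp
    finally show ?thesis by simp
  qed
  \<comment> \<open>L kills k' and L^(w+1) kills y, so L^(w+2) z = 0; w + 2 is the Lefschetz
    exponent of G0 in degree \<open>i - 2\<close>.\<close>
  have "L0 (?d - 1) (c ?d k') = \<zero>\<^bsub>Q0 ?d\<^esub>"
    using c_L[OF k'] Lk' c_zero[of "?d + 1"] by simp
  also have "L0 (?d - 1) (c ?d k') = L0 (?d - 1) (L_power L0 (Suc w) (i - 2) z) \<oplus>\<^bsub>Q0 ?d\<^esub>
      add_pow (Q0 ?d) (int (Suc w)) (L0 (?d - 1) (L_power L0 w (i - 1) y))"
    unfolding ck' using Q0.L_add[OF Lz Q0.deg.M.add.int_pow_closed[OF Lwy], of "int (Suc w)"]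
      Q0.L_add_pow[OF Lwy, of "int (Suc w)"] by (simp del: L_power.simps of_nat_Suc)
  also have "L0 (?d - 1) (L_power L0 w (i - 1) y) = \<zero>\<^bsub>Q0 ?d\<^esub>"
    using prim by (simp add: algebra_simps)
  also have "L0 (?d - 1) (L_power L0 (Suc w) (i - 2) z) = L_power L0 (Suc (Suc w)) (i - 2) z"
    by (simp add: algebra_simps)
  finally have "L_power L0 (Suc (Suc w)) (i - 2) z = \<zero>\<^bsub>Q0 (i - 2 + int (Suc (Suc w)))\<^esub>"
    using Q0.L_power_closed[OF z, of ?d "Suc (Suc w)"] by (simp del: L_power.simps)
  then have "z = \<zero>\<^bsub>Q0 (i - 2)\<^esub>"
    by (intro Q0.L_power_eq_0[of "i - 2" "Suc (Suc w)", OF _ z]) (use w0 in simp_all)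
  then have "L_power L0 (Suc w) (i - 2) z = \<zero>\<^bsub>Q0 (?d - 1)\<^esub>"
    using Q0.L_power_zero[of "Suc w" "i - 2"] by (simp add: algebra_simps del: L_power.simps)
  then have ck'2: "c ?d k' = add_pow (Q0 (?d - 1)) (int (Suc w)) (L_power L0 w (i - 1) y)"
    using ck' Lwy by simp
  \<comment> \<open>By \<open>w\<close>, the Lefschetz exponent of G2 in degree i is w.\<close>
  obtain k where k: "k \<in> carrier (Q2 i)" "L_power L2 w i k = k'"
    using Q2.L_power_surj[OF w refl k'] by blast
  have "L_power L0 w (i - 1) (c i k) = L_power L0 w (i - 1) (add_pow (Q0 (i - 1)) (int (Suc w)) y)"
    using c_L_power[OF k(1), of ?d w] k(2) ck'2 Q0.L_power_add_pow[OF y, of w "int (Suc w)"]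
    by (simp add: algebra_simps)
  then have ck: "c i k = add_pow (Q0 (i - 1)) (int (Suc w)) y"
    by (rule Q0.L_power_inj[OF w0(1) c_closed[OF k(1)] Q0.deg.M.add.int_pow_closed[OF y]])
  obtain a where a: "a \<in> carrier E" "a \<odot>\<^bsub>Q0 (i - 1)\<^esub> add_pow (Q0 (i - 1)) (int (Suc w)) y = y"
    using scalar_inverse[of w] Q0.module_component y by metis
  have "c i (a \<odot>\<^bsub>Q2 i\<^esub> k) = y"
    using linear_maps_smult[OF c_linear a(1) k(1)] ck a(2) by simp
  then show ?thesis using a(1) k(1) by (intro rev_image_eqI[of "a \<odot>\<^bsub>Q2 i\<^esub> k"]) auto
qed

text \<open>Lowering the degree by one takes G0 from n to n + 2, the doubled center of G2, so
  primitive vectors suffice.\<close>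

lemma c_iso: "c j \<in> linear_isos E (Q2 j) (Q0 (j - 1))"
proof (rule L_linear_iso[of E Q2 L2 "n + 2" "\<lambda>j. Q0 (j - 1)" "\<lambda>j. L0 (j - 1)" c])
  show "lefschetz_module E Q2 L2 (n + 2)" by (rule Q2.lefschetz)
  show "lefschetz_module E (\<lambda>j. Q0 (j - 1)) (\<lambda>j. L0 (j - 1)) (n + 2)"
    by (rule lefschetz_shift_down[OF Q0.lefschetz])
  show "y \<in> c i ` carrier (Q2 i)" if "n + 2 = 2 * i + int w" "y \<in> carrier (Q0 (i - 1))"
    "L_power (\<lambda>j. L0 (j - 1)) (Suc w) i y = \<zero>\<^bsub>Q0 (i + int (Suc w) - 1)\<^esub>" for i w y
    using c_onto_primitives[OF that(1,2)] that(3) L_power_shift[of L0 "-1" "Suc w" i]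
    by (simp del: L_power.simps)
qed (use c_linear c_L c_injective_on_primitives in auto)


section \<open>The isomorphism \<beta> from G0 to G2\<close>

definition \<beta> where "\<beta> j = inv_into (carrier (Q2 (j + 1))) (c (j + 1))"

lemma \<beta>_iso: "\<beta> j \<in> linear_isos E (Q0 j) (Q2 (j + 1))"
  using linear_isos_inv[OF c_iso[of "j + 1"] Q2.module_component] by (simp add: \<beta>_def)

lemmas \<beta>_linear = linear_isosD(1)[OF \<beta>_iso]
  and \<beta>_zero = linear_maps_zero[OF Q0.module_component Q2.module_component linear_isosD(1)[OF \<beta>_iso]]

lemma \<beta>_closed: "x \<in> carrier (Q0 j) \<Longrightarrow> i = j + 1 \<Longrightarrow> \<beta> j x \<in> carrier (Q2 i)"
  using linear_maps_closed[OF \<beta>_linear] by simp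

lemma c_\<beta>: "x \<in> carrier (Q0 j) \<Longrightarrow> c (j + 1) (\<beta> j x) = x"
  unfolding \<beta>_def using bij_betw_inv_into_right[OF linear_isosD(2)[OF c_iso[of "j + 1"]]] by simp

lemma \<beta>_c: "x \<in> carrier (Q2 j) \<Longrightarrow> \<beta> (j - 1) (c j x) = x"
  unfolding \<beta>_def using bij_betw_inv_into_left[OF linear_isosD(2)[OF c_iso[of j]]] by simp

text \<open>The matrix of \<Lambda> contains the inverse of \<beta> as an \<open>inv_into\<close>;
  this brings it back to \<open>c\<close>.\<close>

lemma inv_\<beta>:
  assumes "x \<in> carrier (Q2 j)"
  shows "inv_into (carrier (Q0 (j - 1))) (\<beta> (j - 1)) x = c j x"
proof -
  have "inv_into (carrier (Q0 (j - 1))) (\<beta> (j - 1)) (\<beta> (j - 1) (c j x)) = c j x"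
    by (rule bij_betw_inv_into_left[OF linear_isosD(2)[OF \<beta>_iso] c_closed[OF assms]])
  then show ?thesis by (simp add: \<beta>_c assms)
qed

lemma \<beta>_L:
  assumes x: "x \<in> carrier (Q0 j)"
  shows "\<beta> (j + 1) (L0 j x) = L2 (j + 1) (\<beta> j x)"
proof -
  have "\<beta> (j + 1) (c (j + 1 + 1) (L2 (j + 1) (\<beta> j x))) = L2 (j + 1) (\<beta> j x)"
    using \<beta>_c[OF Q2.L_closed[OF \<beta>_closed[OF x refl] refl]] by (simp add: add.commute)
  then show ?thesis using c_L[OF \<beta>_closed[OF x refl]] c_\<beta>[OF x] by simp
qed

text \<open>Both sides have the same commutator with L, because n + 2 - 2 (j + 1) = n - 2 j. Their
  difference is therefore L-linear, from doubled center n to n + 2.\<close>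

lemma \<beta>_Lambda:
  assumes x: "x \<in> carrier (Q0 j)"
  shows "Q2.\<Lambda> (j + 1) (\<beta> j x) = \<beta> (j - 1) (Q0.\<Lambda> j x)"
proof (rule L_linear_eq[OF Q0.lefschetz Q2.lefschetz _ _ _ _ x,
      of "\<lambda>j x. Q2.\<Lambda> (j + 1) (\<beta> j x)" "\<lambda>j x. \<beta> (j - 1) (Q0.\<Lambda> j x)"])
  show "(\<lambda>x. Q2.\<Lambda> (j + 1) (\<beta> j x)) \<in> linear_maps E (Q0 j) (Q2 j)" for j
    using linear_maps_comp[OF \<beta>_linear Q2.Lambda_linear, of j] by simp
  show "(\<lambda>x. \<beta> (j - 1) (Q0.\<Lambda> j x)) \<in> linear_maps E (Q0 j) (Q2 j)" for j
    using linear_maps_comp[OF Q0.Lambda_linear \<beta>_linear, of j] by simp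
  fix j x assume x: "x \<in> carrier (Q0 j)"
  note \<beta>x = \<beta>_closed[OF x refl]
  have \<Lambda>x: "Q0.\<Lambda> j x \<in> carrier (Q0 (j - 1))" by (rule Q0.Lambda_closed[OF x refl])
  have c1: "L2 j (Q2.\<Lambda> (j + 1) (\<beta> j x)) \<in> carrier (Q2 (j + 1))"
    using Q2.L_Lambda_closed[OF \<beta>x] by simp
  have c2: "L0 (j - 1) (Q0.\<Lambda> j x) \<in> carrier (Q0 j)" by (rule Q0.L_Lambda_closed[OF x])
  have 1: "Q2.\<Lambda> (j + 1 + 1) (\<beta> (j + 1) (L0 j x)) = L2 j (Q2.\<Lambda> (j + 1) (\<beta> j x))
      \<oplus>\<^bsub>Q2 (j + 1)\<^esub> add_pow (Q2 (j + 1)) (n - 2 * j) (\<beta> j x)"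
    using Q2.Lambda_L[OF \<beta>x] \<beta>_L[OF x] by simp
  have "\<beta> j (Q0.\<Lambda> (j + 1) (L0 j x)) = \<beta> j (L0 (j - 1) (Q0.\<Lambda> j x) \<oplus>\<^bsub>Q0 j\<^esub> add_pow (Q0 j) (n - 2 * j) x)"
    using Q0.Lambda_L[OF x] by simp
  also have "\<dots> = \<beta> j (L0 (j - 1) (Q0.\<Lambda> j x)) \<oplus>\<^bsub>Q2 (j + 1)\<^esub> add_pow (Q2 (j + 1)) (n - 2 * j) (\<beta> j x)"
    by (simp add: linear_maps_add[OF \<beta>_linear c2 Q0.deg.M.add.int_pow_closed[OF x]]
      linear_maps_add_pow[OF Q0.module_component Q2.module_component \<beta>_linear x])
  also have "\<beta> j (L0 (j - 1) (Q0.\<Lambda> j x)) = L2 j (\<beta> (j - 1) (Q0.\<Lambda> j x))"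
    using \<beta>_L[OF \<Lambda>x] by simp
  finally have 2: "\<beta> (j + 1 - 1) (Q0.\<Lambda> (j + 1) (L0 j x)) = L2 j (\<beta> (j - 1) (Q0.\<Lambda> j x))
      \<oplus>\<^bsub>Q2 (j + 1)\<^esub> add_pow (Q2 (j + 1)) (n - 2 * j) (\<beta> j x)" by simp
  have c3: "L2 j (\<beta> (j - 1) (Q0.\<Lambda> j x)) \<in> carrier (Q2 (j + 1))"
    by (rule Q2.L_closed[OF \<beta>_closed[OF \<Lambda>x] refl]) simp
  show "Q2.\<Lambda> (j + 1 + 1) (\<beta> (j + 1) (L0 j x)) \<oplus>\<^bsub>Q2 (j + 1)\<^esub> L2 j (\<beta> (j - 1) (Q0.\<Lambda> j x)) =
    L2 j (Q2.\<Lambda> (j + 1) (\<beta> j x)) \<oplus>\<^bsub>Q2 (j + 1)\<^esub> \<beta> (j + 1 - 1) (Q0.\<Lambda> (j + 1) (L0 j x))"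
    unfolding 1 2 using c1 c3 \<beta>x by (simp add: Q2.deg.M.a_ac)
qed simp


subsection \<open>The components of the splitting\<close>

text \<open>
  The shape of the matrices in the theorem forces \<open>\<Lambda> (\<beta> x) = \<alpha>0 x + \<Lambda>2 (\<beta> x)\<close> and forces the image
  of \<open>\<alpha>1\<close> to be the kernel of \<open>b\<close> on \<open>F1\<close>.
\<close>

definition \<alpha>0 where
  "\<alpha>0 j x = V.\<Lambda> (j + 1) (\<iota> (j + 1) (\<beta> j x)) \<ominus>\<^bsub>V j\<^esub> \<iota> j (Q2.\<Lambda> (j + 1) (\<beta> j x))"

text \<open>On F1 this is the projection onto the kernel of b along F2, since \<beta> inverts b on
  F2. It kills F2, so the lift chosen by \<open>SOME\<close> in \<open>\<alpha>1\<close> does not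
  matter.\<close>

definition \<kappa> where "\<kappa> j y = y \<ominus>\<^bsub>V j\<^esub> \<iota> j (\<beta> (j - 1) (b j y))"

definition \<alpha>1 where "\<alpha>1 j q = \<kappa> j (SOME y. y \<in> F1 j \<and> p1 j y = q)"

lemma \<alpha>0_linear: "\<alpha>0 j \<in> linear_maps E (Q0 j) (V j)"
proof -
  have 1: "(\<lambda>x. V.\<Lambda> (j + 1) (\<iota> (j + 1) (\<beta> j x))) \<in> linear_maps E (Q0 j) (V j)"
    using linear_maps_comp[OF linear_maps_comp[OF \<beta>_linear \<iota>] V.Lambda_linear, of j] by simp
  have 2: "(\<lambda>x. \<iota> j (Q2.\<Lambda> (j + 1) (\<beta> j x))) \<in> linear_maps E (Q0 j) (V j)"
    using linear_maps_comp[OF linear_maps_comp[OF \<beta>_linear Q2.Lambda_linear, of j]] \<iota>[of j] by simp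
  show ?thesis
    unfolding \<alpha>0_def by (rule linear_maps_diff[OF V.module_component 1 2 Q0.module_component])
qed

lemmas \<alpha>0_closed = linear_maps_closed[OF \<alpha>0_linear]
  and \<alpha>0_add = linear_maps_add[OF \<alpha>0_linear]
  and \<alpha>0_zero = linear_maps_zero[OF Q0.module_component V.module_component \<alpha>0_linear]
  and \<alpha>0_add_pow = linear_maps_add_pow[OF Q0.module_component V.module_component \<alpha>0_linear]

text \<open>The definition of \<open>\<alpha>0\<close> read backwards, as \<beta> c is the identity.
  It yields the column of x2 in the matrix of \<Lambda>.\<close>

lemma Lambda_\<iota>:
  assumes k: "k \<in> carrier (Q2 j)"
  shows "V.\<Lambda> j (\<iota> j k) = \<alpha>0 (j - 1) (c j k) \<oplus>\<^bsub>V (j - 1)\<^esub> \<iota> (j - 1) (Q2.\<Lambda> j k)"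
  using V.Lambda_closed[OF \<iota>_closed[OF k refl] refl] \<iota>_closed[OF Q2.Lambda_closed[OF k refl] refl]
  by (simp add: \<alpha>0_def \<beta>_c[OF k] a_minus_def V.deg.M.a_assoc V.deg.M.l_neg)

lemma p0_\<alpha>0:
  assumes x: "x \<in> carrier (Q0 j)"
  shows "p0 j (\<alpha>0 j x) = x"
proof -
  note \<beta>x = \<beta>_closed[OF x refl]
  have c: "V.\<Lambda> (j + 1) (\<iota> (j + 1) (\<beta> j x)) \<in> carrier (V j)" "Q2.\<Lambda> (j + 1) (\<beta> j x) \<in> carrier (Q2 j)"
    using V.Lambda_closed[OF \<iota>_closed[OF \<beta>x refl], of j] Q2.Lambda_closed[OF \<beta>x, of j] by simp_all
  have "p0 j (\<alpha>0 j x) = c (j + 1) (\<beta> j x) \<ominus>\<^bsub>Q0 j\<^esub> p0 j (\<iota> j (Q2.\<Lambda> (j + 1) (\<beta> j x)))"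
    unfolding \<alpha>0_def p0_minus[OF c(1) \<iota>_closed[OF c(2) refl]] by (simp add: c_def b_def)
  then show ?thesis using c_\<beta>[OF x] p0_\<iota>[OF c(2)] x by (simp add: a_minus_def)
qed

text \<open>Passing L through the two lowering operators in degree j + 1 costs n + 1 - 2 (j + 1) in
  V and n + 2 - 2 (j + 1) in G2. The difference 1 is the source of the summand \<iota> \<beta>
  x.\<close>

lemma L_\<alpha>0:
  assumes x: "x \<in> carrier (Q0 j)"
  shows "L j (\<alpha>0 j x) = \<alpha>0 (j + 1) (L0 j x) \<oplus>\<^bsub>V (j + 1)\<^esub> \<iota> (j + 1) (\<beta> j x)"
proof -
  let ?k = "\<beta> j x" and ?\<iota>k = "\<iota> (j + 1) (\<beta> j x)" and ?V = "V (j + 1)"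
  have k: "?k \<in> carrier (Q2 (j + 1))" by (rule \<beta>_closed[OF x refl])
  have \<iota>k: "?\<iota>k \<in> carrier ?V" by (rule \<iota>_closed[OF k refl])
  have \<Lambda>\<iota>: "V.\<Lambda> (j + 1) ?\<iota>k \<in> carrier (V j)" by (rule V.Lambda_closed[OF \<iota>k]) simp
  have \<Lambda>k: "Q2.\<Lambda> (j + 1) ?k \<in> carrier (Q2 j)" by (rule Q2.Lambda_closed[OF k]) simp
  have A: "L j (V.\<Lambda> (j + 1) ?\<iota>k) \<in> carrier ?V" by (rule V.L_closed[OF \<Lambda>\<iota> refl])
  have B: "\<iota> (j + 1) (L2 j (Q2.\<Lambda> (j + 1) ?k)) \<in> carrier ?V"
    by (rule \<iota>_closed[OF Q2.L_closed[OF \<Lambda>k refl] refl])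
  have LA: "L j (\<alpha>0 j x) = L j (V.\<Lambda> (j + 1) ?\<iota>k) \<ominus>\<^bsub>?V\<^esub> \<iota> (j + 1) (L2 j (Q2.\<Lambda> (j + 1) ?k))"
    unfolding \<alpha>0_def V.L_minus[OF \<Lambda>\<iota> \<iota>_closed[OF \<Lambda>k refl]] \<iota>_L[OF \<Lambda>k] ..
  have 1: "V.\<Lambda> (j + 1 + 1) (\<iota> (j + 1 + 1) (\<beta> (j + 1) (L0 j x))) =
      L j (V.\<Lambda> (j + 1) ?\<iota>k) \<oplus>\<^bsub>?V\<^esub> add_pow ?V (n - 2 * j - 1) ?\<iota>k"
    using V.Lambda_L[OF \<iota>k] \<beta>_L[OF x] \<iota>_L[OF k] by simp
  have "Q2.\<Lambda> (j + 1 + 1) (\<beta> (j + 1) (L0 j x)) =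
      L2 j (Q2.\<Lambda> (j + 1) ?k) \<oplus>\<^bsub>Q2 (j + 1)\<^esub> add_pow (Q2 (j + 1)) (n - 2 * j) ?k"
    using Q2.Lambda_L[OF k] \<beta>_L[OF x] by simp
  then have 2: "\<iota> (j + 1) (Q2.\<Lambda> (j + 1 + 1) (\<beta> (j + 1) (L0 j x))) =
      \<iota> (j + 1) (L2 j (Q2.\<Lambda> (j + 1) ?k)) \<oplus>\<^bsub>?V\<^esub> add_pow ?V (n - 2 * j) ?\<iota>k"
    using \<iota>_add[OF Q2.L_closed[OF \<Lambda>k refl] Q2.deg.M.add.int_pow_closed[OF k], of "n - 2 * j"]
      \<iota>_add_pow[OF k, of "n - 2 * j"] by simp
  have "add_pow ?V (1 + (n - 2 * j - 1)) ?\<iota>k = add_pow ?V (1::int) ?\<iota>k \<oplus>\<^bsub>?V\<^esub> add_pow ?V (n - 2 * j - 1) ?\<iota>k"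
    by (rule V.deg.M.add.int_pow_mult[OF \<iota>k])
  then have 3: "add_pow ?V (n - 2 * j) ?\<iota>k = ?\<iota>k \<oplus>\<^bsub>?V\<^esub> add_pow ?V (n - 2 * j - 1) ?\<iota>k"
    using V.deg.M.add.int_pow_1[OF \<iota>k] by (simp add: algebra_simps)
  show ?thesis
    unfolding LA unfolding \<alpha>0_def[of "j + 1"] 1 2 3
    using A B \<iota>k by (simp add: a_minus_def V.deg.M.a_ac V.deg.M.minus_add V.deg.M.r_neg V.deg.M.r_neg1 V.deg.M.r_neg2)
qed

lemma \<kappa>_b:
  assumes y: "y \<in> F1 j"
  shows "\<iota> j (\<beta> (j - 1) (b j y)) \<in> carrier (V j)" "\<iota> j (\<beta> (j - 1) (b j y)) \<in> F2 j"
    "\<beta> (j - 1) (b j y) \<in> carrier (Q2 j)"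
proof -
  show *: "\<beta> (j - 1) (b j y) \<in> carrier (Q2 j)" by (rule \<beta>_closed[OF b_closed[OF F1_carrier[OF y]]]) simp
  show "\<iota> j (\<beta> (j - 1) (b j y)) \<in> carrier (V j)" "\<iota> j (\<beta> (j - 1) (b j y)) \<in> F2 j"
    using \<iota>_closed[OF * refl] \<iota>_F2[OF *] by auto
qed

lemma \<kappa>_linear: "\<kappa> j \<in> linear_maps E (V j) (V j)"
proof -
  have "(\<lambda>y. \<iota> j (\<beta> (j - 1) (b j y))) \<in> linear_maps E (V j) (V j)"
    using linear_maps_comp[OF linear_maps_comp[OF b_linear \<beta>_linear]] \<iota>[of j] by simp
  moreover have "(\<lambda>y. y) \<in> linear_maps E (V j) (V j)" by (auto simp: linear_maps_def)
  ultimately show ?thesis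
    unfolding \<kappa>_def by (intro linear_maps_diff V.module_component)
qed

lemma \<kappa>_F2:
  assumes y: "y \<in> F2 j"
  shows "\<kappa> j y = \<zero>\<^bsub>V j\<^esub>"
proof -
  obtain k where k: "k \<in> carrier (Q2 j)" "\<iota> j k = y" using F2_lift[OF y] .
  then have "\<beta> (j - 1) (b j y) = k" using \<beta>_c[OF k(1)] by (simp add: c_def)
  then show ?thesis using k \<iota>_closed[OF k(1) refl] by (simp add: \<kappa>_def V.deg.minus_eq_0_iff)
qed

text \<open>Two lifts of the same class differ by an element of F2, which \<kappa> kills. Later
  arguments use this instead of the choice.\<close>

lemma \<alpha>1_p1:
  assumes y: "y \<in> F1 j"
  shows "\<alpha>1 j (p1 j y) = \<kappa> j y"
proof -
  define z where "z = (SOME z. z \<in> F1 j \<and> p1 j z = p1 j y)"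
  have z: "z \<in> F1 j" "p1 j z = p1 j y" using someI[of "\<lambda>z. z \<in> F1 j \<and> p1 j z = p1 j y" y] y by (auto simp: z_def)
  have "p1 j (z \<ominus>\<^bsub>V j\<^esub> y) = \<zero>\<^bsub>Q1 j\<^esub>"
    using z p1_closed[OF y] by (simp add: p1_minus y Q1.deg.minus_eq_0_iff)
  then have "z \<ominus>\<^bsub>V j\<^esub> y \<in> F2 j" using p1_ker[OF F1_minus[OF z(1) y]] by simp
  then have "\<kappa> j z \<ominus>\<^bsub>V j\<^esub> \<kappa> j y = \<zero>\<^bsub>V j\<^esub>"
    using \<kappa>_F2 linear_maps_minus[OF V.module_component V.module_component \<kappa>_linear
      F1_carrier[OF z(1)] F1_carrier[OF y]] by simp
  then have "\<kappa> j z = \<kappa> j y"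
    using V.deg.minus_eq_0_iff linear_maps_closed[OF \<kappa>_linear] F1_carrier z(1) y by metis
  then show ?thesis by (simp add: \<alpha>1_def z_def)
qed

lemma \<alpha>1_linear: "\<alpha>1 j \<in> linear_maps E (Q1 j) (V j)"
proof (rule linear_mapsI)
  fix x assume "x \<in> carrier (Q1 j)"
  then obtain u where u: "u \<in> F1 j" "p1 j u = x" by (rule p1_lift)
  then show "\<alpha>1 j x \<in> carrier (V j)"
    using \<alpha>1_p1[OF u(1)] linear_maps_closed[OF \<kappa>_linear F1_carrier[OF u(1)]] by simp
next
  fix x y assume "x \<in> carrier (Q1 j)" "y \<in> carrier (Q1 j)"
  then obtain u v where u: "u \<in> F1 j" "p1 j u = x" and v: "v \<in> F1 j" "p1 j v = y" by (metis p1_lift)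
  show "\<alpha>1 j (x \<oplus>\<^bsub>Q1 j\<^esub> y) = \<alpha>1 j x \<oplus>\<^bsub>V j\<^esub> \<alpha>1 j y"
    using \<alpha>1_p1[OF u(1)] \<alpha>1_p1[OF v(1)] \<alpha>1_p1[OF F1_add[OF u(1) v(1)]] p1_add[OF u(1) v(1)] u v
      linear_maps_add[OF \<kappa>_linear F1_carrier[OF u(1)] F1_carrier[OF v(1)]] by simp
next
  fix a x assume a: "a \<in> carrier E" and "x \<in> carrier (Q1 j)"
  then obtain u where u: "u \<in> F1 j" "p1 j u = x" by (metis p1_lift)
  show "\<alpha>1 j (a \<odot>\<^bsub>Q1 j\<^esub> x) = a \<odot>\<^bsub>V j\<^esub> \<alpha>1 j x"
    using \<alpha>1_p1[OF u(1)] \<alpha>1_p1[OF F1_smult[OF a u(1)]] p1_smult[OF a u(1)] u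
      linear_maps_smult[OF \<kappa>_linear a F1_carrier[OF u(1)]] by simp
qed

lemmas \<alpha>1_closed = linear_maps_closed[OF \<alpha>1_linear]
  and \<alpha>1_add = linear_maps_add[OF \<alpha>1_linear]
  and \<alpha>1_zero = linear_maps_zero[OF Q1.module_component V.module_component \<alpha>1_linear]
  and \<alpha>1_add_pow = linear_maps_add_pow[OF Q1.module_component V.module_component \<alpha>1_linear]

lemma
  assumes x: "x \<in> carrier (Q1 j)"
  shows \<alpha>1_F1: "\<alpha>1 j x \<in> F1 j" and p1_\<alpha>1: "p1 j (\<alpha>1 j x) = x"
proof -
  obtain u where u: "u \<in> F1 j" "p1 j u = x" using x by (rule p1_lift)
  note k = \<kappa>_b[OF u(1)]
  have a: "\<alpha>1 j x = u \<ominus>\<^bsub>V j\<^esub> \<iota> j (\<beta> (j - 1) (b j u))" using \<alpha>1_p1[OF u(1)] u(2) by (simp add: \<kappa>_def)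
  show "\<alpha>1 j x \<in> F1 j" unfolding a by (rule F1_minus[OF u(1) \<iota>_F1[OF k(3)]])
  show "p1 j (\<alpha>1 j x) = x"
    unfolding a p1_minus[OF u(1) \<iota>_F1[OF k(3)]] using p1_\<iota>[OF k(3)] u(2) x by (simp add: a_minus_def)
qed

text \<open>On F1 the maps b, \<beta> and \<iota> all commute with L, hence so does
  \<kappa>.\<close>

lemma \<alpha>1_L:
  assumes x: "x \<in> carrier (Q1 j)"
  shows "\<alpha>1 (j + 1) (L1 j x) = L j (\<alpha>1 j x)"
proof -
  obtain u where u: "u \<in> F1 j" "p1 j u = x" using x by (rule p1_lift)
  note k = \<kappa>_b[OF u(1)]
  have bu: "b j u \<in> carrier (Q0 (j - 1))" by (rule b_closed[OF F1_carrier[OF u(1)]])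
  have "\<beta> j (L0 (j - 1) (b j u)) = L2 j (\<beta> (j - 1) (b j u))" using \<beta>_L[OF bu] by simp
  then have "\<kappa> (j + 1) (L j u) = L j (\<kappa> j u)"
    by (simp add: \<kappa>_def b_L[OF u(1)] \<iota>_L[OF k(3)] V.L_minus[OF F1_carrier[OF u(1)] k(1)])
  then show ?thesis using \<alpha>1_p1[OF u(1)] \<alpha>1_p1[OF F1_L[OF u(1)]] p1_L[OF u(1)] u(2) by simp
qed

text \<open>As \<open>\<alpha>1\<close> is L-linear and G1 and V share the doubled center n + 1,
  both sides have the same commutator with L. Their difference goes from n + 1 to n + 3 after the
  shift.\<close>

lemma Lambda_\<alpha>1:
  assumes x: "x \<in> carrier (Q1 j)"
  shows "V.\<Lambda> j (\<alpha>1 j x) = \<alpha>1 (j - 1) (Q1.\<Lambda> j x)"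
proof (rule L_linear_eq[OF Q1.lefschetz lefschetz_shift_down[OF V.lefschetz] _ _ _ _ x,
      of "\<lambda>j x. V.\<Lambda> j (\<alpha>1 j x)" "\<lambda>j x. \<alpha>1 (j - 1) (Q1.\<Lambda> j x)"])
  show "(\<lambda>x. V.\<Lambda> j (\<alpha>1 j x)) \<in> linear_maps E (Q1 j) (V (j - 1))" for j
    by (rule linear_maps_comp[OF \<alpha>1_linear V.Lambda_linear])
  show "(\<lambda>x. \<alpha>1 (j - 1) (Q1.\<Lambda> j x)) \<in> linear_maps E (Q1 j) (V (j - 1))" for j
    by (rule linear_maps_comp[OF Q1.Lambda_linear \<alpha>1_linear])
  fix j x assume x: "x \<in> carrier (Q1 j)"
  note ax = \<alpha>1_closed[OF x]
  have \<Lambda>x: "Q1.\<Lambda> j x \<in> carrier (Q1 (j - 1))" by (rule Q1.Lambda_closed[OF x refl])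
  have 1: "V.\<Lambda> (j + 1) (\<alpha>1 (j + 1) (L1 j x)) = L (j - 1) (V.\<Lambda> j (\<alpha>1 j x))
      \<oplus>\<^bsub>V j\<^esub> add_pow (V j) (n + 1 - 2 * j) (\<alpha>1 j x)"
    unfolding \<alpha>1_L[OF x] by (rule V.Lambda_L[OF ax])
  have 2: "\<alpha>1 j (Q1.\<Lambda> (j + 1) (L1 j x)) = L (j - 1) (\<alpha>1 (j - 1) (Q1.\<Lambda> j x))
      \<oplus>\<^bsub>V j\<^esub> add_pow (V j) (n + 1 - 2 * j) (\<alpha>1 j x)"
    unfolding Q1.Lambda_L[OF x] \<alpha>1_L[OF \<Lambda>x, symmetric]
    by (simp add: \<alpha>1_add[OF Q1.L_Lambda_closed[OF x] Q1.deg.M.add.int_pow_closed[OF x]] \<alpha>1_add_pow[OF x])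
  show "V.\<Lambda> (j + 1) (\<alpha>1 (j + 1) (L1 j x)) \<oplus>\<^bsub>V (j + 1 - 1)\<^esub> L (j - 1) (\<alpha>1 (j - 1) (Q1.\<Lambda> j x)) =
    L (j - 1) (V.\<Lambda> j (\<alpha>1 j x)) \<oplus>\<^bsub>V (j + 1 - 1)\<^esub> \<alpha>1 (j + 1 - 1) (Q1.\<Lambda> (j + 1) (L1 j x))"
    using ax V.L_Lambda_closed[OF ax] V.L_closed[OF \<alpha>1_closed[OF \<Lambda>x], of j]
    by (simp add: 1 2 V.deg.M.a_ac)
qed simp

text \<open>\<open>\<alpha>0\<close> is not L-linear and the centers of G0 and V differ, but the two
  effects cancel. The defect \<iota> \<beta> x contributes \<Lambda> (\<iota> \<beta> x) = \<alpha>0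
  x + \<iota> \<beta> (\<Lambda>0 x), with \<Lambda>0 that of G0. The first summand makes up for n +
  1 - 2 j against n - 2 j, the second for the defect of L at \<Lambda>0 x. So the difference of the
  two sides is L-linear, from n to n + 3. The equality is exact, not only modulo the image of
  \<open>\<alpha>1\<close>.\<close>

lemma Lambda_\<alpha>0:
  assumes x: "x \<in> carrier (Q0 j)"
  shows "V.\<Lambda> j (\<alpha>0 j x) = \<alpha>0 (j - 1) (Q0.\<Lambda> j x)"
proof (rule L_linear_eq[OF Q0.lefschetz lefschetz_shift_down[OF V.lefschetz] _ _ _ _ x,
      of "\<lambda>j x. V.\<Lambda> j (\<alpha>0 j x)" "\<lambda>j x. \<alpha>0 (j - 1) (Q0.\<Lambda> j x)"])
  show "(\<lambda>x. V.\<Lambda> j (\<alpha>0 j x)) \<in> linear_maps E (Q0 j) (V (j - 1))" for j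
    by (rule linear_maps_comp[OF \<alpha>0_linear V.Lambda_linear])
  show "(\<lambda>x. \<alpha>0 (j - 1) (Q0.\<Lambda> j x)) \<in> linear_maps E (Q0 j) (V (j - 1))" for j
    by (rule linear_maps_comp[OF Q0.Lambda_linear \<alpha>0_linear])
  fix j x assume x: "x \<in> carrier (Q0 j)"
  let ?a = "\<alpha>0 j x" and ?k = "\<beta> j x"
  let ?\<beta>\<Lambda> = "\<beta> (j - 1) (Q0.\<Lambda> j x)"
  note a = \<alpha>0_closed[OF x]
  have k: "?k \<in> carrier (Q2 (j + 1))" by (rule \<beta>_closed[OF x refl])
  have \<Lambda>x: "Q0.\<Lambda> j x \<in> carrier (Q0 (j - 1))" by (rule Q0.Lambda_closed[OF x refl])
  have \<beta>\<Lambda>: "?\<beta>\<Lambda> \<in> carrier (Q2 j)" by (rule \<beta>_closed[OF \<Lambda>x]) simp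
  have Lx: "L0 j x \<in> carrier (Q0 (j + 1))" by (rule Q0.L_closed[OF x refl])
  have aL: "\<alpha>0 (j + 1) (L0 j x) \<in> carrier (V (j + 1))" by (rule \<alpha>0_closed[OF Lx])
  have \<Lambda>aL: "V.\<Lambda> (j + 1) (\<alpha>0 (j + 1) (L0 j x)) \<in> carrier (V j)" by (rule V.Lambda_closed[OF aL]) simp
  have L\<Lambda>x: "L0 (j - 1) (Q0.\<Lambda> j x) \<in> carrier (Q0 j)" by (rule Q0.L_Lambda_closed[OF x])
  have \<iota>\<beta>\<Lambda>: "\<iota> j ?\<beta>\<Lambda> \<in> carrier (V j)" by (rule \<iota>_closed[OF \<beta>\<Lambda> refl])
  have "V.\<Lambda> (j + 1) (\<alpha>0 (j + 1) (L0 j x) \<oplus>\<^bsub>V (j + 1)\<^esub> \<iota> (j + 1) ?k) =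
      L (j - 1) (V.\<Lambda> j ?a) \<oplus>\<^bsub>V j\<^esub> add_pow (V j) (n + 1 - 2 * j) ?a"
    using V.Lambda_L[OF a] L_\<alpha>0[OF x] by simp
  moreover have "V.\<Lambda> (j + 1) (\<alpha>0 (j + 1) (L0 j x) \<oplus>\<^bsub>V (j + 1)\<^esub> \<iota> (j + 1) ?k) =
      V.\<Lambda> (j + 1) (\<alpha>0 (j + 1) (L0 j x)) \<oplus>\<^bsub>V j\<^esub> (?a \<oplus>\<^bsub>V j\<^esub> \<iota> j ?\<beta>\<Lambda>)"
    using linear_maps_add[OF V.Lambda_linear aL \<iota>_closed[OF k refl]] Lambda_\<iota>[OF k] c_\<beta>[OF x]
      \<beta>_Lambda[OF x] by simp
  moreover have "add_pow (V j) (n + 1 - 2 * j) ?a = add_pow (V j) (n - 2 * j) ?a \<oplus>\<^bsub>V j\<^esub> ?a"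
    using V.deg.M.add.int_pow_mult[OF a, of "n - 2 * j" 1] V.deg.M.add.int_pow_1[OF a]
    by (simp add: algebra_simps)
  ultimately have "(V.\<Lambda> (j + 1) (\<alpha>0 (j + 1) (L0 j x)) \<oplus>\<^bsub>V j\<^esub> \<iota> j ?\<beta>\<Lambda>) \<oplus>\<^bsub>V j\<^esub> ?a =
      (L (j - 1) (V.\<Lambda> j ?a) \<oplus>\<^bsub>V j\<^esub> add_pow (V j) (n - 2 * j) ?a) \<oplus>\<^bsub>V j\<^esub> ?a"
    using a \<Lambda>aL \<iota>\<beta>\<Lambda> V.L_Lambda_closed[OF a] by (simp add: V.deg.M.a_ac)
  then have 1: "V.\<Lambda> (j + 1) (\<alpha>0 (j + 1) (L0 j x)) \<oplus>\<^bsub>V j\<^esub> \<iota> j ?\<beta>\<Lambda> =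
      L (j - 1) (V.\<Lambda> j ?a) \<oplus>\<^bsub>V j\<^esub> add_pow (V j) (n - 2 * j) ?a"
    using a \<Lambda>aL \<iota>\<beta>\<Lambda> V.L_Lambda_closed[OF a] by simp
  have "\<alpha>0 j (Q0.\<Lambda> (j + 1) (L0 j x)) =
      \<alpha>0 j (L0 (j - 1) (Q0.\<Lambda> j x)) \<oplus>\<^bsub>V j\<^esub> add_pow (V j) (n - 2 * j) ?a"
    unfolding Q0.Lambda_L[OF x]
    by (simp add: \<alpha>0_add[OF L\<Lambda>x Q0.deg.M.add.int_pow_closed[OF x]] \<alpha>0_add_pow[OF x])
  moreover have "L (j - 1) (\<alpha>0 (j - 1) (Q0.\<Lambda> j x)) = \<alpha>0 j (L0 (j - 1) (Q0.\<Lambda> j x)) \<oplus>\<^bsub>V j\<^esub> \<iota> j ?\<beta>\<Lambda>"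
    using L_\<alpha>0[OF \<Lambda>x] by simp
  ultimately show "V.\<Lambda> (j + 1) (\<alpha>0 (j + 1) (L0 j x)) \<oplus>\<^bsub>V (j + 1 - 1)\<^esub> L (j - 1) (\<alpha>0 (j - 1) (Q0.\<Lambda> j x)) =
    L (j - 1) (V.\<Lambda> j ?a) \<oplus>\<^bsub>V (j + 1 - 1)\<^esub> \<alpha>0 (j + 1 - 1) (Q0.\<Lambda> (j + 1) (L0 j x))"
    using 1 a \<Lambda>aL \<iota>\<beta>\<Lambda> \<alpha>0_closed[OF L\<Lambda>x] V.L_Lambda_closed[OF a]
    by (simp add: V.deg.M.a_ac) (metis V.deg.M.a_assoc V.deg.M.a_comm V.deg.M.add.int_pow_closed)
qed simp

subsection \<open>Uniqueness of the splitting\<close>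

text \<open>The composite b f is L-linear from doubled center n + 1 to n + 2, so f takes values in
  the kernel of b, where \<kappa> is the identity.\<close>

lemma \<alpha>1_unique:
  assumes lin: "\<And>j. f j \<in> linear_maps E (Q1 j) (V j)"
    and F1: "\<And>j x. x \<in> carrier (Q1 j) \<Longrightarrow> f j x \<in> F1 j"
    and p1: "\<And>j x. x \<in> carrier (Q1 j) \<Longrightarrow> p1 j (f j x) = x"
    and L: "\<And>j x. x \<in> carrier (Q1 j) \<Longrightarrow> f (j + 1) (L1 j x) = L j (f j x)"
    and x: "x \<in> carrier (Q1 j)"
  shows "f j x = \<alpha>1 j x"
proof -
  have "b j (f j x) = \<zero>\<^bsub>Q0 (j - 1)\<^esub>"
  proof (rule L_linear_eq_0[OF Q1.lefschetz lefschetz_shift_down[OF Q0.lefschetz] _ _ _ x,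
        of "\<lambda>j x. b j (f j x)"])
    show "(\<lambda>x. b j (f j x)) \<in> linear_maps E (Q1 j) (Q0 (j - 1))" for j
      by (rule linear_maps_comp[OF lin b_linear])
  qed (use L b_L[OF F1] in auto)
  then have "\<kappa> j (f j x) = f j x"
    using \<beta>_zero[of "j - 1"] \<iota>_zero[of j] linear_maps_closed[OF lin x] by (simp add: \<kappa>_def a_minus_def)
  then show ?thesis using \<alpha>1_p1[OF F1[OF x]] p1[OF x] by simp
qed

text \<open>Let h be the difference. It lands in F1, as both maps are sections of \<open>p0\<close>.
  Modulo F2 it is L-linear, from doubled center n to n + 1, so it lands in F2. There h x = \<iota>
  k, and the condition on \<Lambda> gives c k = 0.\<close>

lemma \<alpha>0_unique:
  assumes lin: "\<And>j. f j \<in> linear_maps E (Q0 j) (V j)"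
    and p0: "\<And>j x. x \<in> carrier (Q0 j) \<Longrightarrow> p0 j (f j x) = x"
    and L: "\<And>j x. x \<in> carrier (Q0 j) \<Longrightarrow> f (j + 1) (L0 j x) \<ominus>\<^bsub>V (j + 1)\<^esub> L j (f j x) \<in> F2 (j + 1)"
    and Lambda: "\<And>j x. x \<in> carrier (Q0 j) \<Longrightarrow> f (j - 1) (Q0.\<Lambda> j x) \<ominus>\<^bsub>V (j - 1)\<^esub> V.\<Lambda> j (f j x) \<in> F1 (j - 1)"
    and x: "x \<in> carrier (Q0 j)"
  shows "f j x = \<alpha>0 j x"
proof -
  define h where "h j x = f j x \<ominus>\<^bsub>V j\<^esub> \<alpha>0 j x" for j x
  have h: "h j \<in> linear_maps E (Q0 j) (V j)" for j
    unfolding h_def by (rule linear_maps_diff[OF V.module_component lin \<alpha>0_linear Q0.module_component])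
  note fc = linear_maps_closed[OF lin]
  have hF1: "h j x \<in> F1 j" if x: "x \<in> carrier (Q0 j)" for j x
  proof -
    have "p0 j (h j x) = \<zero>\<^bsub>Q0 j\<^esub>"
      unfolding h_def p0_minus[OF fc[OF x] \<alpha>0_closed[OF x]] using p0[OF x] p0_\<alpha>0[OF x] x
      by (simp add: Q0.deg.minus_eq_0_iff)
    then show ?thesis using p0_ker[OF linear_maps_closed[OF h x]] by simp
  qed
  have F2_sub: "u \<in> F2 j \<Longrightarrow> v \<in> F2 j \<Longrightarrow> u \<oplus>\<^bsub>V j\<^esub> v \<in> F2 j" for u v j
    by (metis F2_lift \<iota>_F2 \<iota>_add Q2.deg.M.add.m_closed)
  have "p1 j (h j x) = \<zero>\<^bsub>Q1 j\<^esub>"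
  proof (rule L_linear_eq_0[OF Q0.lefschetz Q1.lefschetz _ _ _ x, of "\<lambda>j x. p1 j (h j x)"])
    show "(\<lambda>x. p1 j (h j x)) \<in> linear_maps E (Q0 j) (Q1 j)" for j
      by (rule linear_maps_comp[OF linear_maps_codomain[OF h hF1] p1])
  next
    fix j x assume x: "x \<in> carrier (Q0 j)"
    note Lx = Q0.L_closed[OF x refl]
    have c: "f j x \<in> carrier (V j)" "\<alpha>0 j x \<in> carrier (V j)" "f (j + 1) (L0 j x) \<in> carrier (V (j + 1))"
      "\<alpha>0 (j + 1) (L0 j x) \<in> carrier (V (j + 1))" "L j (f j x) \<in> carrier (V (j + 1))"
      "\<iota> (j + 1) (\<beta> j x) \<in> carrier (V (j + 1))"
      using fc[OF x] \<alpha>0_closed[OF x] fc[OF Lx] \<alpha>0_closed[OF Lx] V.L_closed[OF fc[OF x] refl]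
        \<iota>_closed[OF \<beta>_closed[OF x refl] refl] by auto
    \<comment> \<open>The defect of f lies in F2 by hypothesis, and that of \<open>\<alpha>0\<close>
      is \<iota> \<beta> x up to sign.\<close>
    have "h (j + 1) (L0 j x) \<ominus>\<^bsub>V (j + 1)\<^esub> L j (h j x) =
      (f (j + 1) (L0 j x) \<ominus>\<^bsub>V (j + 1)\<^esub> L j (f j x)) \<oplus>\<^bsub>V (j + 1)\<^esub> \<iota> (j + 1) (\<beta> j x)"
      unfolding h_def V.L_minus[OF c(1,2)] L_\<alpha>0[OF x] using c
      by (simp add: a_minus_def V.deg.M.a_ac V.deg.M.minus_add V.deg.M.r_neg V.deg.M.r_neg1 V.deg.M.r_neg2)
    also have "\<dots> \<in> F2 (j + 1)" by (rule F2_sub[OF L[OF x] \<iota>_F2[OF \<beta>_closed[OF x refl]]])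
    finally have "p1 (j + 1) (h (j + 1) (L0 j x) \<ominus>\<^bsub>V (j + 1)\<^esub> L j (h j x)) = \<zero>\<^bsub>Q1 (j + 1)\<^esub>"
      using p1_ker F2_F1 by blast
    then have "p1 (j + 1) (h (j + 1) (L0 j x)) = p1 (j + 1) (L j (h j x))"
      using p1_minus[OF hF1[OF Lx] F1_L[OF hF1[OF x]]]
      by (simp add: Q1.deg.minus_eq_0_iff p1_closed[OF hF1[OF Lx]] p1_closed[OF F1_L[OF hF1[OF x]]])
    then show "p1 (j + 1) (h (j + 1) (L0 j x)) = L1 j (p1 j (h j x))" using p1_L[OF hF1[OF x]] by simp
  qed simp
  then have "h j x \<in> F2 j" using p1_ker[OF hF1[OF x]] by simp
  then obtain k where k: "k \<in> carrier (Q2 j)" "\<iota> j k = h j x" using F2_lift by metis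
  \<comment> \<open>As F1 is the kernel of \<open>p0\<close>, the condition on \<Lambda> becomes an
    equation after \<open>p0\<close>.\<close>
  have p0\<Lambda>f: "p0 (j - 1) (V.\<Lambda> j (f j x)) = Q0.\<Lambda> j x"
  proof -
    note \<Lambda>x = Q0.Lambda_closed[OF x refl]
    note c = fc[OF \<Lambda>x] V.Lambda_closed[OF fc[OF x] refl]
    have "p0 (j - 1) (f (j - 1) (Q0.\<Lambda> j x)) \<ominus>\<^bsub>Q0 (j - 1)\<^esub> p0 (j - 1) (V.\<Lambda> j (f j x)) = \<zero>\<^bsub>Q0 (j - 1)\<^esub>"
      using p0_ker[OF F1_carrier[OF Lambda[OF x]]] Lambda[OF x] p0_minus[OF c] by simp
    then show ?thesis using p0[OF \<Lambda>x] \<Lambda>x p0_closed[OF c(2)] by (simp add: Q0.deg.minus_eq_0_iff)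
  qed
  have "c j k = p0 (j - 1) (V.\<Lambda> j (f j x \<ominus>\<^bsub>V j\<^esub> \<alpha>0 j x))"
    using k(2) by (simp add: c_def b_def h_def)
  also have "\<dots> = p0 (j - 1) (V.\<Lambda> j (f j x)) \<ominus>\<^bsub>Q0 (j - 1)\<^esub> p0 (j - 1) (V.\<Lambda> j (\<alpha>0 j x))"
    using b_minus[OF fc[OF x] \<alpha>0_closed[OF x]] by (simp add: b_def)
  also have "\<dots> = \<zero>\<^bsub>Q0 (j - 1)\<^esub>"
    unfolding p0\<Lambda>f Lambda_\<alpha>0[OF x] p0_\<alpha>0[OF Q0.Lambda_closed[OF x refl]]
    using Q0.Lambda_closed[OF x refl] by (simp add: Q0.deg.minus_eq_0_iff)
  finally have "k = \<zero>\<^bsub>Q2 j\<^esub>" using \<beta>_c[OF k(1)] \<beta>_zero[of "j - 1"] by simp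
  then have "h j x = \<zero>\<^bsub>V j\<^esub>" using k(2) \<iota>_zero by simp
  then show ?thesis by (simp add: h_def V.deg.minus_eq_0_iff fc[OF x] \<alpha>0_closed[OF x])
qed

end


section \<open>Quotient modules\<close>

lemma (in module) submodule_abelian_subgroup:
  assumes "submodule N R M"
  shows "abelian_subgroup N M"
  using assms
  by (intro abelian_subgroupI3 additive_subgroup.intro M.abelian_group_axioms submodule.axioms(1))

text \<open>Scalar multiplication in \<open>quot_module\<close> and the operator \<open>Gr_L\<close>
  both have this form: adding N absorbs the image of N0 and completes the image of a coset to a full
  coset.\<close>

lemma set_add_image_coset:
  assumes M: "module R M" and N: "submodule N R M" and M0: "module R M0"
    and N0: "submodule N0 R M0" and f: "f \<in> linear_maps R M0 M" "f ` N0 \<subseteq> N"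
    and x: "x \<in> carrier M0"
  shows "N <+>\<^bsub>M\<^esub> f ` (N0 +>\<^bsub>M0\<^esub> x) = N +>\<^bsub>M\<^esub> f x"
proof -
  interpret M: module R M by fact
  interpret M0: module R M0 by fact
  have N0c: "h \<in> carrier M0" if "h \<in> N0" for h using M0.submoduleE(1)[OF N0] that by auto
  have Nc: "h \<in> carrier M" if "h \<in> N" for h using M.submoduleE(1)[OF N] that by auto
  have N0_zero: "\<zero>\<^bsub>M0\<^esub> \<in> N0" using subgroup.one_closed[OF submodule.axioms(1)[OF N0]] by simp
  have *: "g \<oplus>\<^bsub>M\<^esub> f (h \<oplus>\<^bsub>M0\<^esub> x) = (g \<oplus>\<^bsub>M\<^esub> f h) \<oplus>\<^bsub>M\<^esub> f x" if "g \<in> N" "h \<in> N0" for g h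
    using that x by (simp add: linear_maps_add[OF f(1)] linear_maps_closed[OF f(1)] N0c Nc M.a_assoc)
  show ?thesis
  proof
    show "N <+>\<^bsub>M\<^esub> f ` (N0 +>\<^bsub>M0\<^esub> x) \<subseteq> N +>\<^bsub>M\<^esub> f x"
    proof
      fix z assume "z \<in> N <+>\<^bsub>M\<^esub> f ` (N0 +>\<^bsub>M0\<^esub> x)"
      then obtain g h where "g \<in> N" "h \<in> N0" "z = g \<oplus>\<^bsub>M\<^esub> f (h \<oplus>\<^bsub>M0\<^esub> x)"
        by (auto simp: set_add_def' a_r_coset_def')
      moreover have "g \<oplus>\<^bsub>M\<^esub> f h \<in> N"
        using M.submoduleE(5)[OF N] f(2) \<open>g \<in> N\<close> \<open>h \<in> N0\<close> by blast
      ultimately show "z \<in> N +>\<^bsub>M\<^esub> f x" using * by (auto simp: a_r_coset_def')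
    qed
    show "N +>\<^bsub>M\<^esub> f x \<subseteq> N <+>\<^bsub>M\<^esub> f ` (N0 +>\<^bsub>M0\<^esub> x)"
    proof
      fix z assume "z \<in> N +>\<^bsub>M\<^esub> f x"
      then obtain g where g: "g \<in> N" "z = g \<oplus>\<^bsub>M\<^esub> f x" by (auto simp: a_r_coset_def')
      have "x \<in> N0 +>\<^bsub>M0\<^esub> x" using N0_zero x by (force simp: a_r_coset_def')
      then show "z \<in> N <+>\<^bsub>M\<^esub> f ` (N0 +>\<^bsub>M0\<^esub> x)" using g by (auto simp: set_add_def')
    qed
  qed
qed

context module
begin

context
  fixes N H
  assumes N: "submodule N R M" and H: "submodule H R M"
begin

lemma carrier_quot: "carrier (quot_module (M\<lparr>carrier := H\<rparr>) N) = (\<lambda>x. N +>\<^bsub>M\<^esub> x) ` H"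
  by (auto simp: quot_module_def A_RCOSETS_def' a_r_coset_def')

lemma quot_projection_linear:
  "(\<lambda>x. N +>\<^bsub>M\<^esub> x) \<in> linear_maps R (M\<lparr>carrier := H\<rparr>) (quot_module (M\<lparr>carrier := H\<rparr>) N)"
proof (rule linear_mapsI)
  interpret abelian_subgroup N M by (rule submodule_abelian_subgroup[OF N])
  have Hc: "x \<in> carrier M" if "x \<in> H" for x using submoduleE(1)[OF H] that by auto
  fix x assume x: "x \<in> carrier (M\<lparr>carrier := H\<rparr>)"
  then show "N +>\<^bsub>M\<^esub> x \<in> carrier (quot_module (M\<lparr>carrier := H\<rparr>) N)"
    by (simp add: carrier_quot)
  {
    fix y assume "y \<in> carrier (M\<lparr>carrier := H\<rparr>)"
    then show "N +>\<^bsub>M\<^esub> (x \<oplus>\<^bsub>M\<lparr>carrier := H\<rparr>\<^esub> y) =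
        (N +>\<^bsub>M\<^esub> x) \<oplus>\<^bsub>quot_module (M\<lparr>carrier := H\<rparr>) N\<^esub> (N +>\<^bsub>M\<^esub> y)"
      using x Hc a_rcos_sum[of x y] by (simp add: quot_module_def set_add_def')
  next
    fix a assume a: "a \<in> carrier R"
    have "(\<lambda>x. a \<odot>\<^bsub>M\<^esub> x) \<in> linear_maps R M M"
      using a by (auto simp: smult_r_distr m_comm simp flip: smult_assoc1 intro!: linear_mapsI)
    then have "N <+>\<^bsub>M\<^esub> (\<lambda>x. a \<odot>\<^bsub>M\<^esub> x) ` (N +>\<^bsub>M\<^esub> x) = N +>\<^bsub>M\<^esub> (a \<odot>\<^bsub>M\<^esub> x)"
      using x Hc submoduleE(4)[OF N a]
      by (intro set_add_image_coset[OF module_axioms N module_axioms N]) auto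
    then show "N +>\<^bsub>M\<^esub> (a \<odot>\<^bsub>M\<lparr>carrier := H\<rparr>\<^esub> x) =
        a \<odot>\<^bsub>quot_module (M\<lparr>carrier := H\<rparr>) N\<^esub> (N +>\<^bsub>M\<^esub> x)"
      by (simp add: quot_module_def set_add_def')
  }
qed

lemma quot_projection_ker:
  assumes x: "x \<in> H"
  shows "N +>\<^bsub>M\<^esub> x = \<zero>\<^bsub>quot_module (M\<lparr>carrier := H\<rparr>) N\<^esub> \<longleftrightarrow> x \<in> N"
proof -
  interpret abelian_subgroup N M by (rule submodule_abelian_subgroup[OF N])
  have "x \<in> carrier M" using submoduleE(1)[OF H] x by auto
  then show ?thesis
    using a_rcos_const[of x] a_rcos_self[of x] by (auto simp: quot_module_def)
qed

end

end


section \<open>Filtered Lefschetz modules\<close>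

locale filtered_lefschetz =
  fixes E :: "('e, 'r) ring_scheme" and V :: "int \<Rightarrow> ('e, 'v) module" and L F n
  assumes field: "field E"
    and char_0: "\<And>k::nat. add_pow E k \<one>\<^bsub>E\<^esub> = \<zero>\<^bsub>E\<^esub> \<Longrightarrow> k = 0"
    and lefschetz_V: "lefschetz_module E V L (n + 1)"
    and filtration: "three_step_filtration E V L F"
    and lefschetz_Gr: "\<And>i. i \<le> 2 \<Longrightarrow> lefschetz_module E (Gr V F i) (Gr_L V L F i) (n + int i)"
begin

text \<open>Keeps the index in \<open>F 1\<close> and \<open>Gr V F 1\<close> from being rewritten
  to \<open>Suc 0\<close>.\<close>

declare One_nat_def [simp del]

sublocale V: lefschetz E V L "n + 1"
  by unfold_locales (rule lefschetz_V)

section \<open>The filtration and its quotient maps\<close>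

lemma F_submodule: "submodule (F i j) E (V j)"
  and F_L: "x \<in> F i j \<Longrightarrow> L j x \<in> F i (j + 1)"
  and F_antimono: "F (i + 1) j \<subseteq> F i j"
  and F_0: "F 0 j = carrier (V j)"
  and F_ge_3: "i \<ge> 3 \<Longrightarrow> F i j = {\<zero>\<^bsub>V j\<^esub>}"
  using filtration unfolding three_step_filtration_def by blast+

lemma F_carrier: "x \<in> F i j \<Longrightarrow> x \<in> carrier (V j)"
  using V.deg.submoduleE(1)[OF F_submodule] by auto

lemma F_zero: "\<zero>\<^bsub>V j\<^esub> \<in> F i j"
  using subgroup.one_closed[OF submodule.axioms(1)[OF F_submodule]] by simp

definition proj where "proj i j x = F (i + 1) j +>\<^bsub>V j\<^esub> x"

lemma proj_linear: "proj i j \<in> linear_maps E ((V j)\<lparr>carrier := F i j\<rparr>) (Gr V F i j)"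
  unfolding proj_def Gr_def
  by (rule V.deg.quot_projection_linear[OF F_submodule F_submodule])

lemma proj_surj: "proj i j ` F i j = carrier (Gr V F i j)"
  unfolding proj_def Gr_def
  by (rule V.deg.carrier_quot[OF F_submodule F_submodule, symmetric])

lemma proj_ker: "x \<in> F i j \<Longrightarrow> proj i j x = \<zero>\<^bsub>Gr V F i j\<^esub> \<longleftrightarrow> x \<in> F (i + 1) j"
  unfolding proj_def Gr_def
  by (rule V.deg.quot_projection_ker[OF F_submodule F_submodule])

lemma proj_L:
  assumes x: "x \<in> F i j"
  shows "proj i (j + 1) (L j x) = Gr_L V L F i j (proj i j x)"
  unfolding proj_def Gr_L_def using F_L
  by (intro set_add_image_coset[symmetric, OF V.module_component F_submodule V.module_component
        F_submodule V.L_linear _ F_carrier[OF x]]) auto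

lemma proj_2: "x \<in> F 2 j \<Longrightarrow> proj 2 j x = {x}"
  using F_carrier[of x 2 j] by (simp add: proj_def F_ge_3 a_r_coset_def')

lemma Gr_2_carrier: "carrier (Gr V F 2 j) = (\<lambda>x. {x}) ` F 2 j"
  using proj_2 by (simp flip: proj_surj)

text \<open>Since \<open>F 3\<close> is zero, the elements of G2 are singletons and
  \<open>the_elem\<close> inverts \<open>proj 2\<close>. It plays the part of the inclusion
  \<iota>.\<close>

lemma the_elem_linear: "the_elem \<in> linear_maps E (Gr V F 2 j) (V j)"
proof (rule linear_mapsI)
  fix X assume "X \<in> carrier (Gr V F 2 j)"
  then obtain x where x: "X = {x}" "x \<in> F 2 j" unfolding Gr_2_carrier by blast
  show "the_elem X \<in> carrier (V j)" using x F_carrier by simp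
  {
    fix Y assume "Y \<in> carrier (Gr V F 2 j)"
    then obtain y where y: "Y = {y}" "y \<in> F 2 j" unfolding Gr_2_carrier by blast
    have "proj 2 j (x \<oplus>\<^bsub>V j\<^esub> y) = X \<oplus>\<^bsub>Gr V F 2 j\<^esub> Y"
      using linear_maps_add[OF proj_linear, of x 2 j y] x y by (simp add: proj_2)
    moreover have "x \<oplus>\<^bsub>V j\<^esub> y \<in> F 2 j" by (rule V.deg.submoduleE(5)[OF F_submodule x(2) y(2)])
    ultimately have "X \<oplus>\<^bsub>Gr V F 2 j\<^esub> Y = {x \<oplus>\<^bsub>V j\<^esub> y}" by (simp add: proj_2)
    then show "the_elem (X \<oplus>\<^bsub>Gr V F 2 j\<^esub> Y) = the_elem X \<oplus>\<^bsub>V j\<^esub> the_elem Y"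
      using x y by simp
  next
    fix a assume a: "a \<in> carrier E"
    have "proj 2 j (a \<odot>\<^bsub>V j\<^esub> x) = a \<odot>\<^bsub>Gr V F 2 j\<^esub> X"
      using linear_maps_smult[OF proj_linear a, of x 2 j] x by (simp add: proj_2)
    moreover have "a \<odot>\<^bsub>V j\<^esub> x \<in> F 2 j" by (rule V.deg.submoduleE(4)[OF F_submodule a x(2)])
    ultimately have "a \<odot>\<^bsub>Gr V F 2 j\<^esub> X = {a \<odot>\<^bsub>V j\<^esub> x}" by (simp add: proj_2)
    then show "the_elem (a \<odot>\<^bsub>Gr V F 2 j\<^esub> X) = a \<odot>\<^bsub>V j\<^esub> the_elem X" using x by simp
  }
qed

sublocale X: lefschetz_extension E V L n "Gr V F 0" "Gr V F 1" "Gr V F 2"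
  "Gr_L V L F 0" "Gr_L V L F 1" "Gr_L V L F 2" "F 1" "F 2" "proj 0" "proj 1" "\<lambda>j. the_elem"
proof (intro lefschetz_extension.intro lefschetz.intro lefschetz_extension_axioms.intro)
  show "lefschetz_module E V L (n + 1)" by (rule lefschetz_V)
  show "lefschetz_module E (Gr V F 0) (Gr_L V L F 0) n" using lefschetz_Gr[of 0] by simp
  show "lefschetz_module E (Gr V F 1) (Gr_L V L F 1) (n + 1)" using lefschetz_Gr[of 1] by simp
  show "lefschetz_module E (Gr V F 2) (Gr_L V L F 2) (n + 2)" using lefschetz_Gr[of 2] by simp
  show "field E" by (rule field)
  show "k = 0" if "add_pow E k \<one>\<^bsub>E\<^esub> = \<zero>\<^bsub>E\<^esub>" for k :: nat using char_0[OF that] .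
  fix j
  show "submodule (F 1 j) E (V j)" by (rule F_submodule)
  show "F 2 j \<subseteq> F 1 j" using F_antimono[of 1 j] by simp
  show "proj 0 j \<in> linear_maps E (V j) (Gr V F 0 j)" using proj_linear[of 0 j] by (simp add: F_0)
  show "proj 0 j ` carrier (V j) = carrier (Gr V F 0 j)" using proj_surj[of 0 j] by (simp add: F_0)
  show "proj 1 j \<in> linear_maps E ((V j)\<lparr>carrier := F 1 j\<rparr>) (Gr V F 1 j)" by (rule proj_linear)
  show "proj 1 j ` F 1 j = carrier (Gr V F 1 j)" by (rule proj_surj)
  show "the_elem \<in> linear_maps E (Gr V F 2 j) (V j)" by (rule the_elem_linear)
  show "inj_on the_elem (carrier (Gr V F 2 j))" unfolding Gr_2_carrier by (auto intro: inj_onI)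
  show "the_elem ` carrier (Gr V F 2 j) = F 2 j" unfolding Gr_2_carrier by (force simp: image_image)
  fix x
  show "L j x \<in> F 1 (j + 1)" if "x \<in> F 1 j" using F_L[OF that] .
  show "proj 0 j x = \<zero>\<^bsub>Gr V F 0 j\<^esub> \<longleftrightarrow> x \<in> F 1 j" if "x \<in> carrier (V j)"
    using proj_ker[of x 0 j] that by (simp add: F_0)
  show "proj 0 (j + 1) (L j x) = Gr_L V L F 0 j (proj 0 j x)" if "x \<in> carrier (V j)"
    using proj_L[of x 0 j] that by (simp add: F_0)
  show "proj 1 j x = \<zero>\<^bsub>Gr V F 1 j\<^esub> \<longleftrightarrow> x \<in> F 2 j" if "x \<in> F 1 j"
    using proj_ker[OF that] by simp
  show "proj 1 (j + 1) (L j x) = Gr_L V L F 1 j (proj 1 j x)" if "x \<in> F 1 j" using proj_L[OF that] .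
next
  fix j z assume "z \<in> carrier (Gr V F 2 j)"
  then obtain x where x: "z = {x}" "x \<in> F 2 j" unfolding Gr_2_carrier by blast
  have "Gr_L V L F 2 j z = {L j x}" using proj_L[OF x(2)] x by (simp add: proj_2 F_L)
  then show "the_elem (Gr_L V L F 2 j z) = L j (the_elem z)" using x by simp
qed

lemma Gr_Lambda_eq:
  "Gr_Lambda E V L F n 0 = X.Q0.\<Lambda>" "Gr_Lambda E V L F n 1 = X.Q1.\<Lambda>" "Gr_Lambda E V L F n 2 = X.Q2.\<Lambda>"
  by (simp_all add: Gr_Lambda_def)

section \<open>The splitting assembled from its components\<close>

lemma Gr_sum_simps [simp]:
  "(x0, x1, x2) \<in> carrier (Gr_sum V F j) \<longleftrightarrow>
    x0 \<in> carrier (Gr V F 0 j) \<and> x1 \<in> carrier (Gr V F 1 j) \<and> x2 \<in> carrier (Gr V F 2 j)"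
  "(x0, x1, x2) \<oplus>\<^bsub>Gr_sum V F j\<^esub> (y0, y1, y2) =
    (x0 \<oplus>\<^bsub>Gr V F 0 j\<^esub> y0, x1 \<oplus>\<^bsub>Gr V F 1 j\<^esub> y1, x2 \<oplus>\<^bsub>Gr V F 2 j\<^esub> y2)"
  "a \<odot>\<^bsub>Gr_sum V F j\<^esub> (x0, x1, x2) =
    (a \<odot>\<^bsub>Gr V F 0 j\<^esub> x0, a \<odot>\<^bsub>Gr V F 1 j\<^esub> x1, a \<odot>\<^bsub>Gr V F 2 j\<^esub> x2)"
  by (simp_all add: Gr_sum_def direct_sum3_def)

text \<open>The \<open>restrict\<close> gives the extensionality that lets uniqueness be an equality
  of functions.\<close>

definition \<alpha> where
  "\<alpha> j = restrict (\<lambda>(x0, x1, x2). X.\<alpha>0 j x0 \<oplus>\<^bsub>V j\<^esub> (X.\<alpha>1 j x1 \<oplus>\<^bsub>V j\<^esub> the_elem x2)) (carrier (Gr_sum V F j))"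

lemma \<alpha>_eq:
  "x0 \<in> carrier (Gr V F 0 j) \<Longrightarrow> x1 \<in> carrier (Gr V F 1 j) \<Longrightarrow> x2 \<in> carrier (Gr V F 2 j) \<Longrightarrow>
    \<alpha> j (x0, x1, x2) = X.\<alpha>0 j x0 \<oplus>\<^bsub>V j\<^esub> (X.\<alpha>1 j x1 \<oplus>\<^bsub>V j\<^esub> the_elem x2)"
  by (simp add: \<alpha>_def)

lemma \<alpha>_linear: "\<alpha> j \<in> linear_maps E (Gr_sum V F j) (V j)"
proof (rule linear_mapsI)
  fix x assume x: "x \<in> carrier (Gr_sum V F j)"
  obtain x0 x1 x2 where x_eq: "x = (x0, x1, x2)" by (cases x) auto
  have xc: "x0 \<in> carrier (Gr V F 0 j)" "x1 \<in> carrier (Gr V F 1 j)" "x2 \<in> carrier (Gr V F 2 j)"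
    using x x_eq by auto
  show "\<alpha> j x \<in> carrier (V j)" unfolding x_eq \<alpha>_eq[OF xc]
    by (intro V.deg.M.add.m_closed X.\<alpha>0_closed X.\<alpha>1_closed X.\<iota>_closed[OF _ refl] xc)
  {
    fix y assume y: "y \<in> carrier (Gr_sum V F j)"
    obtain y0 y1 y2 where y_eq: "y = (y0, y1, y2)" by (cases y) auto
    have yc: "y0 \<in> carrier (Gr V F 0 j)" "y1 \<in> carrier (Gr V F 1 j)" "y2 \<in> carrier (Gr V F 2 j)"
      using y y_eq by auto
    show "\<alpha> j (x \<oplus>\<^bsub>Gr_sum V F j\<^esub> y) = \<alpha> j x \<oplus>\<^bsub>V j\<^esub> \<alpha> j y"
      unfolding x_eq y_eq Gr_sum_simps \<alpha>_eq[OF xc] \<alpha>_eq[OF yc]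
        \<alpha>_eq[OF X.Q0.deg.M.add.m_closed[OF xc(1) yc(1)] X.Q1.deg.M.add.m_closed[OF xc(2) yc(2)]
          X.Q2.deg.M.add.m_closed[OF xc(3) yc(3)]]
        X.\<alpha>0_add[OF xc(1) yc(1)] X.\<alpha>1_add[OF xc(2) yc(2)] X.\<iota>_add[OF xc(3) yc(3)]
      using X.\<alpha>0_closed[OF xc(1)] X.\<alpha>1_closed[OF xc(2)] X.\<iota>_closed[OF xc(3) refl]
        X.\<alpha>0_closed[OF yc(1)] X.\<alpha>1_closed[OF yc(2)] X.\<iota>_closed[OF yc(3) refl]
      by (simp add: V.deg.M.a_ac)
  next
    fix a assume a: "a \<in> carrier E"
    show "\<alpha> j (a \<odot>\<^bsub>Gr_sum V F j\<^esub> x) = a \<odot>\<^bsub>V j\<^esub> \<alpha> j x"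
      unfolding x_eq Gr_sum_simps \<alpha>_eq[OF xc]
        \<alpha>_eq[OF X.Q0.deg.smult_closed[OF a xc(1)] X.Q1.deg.smult_closed[OF a xc(2)]
          X.Q2.deg.smult_closed[OF a xc(3)]]
        linear_maps_smult[OF X.\<alpha>0_linear a xc(1)] linear_maps_smult[OF X.\<alpha>1_linear a xc(2)]
        linear_maps_smult[OF X.\<iota> a xc(3)]
      using a X.\<alpha>0_closed[OF xc(1)] X.\<alpha>1_closed[OF xc(2)] X.\<iota>_closed[OF xc(3) refl]
      by (simp add: V.deg.smult_r_distr)
  }
qed

text \<open>The components are peeled off: x0 is the class of v, x1 the class in G1 of what remains
  in F1, and the last remainder lies in F2. The three final clauses, on vanishing leading
  components, give that each \<open>F k\<close> is reached by its counterpart in the direct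
  sum.\<close>

lemma \<alpha>_decomposition:
  assumes v: "v \<in> carrier (V j)"
  obtains x0 x1 x2 where "x0 \<in> carrier (Gr V F 0 j)" "x1 \<in> carrier (Gr V F 1 j)"
    "x2 \<in> carrier (Gr V F 2 j)" "\<alpha> j (x0, x1, x2) = v"
    "v \<in> F 1 j \<Longrightarrow> x0 = \<zero>\<^bsub>Gr V F 0 j\<^esub>" "v \<in> F 2 j \<Longrightarrow> x1 = \<zero>\<^bsub>Gr V F 1 j\<^esub>"
    "v = \<zero>\<^bsub>V j\<^esub> \<Longrightarrow> x2 = \<zero>\<^bsub>Gr V F 2 j\<^esub>"
proof -
  define x0 where "x0 = proj 0 j v"
  define r where "r = v \<ominus>\<^bsub>V j\<^esub> X.\<alpha>0 j x0"
  define x1 where "x1 = proj 1 j r"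
  define s where "s = r \<ominus>\<^bsub>V j\<^esub> X.\<alpha>1 j x1"
  have x0: "x0 \<in> carrier (Gr V F 0 j)" unfolding x0_def by (rule X.p0_closed[OF v])
  note a0 = X.\<alpha>0_closed[OF x0]
  have r: "r \<in> carrier (V j)" using v a0 by (simp add: r_def)
  have "proj 0 j r = \<zero>\<^bsub>Gr V F 0 j\<^esub>"
    unfolding r_def X.p0_minus[OF v a0] X.p0_\<alpha>0[OF x0] using x0
    by (simp add: x0_def X.Q0.deg.minus_eq_0_iff)
  then have rF: "r \<in> F 1 j" using X.p0_ker[OF r] by simp
  have x1: "x1 \<in> carrier (Gr V F 1 j)" unfolding x1_def by (rule X.p1_closed[OF rF])
  note a1 = X.\<alpha>1_closed[OF x1]
  have "proj 1 j s = \<zero>\<^bsub>Gr V F 1 j\<^esub>"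
    unfolding s_def X.p1_minus[OF rF X.\<alpha>1_F1[OF x1]] X.p1_\<alpha>1[OF x1] using x1
    unfolding x1_def by (simp only: X.Q1.deg.minus_eq_0_iff)
  then have sF: "s \<in> F 2 j" using X.p1_ker[OF X.F1_minus[OF rF X.\<alpha>1_F1[OF x1]]] by (simp only: s_def)
  have x2: "{s} \<in> carrier (Gr V F 2 j)" using sF by (simp add: Gr_2_carrier)
  have "\<alpha> j (x0, x1, {s}) = X.\<alpha>0 j x0 \<oplus>\<^bsub>V j\<^esub> (X.\<alpha>1 j x1 \<oplus>\<^bsub>V j\<^esub> s)"
    unfolding \<alpha>_eq[OF x0 x1 x2] by simp
  also have "X.\<alpha>1 j x1 \<oplus>\<^bsub>V j\<^esub> s = r"
    using a1 r unfolding s_def by (simp add: a_minus_def V.deg.M.a_ac V.deg.M.r_neg V.deg.M.r_neg1 V.deg.M.r_neg2)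
  also have "X.\<alpha>0 j x0 \<oplus>\<^bsub>V j\<^esub> r = v"
    using a0 v unfolding r_def by (simp add: a_minus_def V.deg.M.a_ac V.deg.M.r_neg V.deg.M.r_neg1 V.deg.M.r_neg2)
  finally have v_eq: "\<alpha> j (x0, x1, {s}) = v" .
  have 1: "x0 = \<zero>\<^bsub>Gr V F 0 j\<^esub>" if "v \<in> F 1 j" using X.p0_ker[OF v] that by (simp add: x0_def)
  then have r_eq: "r = v" if "v \<in> F 1 j" using that v X.\<alpha>0_zero by (simp add: r_def a_minus_def)
  have 2: "x1 = \<zero>\<^bsub>Gr V F 1 j\<^esub>" if "v \<in> F 2 j"
  proof -
    have "v \<in> F 1 j" using that X.F2_F1 by blast
    then show ?thesis unfolding x1_def using X.p1_ker[OF rF] r_eq that by simp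
  qed
  have 3: "{s} = \<zero>\<^bsub>Gr V F 2 j\<^esub>" if "v = \<zero>\<^bsub>V j\<^esub>"
  proof -
    have "v \<in> F 1 j" "v \<in> F 2 j" using that F_zero by auto
    then have "s = \<zero>\<^bsub>V j\<^esub>" unfolding s_def using r_eq 2 X.\<alpha>1_zero that by (simp add: a_minus_def)
    then show ?thesis using X.\<iota>_eq_0[OF x2] by simp
  qed
  show thesis by (rule that[OF x0 x1 x2 v_eq 1 2 3])
qed

text \<open>\<open>\<alpha>1\<close> and \<iota> take values in F1, so \<open>p0\<close> recovers
  x0. On the rest \<open>p1\<close> recovers x1, as it kills the image of \<iota>, and \<iota> is
  injective.\<close>

lemma \<alpha>_injective: "inj_on (\<alpha> j) (carrier (Gr_sum V F j))"
proof (rule inj_onI)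
  fix x y assume xy: "x \<in> carrier (Gr_sum V F j)" "y \<in> carrier (Gr_sum V F j)" "\<alpha> j x = \<alpha> j y"
  obtain x0 x1 x2 y0 y1 y2 where eq: "x = (x0, x1, x2)" "y = (y0, y1, y2)" by (cases x, cases y) auto
  have xc: "x0 \<in> carrier (Gr V F 0 j)" "x1 \<in> carrier (Gr V F 1 j)" "x2 \<in> carrier (Gr V F 2 j)"
    and yc: "y0 \<in> carrier (Gr V F 0 j)" "y1 \<in> carrier (Gr V F 1 j)" "y2 \<in> carrier (Gr V F 2 j)"
    using xy eq by auto
  have p0: "proj 0 j (\<alpha> j (u0, u1, u2)) = u0" and
    r: "\<alpha> j (u0, u1, u2) = X.\<alpha>0 j u0 \<oplus>\<^bsub>V j\<^esub> (X.\<alpha>1 j u1 \<oplus>\<^bsub>V j\<^esub> the_elem u2)" and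
    p1: "proj 1 j (X.\<alpha>1 j u1 \<oplus>\<^bsub>V j\<^esub> the_elem u2) = u1"
    if u: "u0 \<in> carrier (Gr V F 0 j)" "u1 \<in> carrier (Gr V F 1 j)" "u2 \<in> carrier (Gr V F 2 j)"
    for u0 u1 u2
  proof -
    have F1: "X.\<alpha>1 j u1 \<oplus>\<^bsub>V j\<^esub> the_elem u2 \<in> F 1 j"
      by (rule X.F1_add[OF X.\<alpha>1_F1[OF u(2)] X.\<iota>_F1[OF u(3)]])
    show r: "\<alpha> j (u0, u1, u2) = X.\<alpha>0 j u0 \<oplus>\<^bsub>V j\<^esub> (X.\<alpha>1 j u1 \<oplus>\<^bsub>V j\<^esub> the_elem u2)" by (rule \<alpha>_eq[OF u])
    have "proj 0 j (X.\<alpha>1 j u1 \<oplus>\<^bsub>V j\<^esub> the_elem u2) = \<zero>\<^bsub>Gr V F 0 j\<^esub>"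
      using X.p0_ker[OF X.F1_carrier[OF F1]] F1 by blast
    then show "proj 0 j (\<alpha> j (u0, u1, u2)) = u0"
      unfolding r X.p0_add[OF X.\<alpha>0_closed[OF u(1)] X.F1_carrier[OF F1]] X.p0_\<alpha>0[OF u(1)]
      using u(1) by simp
    show "proj 1 j (X.\<alpha>1 j u1 \<oplus>\<^bsub>V j\<^esub> the_elem u2) = u1"
      unfolding X.p1_add[OF X.\<alpha>1_F1[OF u(2)] X.\<iota>_F1[OF u(3)]] X.p1_\<alpha>1[OF u(2)] X.p1_\<iota>[OF u(3)]
      using u(2) by (rule X.Q1.deg.M.r_zero)
  qed
  have 0: "x0 = y0" using p0[OF xc] p0[OF yc] xy(3) eq by metis
  have c: "X.\<alpha>1 j x1 \<in> carrier (V j)" "the_elem x2 \<in> carrier (V j)" "X.\<alpha>1 j y1 \<in> carrier (V j)"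
    "the_elem y2 \<in> carrier (V j)"
    using X.\<alpha>1_closed[OF xc(2)] X.\<alpha>1_closed[OF yc(2)] X.\<iota>_closed[OF xc(3) refl] X.\<iota>_closed[OF yc(3) refl] by auto
  have "X.\<alpha>0 j y0 \<oplus>\<^bsub>V j\<^esub> (X.\<alpha>1 j x1 \<oplus>\<^bsub>V j\<^esub> the_elem x2) =
      X.\<alpha>0 j y0 \<oplus>\<^bsub>V j\<^esub> (X.\<alpha>1 j y1 \<oplus>\<^bsub>V j\<^esub> the_elem y2)"
    using xy(3) r[OF xc] r[OF yc] eq 0 by simp
  then have "X.\<alpha>1 j x1 \<oplus>\<^bsub>V j\<^esub> the_elem x2 = X.\<alpha>1 j y1 \<oplus>\<^bsub>V j\<^esub> the_elem y2"
    using X.\<alpha>0_closed[OF yc(1)] c by simp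
  moreover from this have 1: "x1 = y1" using p1[OF xc] p1[OF yc] by metis
  ultimately have "the_elem x2 = the_elem y2" using c by simp
  then have "x2 = y2" using X.\<iota>_inj[of j] xc(3) yc(3) by (auto dest: inj_onD)
  then show "x = y" using eq 0 1 by simp
qed

lemma \<alpha>_iso: "\<alpha> j \<in> linear_isos E (Gr_sum V F j) (V j)"
proof -
  have "v \<in> \<alpha> j ` carrier (Gr_sum V F j)" if v: "v \<in> carrier (V j)" for v
  proof -
    obtain x0 x1 x2 where "x0 \<in> carrier (Gr V F 0 j)" "x1 \<in> carrier (Gr V F 1 j)"
      "x2 \<in> carrier (Gr V F 2 j)" "\<alpha> j (x0, x1, x2) = v" using \<alpha>_decomposition[OF v] by metis
    then show ?thesis by (intro rev_image_eqI[of "(x0, x1, x2)"]) auto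
  qed
  then have "bij_betw (\<alpha> j) (carrier (Gr_sum V F j)) (carrier (V j))"
    using \<alpha>_injective linear_maps_closed[OF \<alpha>_linear] by (auto simp: bij_betw_def)
  then show ?thesis using \<alpha>_linear by (simp add: linear_isos_def)
qed

lemma \<alpha>_filtration: "\<alpha> j ` Gr_sum_filtration V F k j = F k j"
proof
  show "\<alpha> j ` Gr_sum_filtration V F k j \<subseteq> F k j"
  proof
    fix v assume "v \<in> \<alpha> j ` Gr_sum_filtration V F k j"
    then obtain x0 x1 x2 where v: "v = \<alpha> j (x0, x1, x2)" and
      xc: "x0 \<in> carrier (Gr V F 0 j)" "x1 \<in> carrier (Gr V F 1 j)" "x2 \<in> carrier (Gr V F 2 j)" and
      x0: "0 < k \<Longrightarrow> x0 = \<zero>\<^bsub>Gr V F 0 j\<^esub>" and x1: "1 < k \<Longrightarrow> x1 = \<zero>\<^bsub>Gr V F 1 j\<^esub>" and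
      x2: "2 < k \<Longrightarrow> x2 = \<zero>\<^bsub>Gr V F 2 j\<^esub>"
      unfolding Gr_sum_filtration_def by auto
    have F1: "X.\<alpha>1 j x1 \<oplus>\<^bsub>V j\<^esub> the_elem x2 \<in> F 1 j"
      by (rule X.F1_add[OF X.\<alpha>1_F1[OF xc(2)] X.\<iota>_F1[OF xc(3)]])
    have k1: "v = X.\<alpha>1 j x1 \<oplus>\<^bsub>V j\<^esub> the_elem x2" if "0 < k"
      unfolding v \<alpha>_eq[OF xc] using x0[OF that] X.\<alpha>0_zero[of j] X.F1_carrier[OF F1]
      by simp
    have k2: "v = the_elem x2" if "1 < k"
    proof -
      have "0 < k" using that by simp
      then show ?thesis using k1 x1[OF that] X.\<alpha>1_zero[of j] X.\<iota>_closed[OF xc(3) refl]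
        by simp
    qed
    consider "k = 0" | "k = 1" | "k = 2" | "k \<ge> 3" by linarith
    then show "v \<in> F k j"
    proof cases
      case 1
      have "v \<in> carrier (V j)" unfolding v using linear_maps_closed[OF \<alpha>_linear] xc by simp
      then show ?thesis using 1 F_0 by simp
    next
      case 2
      then show ?thesis using k1 F1 by simp
    next
      case 3
      then show ?thesis using k2 X.\<iota>_F2[OF xc(3)] by simp
    next
      case 4
      then have "v = the_elem \<zero>\<^bsub>Gr V F 2 j\<^esub>" using k2 x2 by simp
      then show ?thesis using X.\<iota>_zero[of j] F_zero by simp
    qed
  qed
  show "F k j \<subseteq> \<alpha> j ` Gr_sum_filtration V F k j"
  proof
    fix v assume v: "v \<in> F k j"
    obtain x0 x1 x2 where x: "x0 \<in> carrier (Gr V F 0 j)" "x1 \<in> carrier (Gr V F 1 j)"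
      "x2 \<in> carrier (Gr V F 2 j)" "\<alpha> j (x0, x1, x2) = v"
      "v \<in> F 1 j \<Longrightarrow> x0 = \<zero>\<^bsub>Gr V F 0 j\<^esub>" "v \<in> F 2 j \<Longrightarrow> x1 = \<zero>\<^bsub>Gr V F 1 j\<^esub>"
      "v = \<zero>\<^bsub>V j\<^esub> \<Longrightarrow> x2 = \<zero>\<^bsub>Gr V F 2 j\<^esub>" using \<alpha>_decomposition[OF F_carrier[OF v]] by metis
    have F3: "v = \<zero>\<^bsub>V j\<^esub>" if "2 < k" using v F_ge_3[of k j] that by simp
    have F2: "v \<in> F 2 j" if "1 < k"
    proof (cases "k = 2")
      case False
      then show ?thesis using F3 that F_zero by simp
    qed (use v in simp)
    have F1: "v \<in> F 1 j" if "0 < k"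
    proof (cases "k = 1")
      case False
      then show ?thesis using F2 that X.F2_F1 by auto
    qed (use v in simp)
    have "(x0, x1, x2) \<in> Gr_sum_filtration V F k j"
      unfolding Gr_sum_filtration_def using x F1 F2 F3 by simp
    then show "v \<in> \<alpha> j ` Gr_sum_filtration V F k j" using x(4) by blast
  qed
qed

section \<open>Restrictions to the graded quotients and the two conditions\<close>

lemma restr_Gr_\<alpha>:
  "x \<in> carrier (Gr V F 0 j) \<Longrightarrow> restr_Gr V F \<alpha> 0 j x = X.\<alpha>0 j x"
  "y \<in> carrier (Gr V F 1 j) \<Longrightarrow> restr_Gr V F \<alpha> 1 j y = X.\<alpha>1 j y"
  "z \<in> carrier (Gr V F 2 j) \<Longrightarrow> restr_Gr V F \<alpha> 2 j z = the_elem z"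
proof -
  have 0: "X.\<alpha>0 j \<zero>\<^bsub>Gr V F 0 j\<^esub> = \<zero>\<^bsub>V j\<^esub>" "X.\<alpha>1 j \<zero>\<^bsub>Gr V F 1 j\<^esub> = \<zero>\<^bsub>V j\<^esub>" "the_elem \<zero>\<^bsub>Gr V F 2 j\<^esub> = \<zero>\<^bsub>V j\<^esub>"
    by (rule X.\<alpha>0_zero X.\<alpha>1_zero X.\<iota>_zero)+
  note z = X.Q0.deg.M.zero_closed[of j] X.Q1.deg.M.zero_closed[of j] X.Q2.deg.M.zero_closed[of j]
  show "restr_Gr V F \<alpha> 0 j x = X.\<alpha>0 j x" if x: "x \<in> carrier (Gr V F 0 j)"
    unfolding restr_Gr_def Gr_incl_def using \<alpha>_eq[OF x z(2,3)] 0 X.\<alpha>0_closed[OF x]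
    by simp
  show "restr_Gr V F \<alpha> 1 j y = X.\<alpha>1 j y" if y: "y \<in> carrier (Gr V F 1 j)"
    unfolding restr_Gr_def Gr_incl_def using \<alpha>_eq[OF z(1) y z(3)] 0 X.\<alpha>1_closed[OF y]
    by simp
  show "restr_Gr V F \<alpha> 2 j z = the_elem z" if z': "z \<in> carrier (Gr V F 2 j)" for z
    unfolding restr_Gr_def Gr_incl_def using \<alpha>_eq[OF z(1,2) z'] 0 X.\<iota>_closed[OF z' refl]
    by simp
qed

lemma \<alpha>_filtered_splitting: "filtered_splitting E V F \<alpha>"
proof -
  have "F (i + 1) j +>\<^bsub>V j\<^esub> restr_Gr V F \<alpha> i j x = x" if i: "i \<le> 2" and x: "x \<in> carrier (Gr V F i j)" for i j x
  proof -
    consider "i = 0" | "i = 1" | "i = 2" using i by linarith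
    then have "proj i j (restr_Gr V F \<alpha> i j x) = x"
    proof cases
      case 1
      have "proj 0 j (restr_Gr V F \<alpha> 0 j x) = x"
        using x unfolding 1 by (simp only: restr_Gr_\<alpha> X.p0_\<alpha>0)
      then show ?thesis unfolding 1 .
    next
      case 2
      have "proj 1 j (restr_Gr V F \<alpha> 1 j x) = x"
        using x unfolding 2 by (simp only: restr_Gr_\<alpha> X.p1_\<alpha>1)
      then show ?thesis unfolding 2 .
    next
      case 3
      obtain y where y: "x = {y}" "y \<in> F 2 j" using x unfolding 3 Gr_2_carrier by blast
      have "proj 2 j (restr_Gr V F \<alpha> 2 j x) = x"
        using x y unfolding 3 by (simp add: restr_Gr_\<alpha> proj_2)
      then show ?thesis unfolding 3 .
    qed
    then show ?thesis by (simp add: proj_def)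
  qed
  moreover have "\<alpha> j \<in> extensional (carrier (Gr_sum V F j))" for j by (simp add: \<alpha>_def)
  ultimately show ?thesis using \<alpha>_iso \<alpha>_filtration by (simp add: filtered_splitting_def)
qed

text \<open>The defect of \<open>\<alpha>0\<close> is -\<iota> \<beta> x for L, which lies in the
  image of G2, and zero for \<Lambda>.\<close>

lemma \<alpha>_adapted: "adapted_splitting E V L F n \<alpha>"
  unfolding adapted_splitting_def
proof (intro conjI allI ballI)
  show "filtered_splitting E V F \<alpha>" by (rule \<alpha>_filtered_splitting)
  fix j x
  show "restr_Gr V F \<alpha> 1 (j + 1) (Gr_L V L F 1 j x) = L j (restr_Gr V F \<alpha> 1 j x)"
    if x: "x \<in> carrier (Gr V F 1 j)"
    unfolding restr_Gr_\<alpha>(2)[OF x] restr_Gr_\<alpha>(2)[OF X.Q1.L_closed[OF x refl]] by (rule X.\<alpha>1_L[OF x])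
  assume x: "x \<in> carrier (Gr V F 0 j)"
  note Lx = X.Q0.L_closed[OF x refl] and \<Lambda>x = X.Q0.Lambda_closed[OF x refl]
  have \<beta>x: "X.\<beta> j x \<in> carrier (Gr V F 2 (j + 1))" by (rule X.\<beta>_closed[OF x refl])
  have m\<beta>x: "\<ominus>\<^bsub>Gr V F 2 (j + 1)\<^esub> X.\<beta> j x \<in> carrier (Gr V F 2 (j + 1))" using \<beta>x by simp
  have "restr_Gr V F \<alpha> 0 (j + 1) (Gr_L V L F 0 j x) \<ominus>\<^bsub>V (j + 1)\<^esub> L j (restr_Gr V F \<alpha> 0 j x) =
      \<ominus>\<^bsub>V (j + 1)\<^esub> the_elem (X.\<beta> j x)"
    unfolding restr_Gr_\<alpha>(1)[OF x] restr_Gr_\<alpha>(1)[OF Lx] X.L_\<alpha>0[OF x]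
    using X.\<alpha>0_closed[OF Lx] X.\<iota>_closed[OF \<beta>x refl]
    by (simp add: a_minus_def V.deg.M.minus_add V.deg.M.r_neg1 V.deg.M.r_neg2)
  also have "\<dots> = restr_Gr V F \<alpha> 2 (j + 1) (\<ominus>\<^bsub>Gr V F 2 (j + 1)\<^esub> X.\<beta> j x)"
    unfolding restr_Gr_\<alpha>(3)[OF m\<beta>x]
    by (rule linear_maps_a_inv[OF X.Q2.module_component V.module_component X.\<iota> \<beta>x, symmetric])
  finally show "restr_Gr V F \<alpha> 0 (j + 1) (Gr_L V L F 0 j x) \<ominus>\<^bsub>V (j + 1)\<^esub> L j (restr_Gr V F \<alpha> 0 j x)
      \<in> restr_Gr V F \<alpha> 2 (j + 1) ` carrier (Gr V F 2 (j + 1))"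
    using m\<beta>x by blast
  have "restr_Gr V F \<alpha> 0 (j - 1) (Gr_Lambda E V L F n 0 j x)
      \<ominus>\<^bsub>V (j - 1)\<^esub> Lambda_op E V L (n + 1) j (restr_Gr V F \<alpha> 0 j x) = \<zero>\<^bsub>V (j - 1)\<^esub>"
    unfolding Gr_Lambda_eq restr_Gr_\<alpha>(1)[OF x] restr_Gr_\<alpha>(1)[OF \<Lambda>x] X.Lambda_\<alpha>0[OF x]
    using X.\<alpha>0_closed[OF \<Lambda>x] by (simp add: V.deg.minus_eq_0_iff)
  also have "\<dots> = restr_Gr V F \<alpha> 1 (j - 1) \<zero>\<^bsub>Gr V F 1 (j - 1)\<^esub>"
    unfolding restr_Gr_\<alpha>(2)[OF X.Q1.deg.M.zero_closed] by (rule X.\<alpha>1_zero[symmetric])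
  finally show "restr_Gr V F \<alpha> 0 (j - 1) (Gr_Lambda E V L F n 0 j x)
      \<ominus>\<^bsub>V (j - 1)\<^esub> Lambda_op E V L (n + 1) j (restr_Gr V F \<alpha> 0 j x)
      \<in> restr_Gr V F \<alpha> 1 (j - 1) ` carrier (Gr V F 1 (j - 1))"
    using X.Q1.deg.M.zero_closed by blast
qed

text \<open>The restrictions of \<alpha>' to G0 and G1 satisfy the hypotheses of the uniqueness
  results for \<open>X.\<alpha>0\<close> and \<open>X.\<alpha>1\<close>. A linear map on the direct
  sum is determined by its restrictions, and extensionality settles the remaining arguments.\<close>

lemma \<alpha>_unique:
  assumes adapted: "adapted_splitting E V L F n \<alpha>'"
  shows "\<alpha>' = \<alpha>"
proof
  fix j
  note z = X.Q0.deg.M.zero_closed X.Q1.deg.M.zero_closed X.Q2.deg.M.zero_closed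
  have splitting: "filtered_splitting E V F \<alpha>'" using adapted by (simp add: adapted_splitting_def)
  have lin: "\<alpha>' j \<in> linear_maps E (Gr_sum V F j) (V j)" for j
    using splitting by (auto simp: filtered_splitting_def linear_isos_def)
  have section_of: "proj i j (restr_Gr V F \<alpha>' i j x) = x" if "i \<le> 2" "x \<in> carrier (Gr V F i j)" for i j x
    using splitting that by (simp add: filtered_splitting_def proj_def)
  have incl: "Gr_incl V F i j x \<in> carrier (Gr_sum V F j)" if "x \<in> carrier (Gr V F i j)" for i j x
    using that z unfolding Gr_incl_def by auto
  have incl_lin: "Gr_incl V F i j \<in> linear_maps E (Gr V F i j) (Gr_sum V F j)" for i j
    using z by (intro linear_mapsI incl) (auto simp: Gr_incl_def)
  have restr_lin: "restr_Gr V F \<alpha>' i j \<in> linear_maps E (Gr V F i j) (V j)" for i j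
    unfolding restr_Gr_def[abs_def] by (rule linear_maps_comp[OF incl_lin lin])
  have restr_F: "restr_Gr V F \<alpha>' i j x \<in> F i j" if "i \<le> 2" "x \<in> carrier (Gr V F i j)" for i j x
  proof -
    have "Gr_incl V F i j x \<in> Gr_sum_filtration V F i j"
      using incl[OF that(2)] that(1) by (auto simp: Gr_sum_filtration_def Gr_incl_def)
    moreover have "\<alpha>' j ` Gr_sum_filtration V F i j = F i j"
      using splitting by (simp add: filtered_splitting_def)
    ultimately show ?thesis unfolding restr_Gr_def by blast
  qed
  \<comment> \<open>On G2, inducing the identity modulo \<open>F 3\<close>, which is zero, already
    means being the inclusion.\<close>
  have 2: "restr_Gr V F \<alpha>' 2 j x = the_elem x" if x: "x \<in> carrier (Gr V F 2 j)" for j x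
    using section_of[OF _ x] proj_2[OF restr_F[OF _ x]] by (metis order_refl the_elem_eq)
  have 1: "restr_Gr V F \<alpha>' 1 j x = X.\<alpha>1 j x" if x: "x \<in> carrier (Gr V F 1 j)" for j x
  proof (rule X.\<alpha>1_unique[OF restr_lin _ _ _ x])
    show "restr_Gr V F \<alpha>' 1 j x \<in> F 1 j" if "x \<in> carrier (Gr V F 1 j)" for j x
      by (rule restr_F[OF _ that]) simp
    show "proj 1 j (restr_Gr V F \<alpha>' 1 j x) = x" if "x \<in> carrier (Gr V F 1 j)" for j x
      by (rule section_of[OF _ that]) simp
    show "restr_Gr V F \<alpha>' 1 (j + 1) (Gr_L V L F 1 j x) = L j (restr_Gr V F \<alpha>' 1 j x)"
      if "x \<in> carrier (Gr V F 1 j)" for j x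
      using adapted that unfolding adapted_splitting_def by blast
  qed
  have 0: "restr_Gr V F \<alpha>' 0 j x = X.\<alpha>0 j x" if x: "x \<in> carrier (Gr V F 0 j)" for j x
  proof (rule X.\<alpha>0_unique[OF restr_lin _ _ _ x])
    fix j x assume x: "x \<in> carrier (Gr V F 0 j)"
    show "proj 0 j (restr_Gr V F \<alpha>' 0 j x) = x" by (rule section_of[OF _ x]) simp
    have "restr_Gr V F \<alpha>' 0 (j + 1) (Gr_L V L F 0 j x) \<ominus>\<^bsub>V (j + 1)\<^esub> L j (restr_Gr V F \<alpha>' 0 j x)
        \<in> restr_Gr V F \<alpha>' 2 (j + 1) ` carrier (Gr V F 2 (j + 1))"
      using adapted x unfolding adapted_splitting_def by blast
    then show "restr_Gr V F \<alpha>' 0 (j + 1) (Gr_L V L F 0 j x) \<ominus>\<^bsub>V (j + 1)\<^esub> L j (restr_Gr V F \<alpha>' 0 j x) \<in> F 2 (j + 1)"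
      using restr_F[of 2] by auto
    have "restr_Gr V F \<alpha>' 0 (j - 1) (Gr_Lambda E V L F n 0 j x)
          \<ominus>\<^bsub>V (j - 1)\<^esub> Lambda_op E V L (n + 1) j (restr_Gr V F \<alpha>' 0 j x)
        \<in> restr_Gr V F \<alpha>' 1 (j - 1) ` carrier (Gr V F 1 (j - 1))"
      using adapted x unfolding adapted_splitting_def by blast
    then show "restr_Gr V F \<alpha>' 0 (j - 1) (X.Q0.\<Lambda> j x)
        \<ominus>\<^bsub>V (j - 1)\<^esub> Lambda_op E V L (n + 1) j (restr_Gr V F \<alpha>' 0 j x) \<in> F 1 (j - 1)"
      using restr_F[of 1] unfolding Gr_Lambda_eq by auto
  qed
  have "\<alpha>' j (x0, x1, x2) = \<alpha> j (x0, x1, x2)"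
    if x: "x0 \<in> carrier (Gr V F 0 j)" "x1 \<in> carrier (Gr V F 1 j)" "x2 \<in> carrier (Gr V F 2 j)" for x0 x1 x2
  proof -
    have i12: "Gr_incl V F 1 j x1 \<oplus>\<^bsub>Gr_sum V F j\<^esub> Gr_incl V F 2 j x2 = (\<zero>\<^bsub>Gr V F 0 j\<^esub>, x1, x2)"
      and i: "Gr_incl V F 0 j x0 \<oplus>\<^bsub>Gr_sum V F j\<^esub> (\<zero>\<^bsub>Gr V F 0 j\<^esub>, x1, x2) = (x0, x1, x2)"
      using x z by (simp_all add: Gr_incl_def)
    have "\<alpha>' j (\<zero>\<^bsub>Gr V F 0 j\<^esub>, x1, x2) = X.\<alpha>1 j x1 \<oplus>\<^bsub>V j\<^esub> the_elem x2"
      using linear_maps_add[OF lin incl[OF x(2)] incl[OF x(3)]] 1[OF x(2)] 2[OF x(3)]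
      by (simp only: i12 restr_Gr_def)
    moreover have "(\<zero>\<^bsub>Gr V F 0 j\<^esub>, x1, x2) \<in> carrier (Gr_sum V F j)" using x z by simp
    ultimately have "\<alpha>' j (x0, x1, x2) = X.\<alpha>0 j x0 \<oplus>\<^bsub>V j\<^esub> (X.\<alpha>1 j x1 \<oplus>\<^bsub>V j\<^esub> the_elem x2)"
      using linear_maps_add[OF lin incl[OF x(1)], of "(\<zero>\<^bsub>Gr V F 0 j\<^esub>, x1, x2)"] 0[OF x(1)]
      by (simp only: i restr_Gr_def)
    then show ?thesis by (simp only: \<alpha>_eq[OF x])
  qed
  then have "\<alpha>' j x = \<alpha> j x" if "x \<in> carrier (Gr_sum V F j)" for x
    using that by (cases x) auto
  moreover have "\<alpha>' j \<in> extensional (carrier (Gr_sum V F j))" "\<alpha> j \<in> extensional (carrier (Gr_sum V F j))"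
    using splitting by (auto simp: filtered_splitting_def \<alpha>_def)
  ultimately show "\<alpha>' j = \<alpha> j" by (meson extensionalityI)
qed

section \<open>The matrices of L and \<Lambda>\<close>

lemma L_\<alpha>:
  assumes x: "x0 \<in> carrier (Gr V F 0 j)" "x1 \<in> carrier (Gr V F 1 j)" "x2 \<in> carrier (Gr V F 2 j)"
  shows "L j (\<alpha> j (x0, x1, x2)) = \<alpha> (j + 1) (Gr_L V L F 0 j x0, Gr_L V L F 1 j x1,
    X.\<beta> j x0 \<oplus>\<^bsub>Gr V F 2 (j + 1)\<^esub> Gr_L V L F 2 j x2)"
proof -
  note a = X.\<alpha>0_closed[OF x(1)] X.\<alpha>1_closed[OF x(2)] X.\<iota>_closed[OF x(3) refl]
  note Lx = X.Q0.L_closed[OF x(1) refl] X.Q1.L_closed[OF x(2) refl] X.Q2.L_closed[OF x(3) refl]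
  note \<beta>x = X.\<beta>_closed[OF x(1) refl]
  note aL = X.\<alpha>0_closed[OF Lx(1)] X.\<alpha>1_closed[OF Lx(2)] X.\<iota>_closed[OF Lx(3) refl] X.\<iota>_closed[OF \<beta>x refl]
  have "L j (\<alpha> j (x0, x1, x2)) =
      L j (X.\<alpha>0 j x0) \<oplus>\<^bsub>V (j + 1)\<^esub> (L j (X.\<alpha>1 j x1) \<oplus>\<^bsub>V (j + 1)\<^esub> L j (the_elem x2))"
    unfolding \<alpha>_eq[OF x] V.L_add[OF a(1) V.deg.M.add.m_closed[OF a(2,3)]] V.L_add[OF a(2,3)] ..
  also have "\<dots> = (X.\<alpha>0 (j + 1) (Gr_L V L F 0 j x0) \<oplus>\<^bsub>V (j + 1)\<^esub> the_elem (X.\<beta> j x0)) \<oplus>\<^bsub>V (j + 1)\<^esub>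
      (X.\<alpha>1 (j + 1) (Gr_L V L F 1 j x1) \<oplus>\<^bsub>V (j + 1)\<^esub> the_elem (Gr_L V L F 2 j x2))"
    by (simp only: X.L_\<alpha>0[OF x(1)] X.\<alpha>1_L[OF x(2)] X.\<iota>_L[OF x(3)])
  also have "\<dots> = X.\<alpha>0 (j + 1) (Gr_L V L F 0 j x0) \<oplus>\<^bsub>V (j + 1)\<^esub> (X.\<alpha>1 (j + 1) (Gr_L V L F 1 j x1) \<oplus>\<^bsub>V (j + 1)\<^esub>
      (the_elem (X.\<beta> j x0) \<oplus>\<^bsub>V (j + 1)\<^esub> the_elem (Gr_L V L F 2 j x2)))"
    using aL by (simp add: V.deg.M.a_ac)
  finally show ?thesis
    unfolding \<alpha>_eq[OF Lx(1,2) X.Q2.deg.M.add.m_closed[OF \<beta>x Lx(3)]] X.\<iota>_add[OF \<beta>x Lx(3)] .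
qed

text \<open>\<Lambda> commutes with \<open>X.\<alpha>0\<close> and \<open>X.\<alpha>1\<close>, so
  the one off-diagonal entry comes from \<open>X.Lambda_\<iota>\<close>, where \<open>X.c\<close> is
  the inverse of \<beta>.\<close>

lemma Lambda_\<alpha>:
  assumes x: "x0 \<in> carrier (Gr V F 0 j)" "x1 \<in> carrier (Gr V F 1 j)" "x2 \<in> carrier (Gr V F 2 j)"
  shows "V.\<Lambda> j (\<alpha> j (x0, x1, x2)) = \<alpha> (j - 1)
    (X.Q0.\<Lambda> j x0 \<oplus>\<^bsub>Gr V F 0 (j - 1)\<^esub> inv_into (carrier (Gr V F 0 (j - 1))) (X.\<beta> (j - 1)) x2,
     X.Q1.\<Lambda> j x1, X.Q2.\<Lambda> j x2)"
proof -
  note a = X.\<alpha>0_closed[OF x(1)] X.\<alpha>1_closed[OF x(2)] X.\<iota>_closed[OF x(3) refl]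
  note \<Lambda>x = X.Q0.Lambda_closed[OF x(1) refl] X.Q1.Lambda_closed[OF x(2) refl] X.Q2.Lambda_closed[OF x(3) refl]
  note cx = X.c_closed[OF x(3)]
  note a\<Lambda> = X.\<alpha>0_closed[OF \<Lambda>x(1)] X.\<alpha>1_closed[OF \<Lambda>x(2)] X.\<iota>_closed[OF \<Lambda>x(3) refl] X.\<alpha>0_closed[OF cx]
  note \<Lambda>_add = linear_maps_add[OF V.Lambda_linear]
  have "V.\<Lambda> j (\<alpha> j (x0, x1, x2)) =
      V.\<Lambda> j (X.\<alpha>0 j x0) \<oplus>\<^bsub>V (j - 1)\<^esub> (V.\<Lambda> j (X.\<alpha>1 j x1) \<oplus>\<^bsub>V (j - 1)\<^esub> V.\<Lambda> j (the_elem x2))"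
    unfolding \<alpha>_eq[OF x] \<Lambda>_add[OF a(1) V.deg.M.add.m_closed[OF a(2,3)]] \<Lambda>_add[OF a(2,3)] ..
  also have "\<dots> = X.\<alpha>0 (j - 1) (X.Q0.\<Lambda> j x0) \<oplus>\<^bsub>V (j - 1)\<^esub> (X.\<alpha>1 (j - 1) (X.Q1.\<Lambda> j x1) \<oplus>\<^bsub>V (j - 1)\<^esub>
      (X.\<alpha>0 (j - 1) (X.c j x2) \<oplus>\<^bsub>V (j - 1)\<^esub> the_elem (X.Q2.\<Lambda> j x2)))"
    by (simp only: X.Lambda_\<alpha>0[OF x(1)] X.Lambda_\<alpha>1[OF x(2)] X.Lambda_\<iota>[OF x(3)])
  also have "\<dots> = (X.\<alpha>0 (j - 1) (X.Q0.\<Lambda> j x0) \<oplus>\<^bsub>V (j - 1)\<^esub> X.\<alpha>0 (j - 1) (X.c j x2)) \<oplus>\<^bsub>V (j - 1)\<^esub>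
      (X.\<alpha>1 (j - 1) (X.Q1.\<Lambda> j x1) \<oplus>\<^bsub>V (j - 1)\<^esub> the_elem (X.Q2.\<Lambda> j x2))"
    using a\<Lambda> by (simp add: V.deg.M.a_ac)
  finally show ?thesis
    unfolding X.inv_\<beta>[OF x(3)] \<alpha>_eq[OF X.Q0.deg.M.add.m_closed[OF \<Lambda>x(1) cx] \<Lambda>x(2,3)]
      X.\<alpha>0_add[OF \<Lambda>x(1) cx] .
qed

end

theorem theorem1p2p1:
  fixes E :: "('e, 'r) ring_scheme"
    and V :: "int \<Rightarrow> ('e, 'v) module"
    and L :: "int \<Rightarrow> 'v \<Rightarrow> 'v"
    and F :: "nat \<Rightarrow> int \<Rightarrow> 'v set"
    and n :: int
  assumes "field E"
    and "\<forall>k::nat. add_pow E k \<one>\<^bsub>E\<^esub> = \<zero>\<^bsub>E\<^esub> \<longrightarrow> k = 0"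
    and "lefschetz_module E V L (n + 1)"
    and "three_step_filtration E V L F"
    and "\<forall>i\<le>2. lefschetz_module E (Gr V F i) (Gr_L V L F i) (n + int i)"
  shows "\<exists>\<alpha>. adapted_splitting E V L F n \<alpha> \<and>
    (\<forall>\<alpha>'. adapted_splitting E V L F n \<alpha>' \<longrightarrow> \<alpha>' = \<alpha>) \<and>
    (\<exists>\<beta>. (\<forall>j. \<beta> j \<in> linear_isos E (Gr V F 0 j) (Gr V F 2 (j + 1))) \<and>
      (\<forall>j. \<forall>x \<in> carrier (Gr V F 0 j).
        \<beta> (j + 1) (Gr_L V L F 0 j x) = Gr_L V L F 2 (j + 1) (\<beta> j x)) \<and>
      (\<forall>j. \<forall>x0 \<in> carrier (Gr V F 0 j). \<forall>x1 \<in> carrier (Gr V F 1 j). \<forall>x2 \<in> carrier (Gr V F 2 j).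
        L j (\<alpha> j (x0, x1, x2)) =
          \<alpha> (j + 1)
            (Gr_L V L F 0 j x0,
             Gr_L V L F 1 j x1,
             \<beta> j x0 \<oplus>\<^bsub>Gr V F 2 (j + 1)\<^esub> Gr_L V L F 2 j x2) \<and>
        Lambda_op E V L (n + 1) j (\<alpha> j (x0, x1, x2)) =
          \<alpha> (j - 1)
            (Gr_Lambda E V L F n 0 j x0 \<oplus>\<^bsub>Gr V F 0 (j - 1)\<^esub>
               inv_into (carrier (Gr V F 0 (j - 1))) (\<beta> (j - 1)) x2,
             Gr_Lambda E V L F n 1 j x1,
             Gr_Lambda E V L F n 2 j x2)))"
proof -
  interpret filtered_lefschetz E V L F n
    by (rule filtered_lefschetz.intro) (use assms in blast)+
  show ?thesis
  proof (intro exI[of _ \<alpha>] exI[of _ X.\<beta>] conjI allI impI ballI)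
    show "adapted_splitting E V L F n \<alpha>" by (rule \<alpha>_adapted)
    show "\<alpha>' = \<alpha>" if "adapted_splitting E V L F n \<alpha>'" for \<alpha>' using that by (rule \<alpha>_unique)
    show "X.\<beta> j \<in> linear_isos E (Gr V F 0 j) (Gr V F 2 (j + 1))" for j by (rule X.\<beta>_iso)
  qed (simp_all only: X.\<beta>_L L_\<alpha> Lambda_\<alpha> Gr_Lambda_eq)
qed

end
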